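(* Let $G$ be a graph with $n\ge 3$ vertices. If $n$ is even or if the rank of $W^G$ over $\mathbb{F}_2$ is less than $\lceil\frac n2\rceil$, then the constant coefficient of $\phi^G\pmod 4$, as well as $\phi^{\overline{G}}\pmod 4$, can be reconstructed from the polynomial deck of $G$. That is: under this hypothesis on $G$, if $H$ is any graph on $n$ vertices with the same polynomial deck as $G$, then $\phi^G(0)\equiv\phi^H(0)\pmod 4$ and $\phi^{\overline{G}}\equiv\phi^{\overline{H}}\pmod 4$ (coefficientwise).
   Context: Graphs are finite, simple and undirected. For a graph $G$ with vertex set $[n]=\{1,\dots,n\}$ and adjacency matrix $A$, the characteristic polynomial is $\phi^G(x)=\det(xI-A)\in\mathbb{Z}[x]$. $\overline{G}$ denotes the complement of $G$ and $G\setminus i$ the graph obtained by deleting vertex $i$. The polynomial deck of $G$ is the multiset $\{\phi^{G\setminus i}\}_{i\in[n]}$. The walk matrix is $W^G=(\mathbf{1}\ \ A\mathbf{1}\ \ \cdots\ \ A^{n-1}\mathbf{1})$, where $\mathbf{1}$ is the all-ones vector; its rank over $\mathbb{F}_2$ is the rank of its entrywise reduction modulo $2$. *)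

theory Defs
  imports
    "Graph_Theory.Digraph"
    "Jordan_Normal_Form.Char_Poly"
    "Jordan_Normal_Form.DL_Rank"
    "HOL-Library.Multiset"
    "HOL-Library.Z2"
    "HOL-Number_Theory.Cong"
begin

text \<open>A finite simple undirected graph is an instance of the locale \<^locale>\<open>graph\<close>: a finite,
  loop-free, symmetric digraph without multiple arcs, each edge being a pair of opposite arcs.
  Vertices are linearly ordered, and rows and columns of the matrices follow that order, so that
  induced subgraphs such as \<^term>\<open>pre_digraph.del_vert G v\<close> again have an adjacency matrix.\<close>

definition adj_matrix :: "('a::linorder, 'b) pre_digraph \<Rightarrow> int mat" where
  "adj_matrix G = (let vs = sorted_list_of_set (verts G) in
     mat (length vs) (length vs) (\<lambda>(i, j). if (vs ! i, vs ! j) \<in> arcs_ends G then 1 else 0))"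

definition graph_char_poly :: "('a::linorder, 'b) pre_digraph \<Rightarrow> int poly" where
  "graph_char_poly G = char_poly (adj_matrix G)"

definition graph_complement :: "('a, 'b) pre_digraph \<Rightarrow> ('a, 'a \<times> 'a) pre_digraph" where
  "graph_complement G =
     \<lparr> verts = verts G,
       arcs = {(u, v). u \<in> verts G \<and> v \<in> verts G \<and> u \<noteq> v \<and> (u, v) \<notin> arcs_ends G},
       tail = fst, head = snd \<rparr>"

definition poly_deck :: "('a::linorder, 'b) pre_digraph \<Rightarrow> int poly multiset" where
  "poly_deck G =
     image_mset (\<lambda>v. graph_char_poly (pre_digraph.del_vert G v)) (mset_set (verts G))"

definition walk_matrix :: "('a::linorder, 'b) pre_digraph \<Rightarrow> int mat" where
  "walk_matrix G = (let n = card (verts G) in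
     mat_of_cols n (map (\<lambda>k. (adj_matrix G ^\<^sub>m k) *\<^sub>v vec n (\<lambda>_. 1)) [0..<n]))"

definition walk_rank_F2 :: "('a::linorder, 'b) pre_digraph \<Rightarrow> nat" where
  "walk_rank_F2 G =
     vec_space.rank (card (verts G)) (map_mat (of_int :: int \<Rightarrow> bit) (walk_matrix G))"

end

theory Submission
  imports Defs "HOL-Algebra.Algebraic_Closure_Type"
begin

text \<open>
  Let \<open>A\<close> be the adjacency matrix, \<open>F = det (tI - A)\<close>, \<open>a = adj (tI - A)\<close>, and let \<open>\<Omega>\<close> be
  the sum of all entries of \<open>a\<close>. The members of the deck are the diagonal entries of \<open>a\<close>, so
  after relabelling one graph two graphs with the same deck have the same diagonal entries;
  their traces are the derivatives of the characteristic polynomials, which hence differ by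
  an integer \<open>c\<close> only. The aim is \<open>4 dvd c\<close>. The complement then follows: its characteristic
  polynomial is, up to sign, \<open>F + \<Omega>\<close> at \<open>-1 - t\<close> (\<open>char_poly_complement\<close>), and computing the
  trace of \<open>a\<^sup>2\<close> shows that an even \<open>c\<close> already determines \<open>\<Omega>\<close> modulo 4 (\<open>\<Omega>_cong\<close>).

  Modulo 2 the matrix \<open>A\<close> is alternating, so \<open>F a\<^sub>i\<^sub>i\<close> is congruent to \<open>t r\<^sub>i\<^sup>2\<close> with \<open>r\<^sub>i\<close>
  the sum of row \<open>i\<close> of \<open>a\<close>. Every polynomial over the field with two elements is
  \<open>u\<^sup>2 + t v\<^sup>2\<close> for unique \<open>u\<close> and \<open>v\<close>; comparing such decompositions, the deck determines
  the row sums modulo 2 up to the square root of \<open>F\<close> or \<open>F / t\<close>. If \<open>n\<close> is even then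
  \<open>F = p\<^sup>2\<close>, \<open>a\<^sub>i\<^sub>i = t d\<^sub>i\<^sup>2\<close> and \<open>r\<^sub>i = p d\<^sub>i\<close> modulo 2; if \<open>n\<close> is odd then \<open>F = t e\<^sup>2\<close>,
  \<open>a\<^sub>i\<^sub>i = k\<^sub>i\<^sup>2\<close> and \<open>r\<^sub>i = e k\<^sub>i\<close> modulo 2.

  For even \<open>n\<close>, the matrix \<open>tI - A - tJ\<close>, where \<open>J\<close> has all entries 1, is symmetric with
  zero diagonal, and its determinant is \<open>F - t \<Omega>\<close>. Modulo 4 such a determinant is up to sign
  a square, as for the Pfaffian of an alternating matrix (\<open>hollow_det_square_mod_4\<close>), and
  the root reduces to \<open>p\<close> modulo 2. If \<open>c\<close> is even, then \<open>p\<close> and \<open>\<Omega>\<close> agree for the two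
  graphs, hence \<open>F\<close> modulo 4 does. If \<open>c\<close> is odd, the roots are \<open>p\<close> and \<open>p + 1\<close>, and up to
  exchanging the graphs \<open>p = t p' + 1\<close>. This is impossible (\<open>parity_clash.contradiction\<close>).
  The \<open>n / 2\<close> coefficient vectors of \<open>d\<close> are independent and pairwise orthogonal, so their
  span is its own orthogonal complement. The deck determines the diagonal of \<open>a\<close> over the
  integers; writing \<open>a\<^sub>i\<^sub>i = t D\<^sub>i\<^sup>2 + 2 \<beta>\<^sub>i\<close> with \<open>D\<^sub>i\<close> lifting \<open>d\<^sub>i\<close>, the polynomials
  \<open>\<beta>\<^sub>i\<close> satisfy an equation modulo \<open>p\<close> from the first graph and one modulo \<open>p + 1\<close> from the
  second. Degrees are so small that both together force the vector \<open>\<beta>\<close> modulo 2 into that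
  span and then make the two equations explicit (\<open>E_diff\<close>, \<open>Q_diff\<close>). At a root \<open>\<theta>\<close> of \<open>p\<close>
  in the algebraic closure Jacobi's identity expresses the quotient of \<open>a - t d d\<^sup>T\<close> by \<open>p\<close>
  by two vectors, and the explicit equation becomes one about the product of these vectors
  that only admits \<open>\<theta> = 1\<close> (\<open>rank_two_contradiction\<close>); but \<open>p\<close> has another root.

  For odd \<open>n\<close> the deck determines \<open>F\<close> modulo 2, so \<open>c\<close> is even. Modulo 4 the polynomial
  \<open>F \<Omega>\<close> is the value of the quadratic form of \<open>tI - A\<close> at any lift of the row sums. If 4
  does not divide \<open>c\<close>, subtracting the identities of the two graphs shows that half the
  quadratic form of the difference of their adjacency matrices has the value 1 at \<open>k\<close>. That
  form is additive on the span of the coefficient vectors \<open>h\<^sub>l\<close> of \<open>k\<close>, so it is 1 at \<open>h\<^sub>0\<close>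
  and 0 at the others (\<open>q_h\<close>). Since \<open>A\<close> shifts the \<open>h\<^sub>l\<close>, they are independent, and so are
  the first \<open>(n + 1) / 2\<close> columns of the walk matrix modulo 2 (\<open>walk_vectors_independent\<close>).
  A smaller rank of the walk matrix excludes this.
\<close>

hide_const (open) UnivPoly.coeff UnivPoly.monom Module.smult Polynomials.degree Polynomials.lead_coeff

section \<open>Polynomials modulo 2 and modulo 4\<close>

definition tvar :: "'a::comm_ring_1 poly" where
  "tvar = [:0, 1:]"

lemma coeff_tvar_mult: "coeff (tvar * f) k = (case k of 0 \<Rightarrow> 0 | Suc j \<Rightarrow> coeff f j)"
  by (simp add: tvar_def coeff_pCons split: nat.split)

lemma tvar_neq_0 [simp]: "(tvar :: 'a::comm_ring_1 poly) \<noteq> 0"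
  by (simp add: tvar_def)

lemma pderiv_tvar [simp]: "pderiv (tvar :: 'a::idom poly) = 1"
  by (simp add: tvar_def pderiv_pCons)

definition mod2 :: "int poly \<Rightarrow> bit poly" where
  "mod2 = map_poly of_int"

definition lift2 :: "bit poly \<Rightarrow> int poly" where
  "lift2 = map_poly (\<lambda>b. if b = 1 then 1 else 0)"

lemma coeff_mod2 [simp]: "coeff (mod2 f) k = of_int (coeff f k)"
  by (simp add: mod2_def coeff_map_poly)

lemma mod2_0 [simp]: "mod2 0 = 0"
  and mod2_1 [simp]: "mod2 1 = 1"
  and mod2_add [simp]: "mod2 (f + g) = mod2 f + mod2 g"
  and mod2_diff [simp]: "mod2 (f - g) = mod2 f - mod2 g"
  and mod2_uminus [simp]: "mod2 (- f) = - mod2 f"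
  and mod2_pCons [simp]: "mod2 (pCons c f) = pCons (of_int c) (mod2 f)"
  and mod2_pderiv [simp]: "mod2 (pderiv f) = pderiv (mod2 f)"
  by (rule poly_eqI, simp add: coeff_pderiv coeff_pCons split: nat.split)+

lemma mod2_smult [simp]: "mod2 (Polynomial.smult c f) = Polynomial.smult (of_int c) (mod2 f)"
  by (rule poly_eqI) simp

lemma mod2_tvar [simp]: "mod2 tvar = tvar"
  by (simp add: tvar_def)

lemma mod2_mult [simp]: "mod2 (f * g) = mod2 f * mod2 g"
  by (rule poly_eqI) (simp add: coeff_mult)

lemma mod2_power [simp]: "mod2 (f ^ k) = mod2 f ^ k"
  by (induction k) simp_all

lemma mod2_sum [simp]: "mod2 (sum f A) = (\<Sum>x\<in>A. mod2 (f x))"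
  by (induction A rule: infinite_finite_induct) simp_all

declare add_bit_eq_xor [simp del] mult_bit_eq_and [simp del]

lemma of_int_bit_eq_0_iff: "(of_int k :: bit) = 0 \<longleftrightarrow> even k"
  by (cases "even k") (auto elim!: evenE oddE)

lemma bit_add_self_eq_0: "(c :: bit) + c = 0"
  by (cases c) simp_all

lemma bit_add_eq_iff: "(x :: bit) + y = z \<longleftrightarrow> y = z + x"
  by (cases x; cases y; cases z) simp_all

lemma bit_poly_add_self [simp]: "(f :: bit poly) + f = 0"
  by (rule poly_eqI) (simp only: coeff_add coeff_0 bit_add_self_eq_0)

lemma bit_poly_uminus [simp]: "- (f :: bit poly) = f"
  by (rule poly_eqI) simp

lemma bit_poly_diff [simp]: "(f :: bit poly) - g = f + g"
  by (metis bit_poly_uminus diff_conv_add_uminus)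

lemma bit_poly_add_self_left [simp]: "(f :: bit poly) + (f + g) = g"
  by (metis add.assoc add_0 bit_poly_add_self)

lemma bit_poly_add_eq_0_iff: "(f :: bit poly) + g = 0 \<longleftrightarrow> f = g"
  by (metis bit_poly_uminus eq_neg_iff_add_eq_0)

lemma bit_poly_add_eq_iff: "(f :: bit poly) + g = h \<longleftrightarrow> f = h + g"
  by (metis add.assoc add_0_right bit_poly_add_self)

lemma bit_poly_two [simp]: "(2 :: bit poly) = 0"
  by (metis bit_poly_add_self one_add_one)

lemma mod2_numeral_2 [simp]: "mod2 2 = 0"
  by (metis bit_poly_add_self mod2_1 mod2_add one_add_one)

lemma mod2_eq_0_iff: "mod2 f = 0 \<longleftrightarrow> 2 dvd f"
proof
  assume "mod2 f = 0"
  then have "even (coeff f k)" for k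
    by (metis coeff_0 coeff_mod2 of_int_bit_eq_0_iff)
  then have "[:2:] dvd f" by (simp add: const_poly_dvd_iff)
  then show "2 dvd f" by (simp add: numeral_poly)
next
  assume "2 dvd f"
  then show "mod2 f = 0" by (auto simp: dvd_def)
qed

lemma mod2_eq_0E:
  assumes "mod2 f = 0"
  obtains g where "f = 2 * g"
  using assms by (auto simp: mod2_eq_0_iff dvd_def)

lemma mod2_eq_iff: "mod2 f = mod2 g \<longleftrightarrow> 2 dvd f - g"
  by (metis bit_poly_add_eq_0_iff bit_poly_diff mod2_diff mod2_eq_0_iff)

lemma mod2_lift2 [simp]: "mod2 (lift2 f) = f"
  by (rule poly_eqI) (simp add: lift2_def coeff_map_poly)

lemma four_dvd_double_iff: "4 dvd 2 * (f :: int poly) \<longleftrightarrow> mod2 f = 0"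
proof -
  have "(4 :: int poly) = 2 * 2" by simp
  then show ?thesis
    by (metis dvd_times_left_cancel_iff mod2_eq_0_iff zero_neq_numeral)
qed

text \<open>This turns identities modulo 2 into identities modulo 4: the square of a polynomial
  modulo 4 is known as soon as the polynomial is known modulo 2.\<close>

lemma mod2_eq_imp_square_cong:
  assumes "mod2 f = mod2 g"
  shows "4 dvd f\<^sup>2 - g\<^sup>2"
proof -
  obtain h where h: "f = g + 2 * h"
    using assms by (auto simp: mod2_eq_iff dvd_def algebra_simps)
  have "f\<^sup>2 - g\<^sup>2 = 4 * (g * h + h\<^sup>2)"
    by (simp add: h power2_eq_square algebra_simps)
  then show ?thesis by simp
qed

lemma char2_add_square: "((f :: bit poly) + g)\<^sup>2 = f\<^sup>2 + g\<^sup>2"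
  by (simp add: power2_sum)

lemma char2_sum_square: "(sum f A :: bit poly)\<^sup>2 = (\<Sum>x\<in>A. (f x)\<^sup>2)"
  by (induction A rule: infinite_finite_induct) (simp_all add: char2_add_square)

lemma char2_square_eq_iff: "(f :: bit poly)\<^sup>2 = g\<^sup>2 \<longleftrightarrow> f = g"
  by (metis bit_poly_add_eq_0_iff char2_add_square zero_eq_power2)

lemma bit_poly_square_const [simp]: "([:c:] :: bit poly)\<^sup>2 = [:c:]"
  by (cases c) (simp_all add: power2_eq_square)

text \<open>Collect the even and the odd powers of the indeterminate: over the field with two
  elements a polynomial in \<open>t\<^sup>2\<close> is a square. The derivative of \<open>u\<^sup>2 + t v\<^sup>2\<close> is \<open>v\<^sup>2\<close>, which
  gives uniqueness.\<close>

lemma even_odd_decomposition: "\<exists>u v. (f :: bit poly) = u\<^sup>2 + tvar * v\<^sup>2"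
proof (induction f)
  case 0
  show ?case by (rule exI[of _ 0], rule exI[of _ 0]) simp
next
  case (pCons c f)
  then obtain u v where f: "f = u\<^sup>2 + tvar * v\<^sup>2" by blast
  have "pCons c f = [:c:]\<^sup>2 + tvar * f" by (simp add: tvar_def)
  also have "\<dots> = ([:c:] + tvar * v)\<^sup>2 + tvar * u\<^sup>2"
    unfolding f char2_add_square by (simp add: power2_eq_square algebra_simps)
  finally show ?case by blast
qed

lemma pderiv_square [simp]: "pderiv ((f :: bit poly)\<^sup>2) = 0"
  by (simp add: power2_eq_square pderiv_mult)

lemma pderiv_even_odd: "pderiv ((u :: bit poly)\<^sup>2 + tvar * v\<^sup>2) = v\<^sup>2"
  by (simp add: pderiv_add pderiv_mult)

lemma even_odd_unique:
  assumes "(u :: bit poly)\<^sup>2 + tvar * v\<^sup>2 = u'\<^sup>2 + tvar * v'\<^sup>2"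
  shows "u = u'" and "v = v'"
proof -
  have "v\<^sup>2 = v'\<^sup>2" using arg_cong[OF assms, of pderiv] by (simp only: pderiv_even_odd)
  then show v: "v = v'" by (simp only: char2_square_eq_iff)
  show "u = u'" using assms unfolding v add_right_cancel char2_square_eq_iff .
qed

definition even_root :: "bit poly \<Rightarrow> bit poly" where
  "even_root f = (SOME u. \<exists>v. f = u\<^sup>2 + tvar * v\<^sup>2)"

definition odd_root :: "bit poly \<Rightarrow> bit poly" where
  "odd_root f = (SOME v. \<exists>u. f = u\<^sup>2 + tvar * v\<^sup>2)"

lemma even_root_eq [simp]: "even_root (u\<^sup>2 + tvar * v\<^sup>2) = u"
  unfolding even_root_def by (rule some_equality) (auto dest: even_odd_unique)

lemma odd_root_eq [simp]: "odd_root (u\<^sup>2 + tvar * v\<^sup>2) = v"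
  unfolding odd_root_def by (rule some_equality) (auto dest: even_odd_unique)

lemma even_odd_roots: "f = (even_root f)\<^sup>2 + tvar * (odd_root f)\<^sup>2"
  using even_odd_decomposition[of f] by (metis even_root_eq odd_root_eq)

lemma sum_square_split:
  fixes g :: "nat \<Rightarrow> nat \<Rightarrow> 'a::comm_monoid_add"
  shows "(\<Sum>i<n. \<Sum>j<n. g i j) = (\<Sum>i<n. g i i) + (\<Sum>i<n. \<Sum>j<i. g i j + g j i)"
proof (induction n)
  case (Suc n)
  have "(\<Sum>i<Suc n. \<Sum>j<Suc n. g i j) = (\<Sum>i<n. \<Sum>j<n. g i j) + (\<Sum>j<n. g n j + g j n) + g n n"
    by (simp add: sum.distrib add_ac)
  then show ?case using Suc.IH by (simp add: add_ac)
qed simp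

lemma sum_symmetric:
  fixes g :: "nat \<Rightarrow> nat \<Rightarrow> 'a::comm_ring_1"
  assumes "\<And>i j. i < n \<Longrightarrow> j < n \<Longrightarrow> g i j = g j i"
  shows "(\<Sum>i<n. \<Sum>j<n. g i j) = (\<Sum>i<n. g i i) + 2 * (\<Sum>i<n. \<Sum>j<i. g i j)"
proof -
  have "(\<Sum>i<n. \<Sum>j<i. g i j + g j i) = (\<Sum>i<n. \<Sum>j<i. 2 * g i j)"
    using assms by (intro sum.cong refl) auto
  then show ?thesis by (simp only: sum_square_split sum_distrib_left)
qed

section \<open>The adjugate of a characteristic matrix modulo 2\<close>

text \<open>Entries of the characteristic matrix \<open>tI - A\<close>.\<close>

definition char_entry :: "(nat \<Rightarrow> nat \<Rightarrow> int) \<Rightarrow> nat \<Rightarrow> nat \<Rightarrow> int poly" where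
  "char_entry A i k = (if i = k then tvar else 0) - [:A i k:]"

text \<open>The expansion behind the lemma \<open>pluecker\<close> below: there \<open>b\<^sub>i\<^sub>i = t d\<^sub>i\<^sup>2\<close> and
  \<open>b\<^sub>j\<^sub>l = p P\<^sub>j\<^sub>l + t d\<^sub>j d\<^sub>l\<close>, and the terms without a factor \<open>p\<close> form a double, which is
  zero in characteristic 2.\<close>

lemma pluecker_ring_identity:
  fixes t :: "'a::comm_ring_1"
  shows "t * x\<^sup>2 * (p * u + t * y * z) + (p * v + t * y * x) * (p * w + t * x * z)
    = p * (t * x * (x * u + z * v + y * w) + p * (v * w))
      + (t * x * y * (t * x * z) + t * x * y * (t * x * z))"
  by (simp add: power2_eq_square algebra_simps)

text \<open>The data of one graph: \<open>F\<close> and \<open>a\<close> stand for the determinant and the adjugate of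
  \<open>tI - A\<close>. Only the listed identities are used, and they are stable under simultaneous
  permutations of rows and columns, so a relabelled graph needs no computation with permuted
  determinants. The assumption \<open>minors\<close> is Jacobi's identity: the determinant divides the 2 by
  2 minors of the adjugate.\<close>

locale adjugate_system =
  fixes n :: nat and A :: "nat \<Rightarrow> nat \<Rightarrow> int"
    and F :: "int poly" and a :: "nat \<Rightarrow> nat \<Rightarrow> int poly"
  assumes A_sym: "\<And>i j. i < n \<Longrightarrow> j < n \<Longrightarrow> A i j = A j i"
    and A_diag: "\<And>i. i < n \<Longrightarrow> A i i = 0"
    and a_sym: "\<And>i j. i < n \<Longrightarrow> j < n \<Longrightarrow> a i j = a j i"
    and char_mult_adj: "\<And>i j. i < n \<Longrightarrow> j < n \<Longrightarrow>
          (\<Sum>k<n. char_entry A i k * a k j) = (if i = j then F else 0)"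
    and trace_adj: "(\<Sum>i<n. a i i) = pderiv F"
    and minors: "\<And>i j l. i < n \<Longrightarrow> j < n \<Longrightarrow> l < n \<Longrightarrow> F dvd a i i * a j l - a j i * a i l"
    and F_monic: "lead_coeff F = 1"
    and F_degree: "degree F = n"
begin

definition f :: "bit poly" where "f = mod2 F"
definition b :: "nat \<Rightarrow> nat \<Rightarrow> bit poly" where "b i j = mod2 (a i j)"
definition M :: "nat \<Rightarrow> nat \<Rightarrow> bit poly" where "M i j = mod2 (char_entry A i j)"
definition r :: "nat \<Rightarrow> bit poly" where "r i = (\<Sum>j<n. b i j)"

lemma M_sym: "i < n \<Longrightarrow> j < n \<Longrightarrow> M i j = M j i"
  by (simp add: M_def char_entry_def A_sym)

lemma M_diag: "i < n \<Longrightarrow> M i i = tvar"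
  by (simp add: M_def char_entry_def A_diag)

lemma b_sym: "i < n \<Longrightarrow> j < n \<Longrightarrow> b i j = b j i"
  by (simp add: b_def a_sym)

lemma M_mult_b: "i < n \<Longrightarrow> j < n \<Longrightarrow> (\<Sum>k<n. M i k * b k j) = (if i = j then f else 0)"
  using arg_cong[OF char_mult_adj[of i j], of mod2] by (auto simp: M_def b_def f_def)

lemma char_mult_row_sums:
  assumes "i < n"
  shows "(\<Sum>j<n. char_entry A i j * (\<Sum>l<n. a j l)) = F"
proof -
  have "(\<Sum>j<n. char_entry A i j * (\<Sum>l<n. a j l)) = (\<Sum>l<n. \<Sum>j<n. char_entry A i j * a j l)"
    unfolding sum_distrib_left by (rule sum.swap)
  also have "\<dots> = (\<Sum>l<n. if i = l then F else 0)"
    by (intro sum.cong refl) (simp add: char_mult_adj assms)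
  finally show ?thesis using assms by simp
qed

lemma M_mult_r: "i < n \<Longrightarrow> (\<Sum>k<n. M i k * r k) = f"
  using arg_cong[OF char_mult_row_sums[of i], of mod2] by (simp add: M_def r_def b_def f_def)

lemma f_coeff_n: "coeff f n = 1"
  using F_monic F_degree by (simp add: f_def)

lemma f_degree: "degree f = n"
  using f_coeff_n by (intro antisym degree_le le_degree)
    (auto simp: f_def F_degree coeff_eq_0)

lemma f_neq_0: "f \<noteq> 0"
  using f_coeff_n by auto

text \<open>Off the diagonal every product occurs twice.\<close>

lemma quadratic_form_M:
  "(\<Sum>i<n. \<Sum>k<n. x i * (M i k * x k)) = tvar * (\<Sum>i<n. x i)\<^sup>2"
proof -
  have "(\<Sum>i<n. \<Sum>k<n. x i * (M i k * x k)) = (\<Sum>i<n. x i * (M i i * x i))"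
    by (subst sum_symmetric) (simp_all add: M_sym mult_ac)
  also have "\<dots> = (\<Sum>i<n. tvar * (x i)\<^sup>2)"
    by (intro sum.cong) (simp_all add: M_diag power2_eq_square mult_ac)
  finally show ?thesis by (simp add: char2_sum_square sum_distrib_left)
qed

text \<open>Both sides are the diagonal entry of \<open>b M b = f b\<close>.\<close>

lemma f_mult_diag: 
  assumes "i < n"
  shows "f * b i i = tvar * (r i)\<^sup>2"
proof -
  have "tvar * (r i)\<^sup>2 = (\<Sum>j<n. \<Sum>k<n. b i j * (M j k * b i k))"
    unfolding r_def by (rule quadratic_form_M[symmetric])
  also have "\<dots> = (\<Sum>j<n. b i j * (\<Sum>k<n. M j k * b k i))"
    by (simp add: sum_distrib_left b_sym[OF assms])
  also have "\<dots> = (\<Sum>j<n. if j = i then b i j * f else 0)"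
    by (intro sum.cong) (auto simp: M_mult_b assms)
  finally show ?thesis using assms by (simp add: mult_ac)
qed

lemma trace_b: "(\<Sum>i<n. b i i) = pderiv f"
  using arg_cong[OF trace_adj, of mod2] by (simp add: b_def f_def)

lemma sum_r: "(\<Sum>i<n. r i) = pderiv f"
proof -
  have "(\<Sum>i<n. r i) = (\<Sum>i<n. b i i)"
    unfolding r_def by (subst sum_symmetric) (simp_all add: b_sym)
  then show ?thesis by (simp add: trace_b)
qed

text \<open>Sum \<open>f_mult_diag\<close> over all vertices: the diagonal entries and the row sums of the
  symmetric matrix \<open>b\<close> have the same sum modulo 2, and the sum of the diagonal is the
  derivative of \<open>f\<close>.\<close>

lemma f_mult_pderiv: "f * pderiv f = tvar * (pderiv f)\<^sup>2"
proof -
  have "f * pderiv f = (\<Sum>i<n. f * b i i)"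
    by (simp add: sum_distrib_left flip: trace_b)
  also have "\<dots> = tvar * (\<Sum>i<n. r i)\<^sup>2"
    by (simp add: f_mult_diag char2_sum_square sum_distrib_left)
  finally show ?thesis by (simp add: sum_r)
qed

lemma pderiv_cases: "pderiv f = 0 \<or> f = tvar * pderiv f"
  using f_mult_pderiv by (auto simp: power2_eq_square)

lemma coeff_pderiv_f: "coeff (tvar * pderiv f) n = of_nat n"
  using f_coeff_n by (cases n) (simp_all add: coeff_tvar_mult coeff_pderiv)

end

locale even_system = adjugate_system +
  assumes even_n: "even n"
begin

lemma pderiv_f: "pderiv f = 0"
proof (rule disjE[OF pderiv_cases])
  assume "f = tvar * pderiv f"
  then have "(of_nat n :: bit) = 1" using coeff_pderiv_f f_coeff_n by metis
  moreover have "(of_nat n :: bit) = 0" using even_n by (auto elim!: evenE)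
  ultimately show ?thesis by simp
qed

definition p :: "bit poly" where "p = even_root f"
definition d :: "nat \<Rightarrow> bit poly" where "d i = odd_root (b i i)"

lemma f_eq: "f = p\<^sup>2"
proof -
  have "odd_root f = 0"
    using pderiv_f pderiv_even_odd[of "even_root f" "odd_root f"] by (simp flip: even_odd_roots)
  then show ?thesis using even_odd_roots[of f] by (simp add: p_def)
qed

lemma p_neq_0: "p \<noteq> 0" using f_eq f_neq_0 by auto

lemma p_degree: "2 * degree p = n"
  using f_degree p_neq_0 by (simp add: f_eq degree_power_eq)

lemma diag_root:
  assumes "i < n"
  shows "b i i = tvar * (d i)\<^sup>2" and "r i = p * d i"
proof -
  have b: "b i i = (even_root (b i i))\<^sup>2 + tvar * (d i)\<^sup>2"
    unfolding d_def by (rule even_odd_roots)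
  have "(p * even_root (b i i))\<^sup>2 + tvar * (p * d i)\<^sup>2 = f * b i i"
    unfolding arg_cong[OF b, of "\<lambda>x. f * x"] by (simp add: f_eq power_mult_distrib algebra_simps)
  also have "\<dots> = 0\<^sup>2 + tvar * (r i)\<^sup>2" by (simp add: f_mult_diag assms)
  finally have *: "p * even_root (b i i) = 0" "p * d i = r i"
    by (rule even_odd_unique)+
  show "r i = p * d i" by (rule *(2)[symmetric])
  show "b i i = tvar * (d i)\<^sup>2" using b *(1) p_neq_0 by simp
qed

lemma M_mult_d:
  assumes "i < n"
  shows "(\<Sum>k<n. M i k * d k) = p"
proof -
  have "p * (\<Sum>k<n. M i k * d k) = (\<Sum>k<n. M i k * r k)"
    by (simp add: sum_distrib_left mult_ac diag_root(2))
  also have "\<dots> = p * p" using assms by (simp add: M_mult_r f_eq power2_eq_square)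
  finally show ?thesis using p_neq_0 by simp
qed

lemma sum_d: "(\<Sum>i<n. d i) = 0"
proof -
  have "p * (\<Sum>i<n. d i) = 0"
    by (simp add: sum_distrib_left diag_root(2)[symmetric] sum_r pderiv_f)
  then show ?thesis using p_neq_0 by simp
qed

text \<open>By \<open>b_eq\<close> below, \<open>b\<close> is modulo \<open>p\<close> the rank one matrix \<open>t d d\<^sup>T\<close>, and \<open>P\<close> is the
  quotient of the difference by \<open>p\<close>.\<close>

definition P :: "nat \<Rightarrow> nat \<Rightarrow> bit poly" where
  "P i j = (b i j + tvar * d i * d j) div p"

text \<open>Jacobi's identity with \<open>l = j\<close> says that \<open>p\<^sup>2\<close> divides the square of
  \<open>b\<^sub>i\<^sub>j + t d\<^sub>i d\<^sub>j\<close>.\<close>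

lemma b_eq:
  assumes "i < n" "j < n"
  shows "b i j = p * P i j + tvar * d i * d j"
proof -
  obtain G where "a i i * a j j - a j i * a i j = F * G"
    using minors[OF assms(1,2,2)] by (auto simp: dvd_def)
  then have "mod2 (a i i * a j j - a j i * a i j) = mod2 (F * G)" by simp
  then have "b i i * b j j + b j i * b i j = f * mod2 G" by (simp add: b_def f_def)
  then have "(b i j + tvar * d i * d j)\<^sup>2 = p\<^sup>2 * mod2 G"
    using assms by (simp add: b_sym[of j i] diag_root f_eq char2_add_square power_mult_distrib)
      (simp add: power2_eq_square algebra_simps)
  also have "\<dots> = p\<^sup>2 * ((even_root (mod2 G))\<^sup>2 + tvar * (odd_root (mod2 G))\<^sup>2)"
    by (simp flip: even_odd_roots)
  finally have "(b i j + tvar * d i * d j)\<^sup>2 + tvar * 0\<^sup>2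
      = (p * even_root (mod2 G))\<^sup>2 + tvar * (p * odd_root (mod2 G))\<^sup>2"
    by (simp add: power_mult_distrib algebra_simps)
  then have "b i j + tvar * d i * d j = p * even_root (mod2 G)"
    by (rule even_odd_unique)
  then have "b i j + tvar * d i * d j = p * P i j"
    unfolding P_def using p_neq_0 by simp
  then show ?thesis by (metis bit_poly_add_self_left add.commute)
qed

lemma P_sym: "i < n \<Longrightarrow> j < n \<Longrightarrow> P i j = P j i"
  by (simp add: P_def b_sym mult_ac)

lemma M_mult_P: 
  assumes "i < n" "j < n"
  shows "(\<Sum>k<n. M i k * P k j) = (if i = j then p else 0) + tvar * d j"
proof -
  have "(if i = j then p * p else 0) = (\<Sum>k<n. M i k * b k j)"
    by (simp add: M_mult_b assms f_eq power2_eq_square)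
  also have "\<dots> = (\<Sum>k<n. p * (M i k * P k j) + tvar * d j * (M i k * d k))"
    by (intro sum.cong) (simp_all add: b_eq assms algebra_simps)
  also have "\<dots> = p * (\<Sum>k<n. M i k * P k j) + tvar * d j * p"
    by (simp add: sum.distrib M_mult_d assms flip: sum_distrib_left)
  finally have "p * (\<Sum>k<n. M i k * P k j) + tvar * d j * p = (if i = j then p * p else 0)" ..
  then have "p * (\<Sum>k<n. M i k * P k j) = p * ((if i = j then p else 0) + tvar * d j)"
    unfolding bit_poly_add_eq_iff by (auto simp: algebra_simps)
  then show ?thesis using p_neq_0 by simp
qed

lemma sum_P: 
  assumes "i < n"
  shows "(\<Sum>j<n. P i j) = d i"
proof -
  have "p * d i = (\<Sum>j<n. p * P i j + tvar * d i * d j)"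
    unfolding diag_root(2)[OF assms, symmetric] r_def by (intro sum.cong) (simp_all add: b_eq assms)
  also have "\<dots> = p * (\<Sum>j<n. P i j)"
    by (simp add: sum.distrib sum_d flip: sum_distrib_left)
  finally show ?thesis using p_neq_0 by simp
qed

text \<open>Jacobi's identity for three indices, with \<open>b\<close> expressed by \<open>P\<close>. At a nonzero root of \<open>p\<close>
  where \<open>d\<close> does not vanish these are Pluecker relations, which make \<open>P\<close> a matrix of rank at
  most two.\<close>

lemma pluecker:
  assumes "i < n" "j < n" "l < n"
  shows "p dvd tvar * d i * (d i * P j l + d l * P j i + d j * P i l)"
proof -
  obtain G where "a i i * a j l - a j i * a i l = F * G"
    using minors[OF assms] by (auto simp: dvd_def)
  then have "mod2 (a i i * a j l - a j i * a i l) = mod2 (F * G)" by simp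
  then have "b i i * b j l + b j i * b i l = p * (p * mod2 G)"
    by (simp add: b_def f_def f_eq[unfolded f_def] power2_eq_square)
  moreover have "b i i * b j l + b j i * b i l
      = p * (tvar * d i * (d i * P j l + d l * P j i + d j * P i l) + p * (P j i * P i l))
        + (tvar * d i * d j * (tvar * d i * d l) + tvar * d i * d j * (tvar * d i * d l))"
    unfolding diag_root(1)[OF assms(1)] b_eq[OF assms(2,3)] b_eq[OF assms(2,1)] b_eq[OF assms(1,3)]
    by (rule pluecker_ring_identity)
  ultimately have "p * (tvar * d i * (d i * P j l + d l * P j i + d j * P i l) + p * (P j i * P i l))
      = p * (p * mod2 G)"
    by (simp only: bit_poly_add_self add_0_right)
  then have "tvar * d i * (d i * P j l + d l * P j i + d j * P i l) + p * (P j i * P i l) = p * mod2 G"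
    using p_neq_0 by simp
  then show ?thesis by (metis dvd_add_left_iff dvd_triv_left)
qed

end

locale odd_system = adjugate_system +
  assumes odd_n: "odd n"
begin

definition e :: "bit poly" where "e = odd_root f"
definition k :: "nat \<Rightarrow> bit poly" where "k i = even_root (b i i)"

lemma f_eq: "f = tvar * e\<^sup>2" and pderiv_f: "pderiv f = e\<^sup>2"
proof -
  have pd: "pderiv f = e\<^sup>2"
    using pderiv_even_odd[of "even_root f" "odd_root f"] by (simp add: e_def flip: even_odd_roots)
  then show "pderiv f = e\<^sup>2" .
  have "pderiv f \<noteq> 0"
  proof
    assume "pderiv f = 0"
    then have "coeff (tvar * pderiv f) n = 0" by simp
    then have "(of_nat n :: bit) = 0" using coeff_pderiv_f by simp
    moreover have "(of_nat n :: bit) = 1" using odd_n by (auto elim!: oddE)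
    ultimately show False by simp
  qed
  then show "f = tvar * e\<^sup>2" using pderiv_cases pd by auto
qed

lemma e_neq_0: "e \<noteq> 0" using f_eq f_neq_0 by auto

lemma diag_root:
  assumes "i < n"
  shows "b i i = (k i)\<^sup>2" and "r i = e * k i"
proof -
  have b: "b i i = (k i)\<^sup>2 + tvar * (odd_root (b i i))\<^sup>2"
    unfolding k_def by (rule even_odd_roots)
  have "tvar * ((e * k i)\<^sup>2 + tvar * (e * odd_root (b i i))\<^sup>2) = f * b i i"
    unfolding arg_cong[OF b, of "\<lambda>x. f * x"] by (simp add: f_eq power_mult_distrib algebra_simps)
  also have "\<dots> = tvar * ((r i)\<^sup>2 + tvar * 0\<^sup>2)" by (simp add: f_mult_diag assms)
  finally have "(e * k i)\<^sup>2 + tvar * (e * odd_root (b i i))\<^sup>2 = (r i)\<^sup>2 + tvar * 0\<^sup>2" by simp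
  then have *: "e * k i = r i" "e * odd_root (b i i) = 0"
    by (rule even_odd_unique)+
  show "r i = e * k i" by (rule *(1)[symmetric])
  show "b i i = (k i)\<^sup>2" using b *(2) e_neq_0 by simp
qed

lemma M_mult_k:
  assumes "i < n"
  shows "(\<Sum>j<n. M i j * k j) = tvar * e"
proof -
  have "e * (\<Sum>j<n. M i j * k j) = (\<Sum>k<n. M i k * r k)"
    by (simp add: sum_distrib_left mult_ac diag_root(2))
  also have "\<dots> = e * (tvar * e)" using assms by (simp add: M_mult_r f_eq power2_eq_square mult_ac)
  finally show ?thesis using e_neq_0 by simp
qed

lemma sum_k: "(\<Sum>i<n. k i) = e"
proof -
  have "e * (\<Sum>i<n. k i) = e * e"
    by (simp add: sum_distrib_left diag_root(2)[symmetric] sum_r pderiv_f power2_eq_square)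
  then show ?thesis using e_neq_0 by simp
qed

end

section \<open>Two graphs with the same deck\<close>

context adjugate_system
begin

definition S :: "int poly" where "S = (\<Sum>i<n. \<Sum>j<i. a i j)"
definition \<Omega> :: "int poly" where "\<Omega> = (\<Sum>i<n. \<Sum>j<n. a i j)"

lemma \<Omega>_eq: "\<Omega> = pderiv F + 2 * S"
  unfolding \<Omega>_def S_def by (subst sum_symmetric) (simp_all add: a_sym trace_adj)

lemma adj_mult_char:
  assumes "i < n" "j < n"
  shows "(\<Sum>k<n. a i k * char_entry A k j) = (if i = j then F else 0)"
proof -
  have "(\<Sum>k<n. a i k * char_entry A k j) = (\<Sum>k<n. char_entry A j k * a k i)"
    by (intro sum.cong) (simp_all add: char_entry_def A_sym a_sym assms mult_ac)
  then show ?thesis using assms by (auto simp: char_mult_adj)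
qed

text \<open>Differentiate \<open>(tI - A) a = F I\<close>, where \<open>tI - A\<close> has the derivative \<open>I\<close>, and multiply by
  \<open>a\<close>.\<close>

lemma adj_square:
  assumes "l < n" "j < n"
  shows "(\<Sum>i<n. a l i * a i j) = pderiv F * a l j - F * pderiv (a l j)"
proof -
  have deriv: "a i j + (\<Sum>k<n. char_entry A i k * pderiv (a k j)) = (if i = j then pderiv F else 0)"
    if "i < n" for i
  proof -
    have "pderiv (char_entry A i k) = (if i = k then 1 else 0)" for k
      by (simp add: char_entry_def pderiv_diff pderiv_pCons)
    then have "pderiv (\<Sum>k<n. char_entry A i k * a k j)
        = (\<Sum>k<n. char_entry A i k * pderiv (a k j) + (if i = k then a k j else 0))"
      unfolding pderiv_sum by (intro sum.cong) (auto simp: pderiv_mult)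
    also have "\<dots> = a i j + (\<Sum>k<n. char_entry A i k * pderiv (a k j))"
      using that by (simp add: sum.distrib add.commute)
    finally show ?thesis using that assms by (auto simp: char_mult_adj split: if_splits)
  qed
  have "(\<Sum>i<n. \<Sum>k<n. a l i * (char_entry A i k * pderiv (a k j)))
      = (\<Sum>k<n. (\<Sum>i<n. a l i * char_entry A i k) * pderiv (a k j))"
    by (subst sum.swap) (simp add: sum_distrib_right mult.assoc)
  also have "\<dots> = (\<Sum>k<n. if k = l then F * pderiv (a k j) else 0)"
    by (intro sum.cong) (auto simp: adj_mult_char assms)
  also have "\<dots> = F * pderiv (a l j)" using assms by simp
  finally have *: "(\<Sum>i<n. \<Sum>k<n. a l i * (char_entry A i k * pderiv (a k j))) = F * pderiv (a l j)" .
  have "(\<Sum>i<n. a l i * (a i j + (\<Sum>k<n. char_entry A i k * pderiv (a k j))))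
      = (\<Sum>i<n. if i = j then a l i * pderiv F else 0)"
    by (intro sum.cong) (auto simp: deriv)
  then have "(\<Sum>i<n. a l i * a i j) + F * pderiv (a l j) = a l j * pderiv F"
    using assms * by (simp add: distrib_left sum.distrib sum_distrib_left)
  then show ?thesis by (simp add: algebra_simps)
qed

lemma trace_adj_square:
  "(\<Sum>i<n. (a i i)\<^sup>2) + 2 * (\<Sum>i<n. \<Sum>j<i. (a i j)\<^sup>2) = (pderiv F)\<^sup>2 - F * pderiv (pderiv F)"
proof -
  have "(\<Sum>i<n. (a i i)\<^sup>2) + 2 * (\<Sum>i<n. \<Sum>j<i. (a i j)\<^sup>2) = (\<Sum>i<n. \<Sum>j<n. (a i j)\<^sup>2)"
    by (rule sum_symmetric[symmetric]) (simp add: a_sym)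
  also have "\<dots> = (\<Sum>i<n. \<Sum>j<n. a i j * a j i)"
    by (intro sum.cong) (simp_all add: a_sym power2_eq_square)
  also have "\<dots> = (\<Sum>i<n. pderiv F * a i i - F * pderiv (a i i))"
    by (simp add: adj_square)
  also have "\<dots> = pderiv F * (\<Sum>i<n. a i i) - F * pderiv (\<Sum>i<n. a i i)"
    by (simp add: sum_subtractf sum_distrib_left pderiv_sum)
  finally show ?thesis by (simp add: trace_adj power2_eq_square)
qed

end

lemma pderiv_pderiv_even: "mod2 (pderiv (pderiv Z)) = 0"
proof -
  have "pderiv (mod2 Z) = (odd_root (mod2 Z))\<^sup>2"
    using pderiv_even_odd[of "even_root (mod2 Z)" "odd_root (mod2 Z)"] by (simp flip: even_odd_roots)
  then show ?thesis by simp
qed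

lemma int_pderiv_eq_0_imp_const:
  assumes "pderiv (Z :: int poly) = 0"
  shows "Z = [:coeff Z 0:]"
  using assms by (metis degree_eq_zeroE pderiv_eq_0_iff coeff_pCons_0)

text \<open>Second derivatives of integer polynomials are even. If \<open>Z = s\<^sup>2 + 2 Y\<close>, then half of the
  second derivative of \<open>Z\<close> is the square of the derivative of \<open>s\<close> plus terms containing a
  second derivative.\<close>

lemma half_second_derivative:
  assumes "mod2 Z = q\<^sup>2"
  obtains H where "pderiv (pderiv Z) = 2 * H" and "mod2 H = (pderiv q)\<^sup>2"
proof -
  have "mod2 (Z - (lift2 q)\<^sup>2) = 0" by (simp add: assms)
  then obtain Y where "Z - (lift2 q)\<^sup>2 = 2 * Y" by (rule mod2_eq_0E)
  then have Z: "Z = (lift2 q)\<^sup>2 + 2 * Y" by (simp add: algebra_simps)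
  have "pderiv (pderiv Z) = 2 * ((pderiv (lift2 q))\<^sup>2 + lift2 q * pderiv (pderiv (lift2 q)) + pderiv (pderiv Y))"
    by (simp add: Z power2_eq_square pderiv_add pderiv_mult algebra_simps flip: mult_2)
  moreover have "mod2 ((pderiv (lift2 q))\<^sup>2 + lift2 q * pderiv (pderiv (lift2 q)) + pderiv (pderiv Y)) = (pderiv q)\<^sup>2"
    using pderiv_pderiv_even[of "lift2 q"] pderiv_pderiv_even[of Y] by simp
  ultimately show ?thesis by (rule that)
qed

locale system_pair = L: adjugate_system n A F a + R: adjugate_system n B G b
  for n A F a B G b +
  assumes same_diag: "\<And>i. i < n \<Longrightarrow> a i i = b i i"
begin

lemma same_pderiv: "pderiv F = pderiv G"
  using L.trace_adj R.trace_adj same_diag by simp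

definition c :: int where "c = coeff F 0 - coeff G 0"

lemma F_minus_G: "F - G = [:c:]"
  using int_pderiv_eq_0_imp_const[of "F - G"] by (simp add: pderiv_diff same_pderiv c_def)

text \<open>Compare the traces of the squared adjugates (\<open>trace_adj_square\<close>): the diagonals agree,
  and the right hand sides differ by \<open>c\<close> times the second derivative of \<open>F\<close>. Modulo 2 the sum
  of the squares of the entries below the diagonal is the square of their sum.\<close>

lemma offdiag_squares:
  assumes "pderiv (pderiv F) = 2 * H"
  shows "(mod2 L.S + mod2 R.S)\<^sup>2 = [:of_int c:] * mod2 H"
proof -
  let ?Z = "\<Sum>i<n. \<Sum>j<i. (a i j)\<^sup>2" and ?Y = "\<Sum>i<n. \<Sum>j<i. (b i j)\<^sup>2"
  have "(\<Sum>i<n. (b i i)\<^sup>2) = (\<Sum>i<n. (a i i)\<^sup>2)" by (simp add: same_diag)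
  then have "2 * ?Z - 2 * ?Y = - (F - G) * pderiv (pderiv F)"
    using L.trace_adj_square R.trace_adj_square same_pderiv by (simp add: algebra_simps)
  then have "2 * (?Z - ?Y) = 2 * (- [:c:] * H)"
    by (simp only: F_minus_G assms algebra_simps)
  then have "?Z - ?Y = - [:c:] * H" by (simp only: mult_cancel_left) simp
  then have "mod2 (?Z - ?Y) = mod2 (- [:c:] * H)" by simp
  then show ?thesis
    by (simp add: L.S_def R.S_def char2_add_square char2_sum_square)
qed

lemma \<Omega>_cong:
  assumes "even c"
  shows "mod2 L.S = mod2 R.S" and "4 dvd L.\<Omega> - R.\<Omega>"
proof -
  have "2 dvd pderiv (pderiv F)" using pderiv_pderiv_even mod2_eq_0_iff by blast
  then obtain H where "pderiv (pderiv F) = 2 * H" by (auto simp: dvd_def)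
  from offdiag_squares[OF this] show S: "mod2 L.S = mod2 R.S"
    using assms by (simp add: bit_poly_add_eq_0_iff of_int_bit_eq_0_iff[THEN iffD2])
  have "L.\<Omega> - R.\<Omega> = 2 * (L.S - R.S)" by (simp add: L.\<Omega>_eq R.\<Omega>_eq same_pderiv algebra_simps)
  then show "4 dvd L.\<Omega> - R.\<Omega>" by (simp only: four_dvd_double_iff) (simp add: S)
qed

end

lemma uminus_one_power_const: "[:(-1) ^ k:] = (-1 :: int poly) ^ k"
proof (cases "even k")
  case True
  then show ?thesis by simp
next
  case False
  then have "(-1 :: int poly) ^ k = - 1" and "(-1 :: int) ^ k = - 1" by simp_all
  then show ?thesis by (simp only:) (simp add: one_pCons)
qed

text \<open>The polynomial \<open>F - t \<Omega>\<close> is the determinant of \<open>tI - A - tJ\<close>, a symmetric matrix with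
  zero diagonal; the assumption is the analogue modulo 4 of being the square of a Pfaffian.\<close>

locale square_det_system = even_system +
  assumes det_square: "\<And>s. mod2 s = p \<Longrightarrow> 4 dvd F - tvar * \<Omega> - (-1) ^ (n div 2) * s\<^sup>2"

locale even_pair = system_pair n A F a B G b + L: square_det_system n A F a + R: square_det_system n B G b
  for n A F a B G b
begin

lemma f_diff: "L.f + R.f = [:of_int c:]"
  using arg_cong[OF F_minus_G, of mod2] by (simp add: L.f_def R.f_def)

lemma p_diff: "L.p + R.p = [:of_int c:]"
proof -
  have "(L.p + R.p)\<^sup>2 = [:of_int c:]\<^sup>2"
    using f_diff by (simp add: L.f_eq R.f_eq char2_add_square)
  then show ?thesis by (simp only: char2_square_eq_iff)
qed

lemma const_cong_4:
  assumes "even c"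
  shows "4 dvd c"
proof -
  have c0: "(of_int c :: bit) = 0" using assms by (simp add: of_int_bit_eq_0_iff)
  then have "L.p = R.p" using p_diff by (simp add: bit_poly_add_eq_0_iff)
  then have "4 dvd (F - tvar * L.\<Omega> - (-1) ^ (n div 2) * (lift2 L.p)\<^sup>2)
      - (G - tvar * R.\<Omega> - (-1) ^ (n div 2) * (lift2 L.p)\<^sup>2)"
    by (intro dvd_diff L.det_square R.det_square) simp_all
  also have "\<dots> = [:c:] - tvar * (L.\<Omega> - R.\<Omega>)"
    using F_minus_G by (simp add: algebra_simps)
  finally have "4 dvd ([:c:] - tvar * (L.\<Omega> - R.\<Omega>)) + tvar * (L.\<Omega> - R.\<Omega>)"
    using \<Omega>_cong(2)[OF assms] by (intro dvd_add dvd_mult)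
  then have "4 dvd [:c:]" by simp
  then show ?thesis by (simp add: numeral_poly const_poly_dvd_const_poly_iff)
qed

text \<open>The roots \<open>s\<close> and \<open>s + 1\<close> of the two instances of \<open>det_square\<close> have squares with
  difference \<open>2 s + 1\<close>. Subtracting the instances leaves an even polynomial, whose half modulo
  2 is the second statement, since \<open>offdiag_squares\<close> gives the difference of the two \<open>\<Omega>\<close>.\<close>

lemma p_shape:
  assumes "odd c"
  shows "R.p = L.p + 1" and "\<exists>k. L.p = tvar * pderiv L.p + [:k:]"
proof -
  have c1: "(of_int c :: bit) = 1" using assms of_int_bit_eq_0_iff[of c] by auto
  then have pd: "L.p + R.p = 1" using p_diff by (simp add: one_pCons)
  then show Rp: "R.p = L.p + 1" by (metis bit_poly_add_self_left)
  obtain H where H: "pderiv (pderiv F) = 2 * H" "mod2 H = (pderiv L.p)\<^sup>2"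
    using half_second_derivative[OF L.f_eq[unfolded L.f_def]] .
  have "(mod2 L.S + mod2 R.S)\<^sup>2 = (pderiv L.p)\<^sup>2"
    using offdiag_squares[OF H(1)] by (simp add: c1 H(2))
  then have S: "mod2 (L.S - R.S) = pderiv L.p" by (simp add: char2_square_eq_iff)
  define s where "s = lift2 L.p"
  define \<epsilon> :: int where "\<epsilon> = (-1) ^ (n div 2)"
  have \<epsilon>: "(-1) ^ (n div 2) = [:\<epsilon>:]" and odd_\<epsilon>: "odd \<epsilon>"
    by (simp_all add: \<epsilon>_def uminus_one_power_const)
  obtain q where q: "c + \<epsilon> = 2 * q" using assms odd_\<epsilon> by (meson evenE odd_even_add)
  have "4 dvd (F - tvar * L.\<Omega> - (-1) ^ (n div 2) * s\<^sup>2)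
      - (G - tvar * R.\<Omega> - (-1) ^ (n div 2) * (s + 1)\<^sup>2)"
    by (intro dvd_diff L.det_square R.det_square) (simp_all add: s_def Rp)
  also have "\<dots> = (F - G) + [:\<epsilon>:] - 2 * (tvar * (L.S - R.S) - [:\<epsilon>:] * s)"
    by (simp add: \<epsilon> L.\<Omega>_eq R.\<Omega>_eq same_pderiv power2_eq_square algebra_simps)
  also have "(F - G) + [:\<epsilon>:] = 2 * [:q:]" by (simp add: F_minus_G q numeral_poly)
  finally have "4 dvd 2 * ([:q:] - (tvar * (L.S - R.S) - [:\<epsilon>:] * s))" by (simp add: algebra_simps)
  then have "mod2 ([:q:] - (tvar * (L.S - R.S) - [:\<epsilon>:] * s)) = 0" by (simp only: four_dvd_double_iff)
  moreover have "(of_int \<epsilon> :: bit) = 1" using odd_\<epsilon> of_int_bit_eq_0_iff[of \<epsilon>] by auto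
  ultimately have "[:of_int q:] + (tvar * pderiv L.p + L.p) = 0"
    using S by (simp add: s_def one_pCons[symmetric])
  then have "L.p = tvar * pderiv L.p + [:of_int q:]"
    by (metis add.left_commute add.commute bit_poly_add_eq_0_iff)
  then show "\<exists>k. L.p = tvar * pderiv L.p + [:k:]" ..
qed

end

section \<open>Linear algebra of dual families and shifted vectors\<close>

text \<open>Induction on the number of vectors: \<open>z\<close> is the new vector made orthogonal to the dual
  family found so far, \<open>u\<close> pairs to 1 with \<open>z\<close> and to 0 with the old vectors, and the old dual
  family is corrected by multiples of \<open>u\<close>.\<close>

lemma dual_family_exists:
  fixes h :: "nat \<Rightarrow> nat \<Rightarrow> 'a::field"
  assumes "\<And>x. (\<And>i. i < n \<Longrightarrow> (\<Sum>j<m. x j * h j i) = 0) \<Longrightarrow> (\<forall>j<m. x j = 0)"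
  shows "\<exists>y. \<forall>j<m. \<forall>l<m. (\<Sum>i<n. h j i * y l i) = (if j = l then 1 else 0)"
  using assms
proof (induction m)
  case 0
  then show ?case by simp
next
  case (Suc m)
  have "\<exists>y. \<forall>j<m. \<forall>l<m. (\<Sum>i<n. h j i * y l i) = (if j = l then 1 else 0)"
  proof (rule Suc.IH)
    fix x assume "\<And>i. i < n \<Longrightarrow> (\<Sum>j<m. x j * h j i) = 0"
    then have "\<forall>j<Suc m. (if j < m then x j else 0) = 0"
      by (intro Suc.prems) simp
    then show "\<forall>j<m. x j = 0" by (metis less_SucI)
  qed
  then obtain y where y: "\<And>j l. j < m \<Longrightarrow> l < m \<Longrightarrow> (\<Sum>i<n. h j i * y l i) = (if j = l then 1 else 0)"
    by blast
  define s where "s j = (\<Sum>i<n. h m i * y j i)" for j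
  define z where "z i = h m i - (\<Sum>j<m. s j * h j i)" for i
  have zy: "(\<Sum>i<n. z i * y l i) = 0" if "l < m" for l
  proof -
    have "(\<Sum>i<n. (\<Sum>j<m. s j * h j i) * y l i)
        = (\<Sum>j<m. s j * (\<Sum>i<n. h j i * y l i))"
      by (simp add: sum_distrib_left sum_distrib_right mult.assoc) (rule sum.swap)
    also have "\<dots> = (\<Sum>j<m. if j = l then s j else 0)"
      by (intro sum.cong) (auto simp: y that)
    finally show ?thesis using that by (simp add: z_def s_def[symmetric] left_diff_distrib sum_subtractf)
  qed
  have "\<exists>i0<n. z i0 \<noteq> 0"
  proof (rule ccontr)
    assume none: "\<not> ?thesis"
    define w where "w j = (if j < m then - s j else 1)" for j
    have "(\<Sum>j<Suc m. w j * h j i) = 0" if "i < n" for i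
    proof -
      have "(\<Sum>j<Suc m. w j * h j i) = z i" by (simp add: w_def z_def sum_negf)
      then show ?thesis using none that by simp
    qed
    then have "\<forall>j<Suc m. w j = 0" by (rule Suc.prems)
    then have "w m = 0" by simp
    then show False by (simp add: w_def)
  qed
  then obtain i0 where i0: "i0 < n" "z i0 \<noteq> 0" by blast
  define u where "u i = (if i = i0 then inverse (z i0) else 0) - (\<Sum>j<m. h j i0 * inverse (z i0) * y j i)" for i
  have pair_u: "(\<Sum>i<n. g i * u i) = g i0 * inverse (z i0) - (\<Sum>j<m. h j i0 * inverse (z i0) * (\<Sum>i<n. g i * y j i))" for g
  proof -
    have "(\<Sum>i<n. g i * (\<Sum>j<m. h j i0 * inverse (z i0) * y j i))
        = (\<Sum>j<m. h j i0 * inverse (z i0) * (\<Sum>i<n. g i * y j i))"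
      by (simp add: sum_distrib_left mult_ac) (rule sum.swap)
    moreover have "(\<Sum>i<n. g i * (if i = i0 then inverse (z i0) else 0)) = g i0 * inverse (z i0)"
      using i0 by (simp add: if_distrib cong: if_cong)
    ultimately show ?thesis by (simp add: u_def right_diff_distrib sum_subtractf)
  qed
  have hu: "(\<Sum>i<n. h l i * u i) = 0" if "l < m" for l
  proof -
    have "(\<Sum>j<m. h j i0 * inverse (z i0) * (\<Sum>i<n. h l i * y j i))
        = (\<Sum>j<m. if j = l then h j i0 * inverse (z i0) else 0)"
      by (intro sum.cong) (auto simp: y that)
    then show ?thesis using that by (simp add: pair_u)
  qed
  have zu: "(\<Sum>i<n. z i * u i) = 1"
    using i0 by (simp add: pair_u zy)
  have hmu: "(\<Sum>i<n. h m i * u i) = 1"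
  proof -
    have "(\<Sum>i<n. h m i * u i) = (\<Sum>i<n. z i * u i) + (\<Sum>i<n. (\<Sum>j<m. s j * h j i) * u i)"
      by (simp add: z_def s_def[symmetric] left_diff_distrib sum_subtractf)
    also have "(\<Sum>i<n. (\<Sum>j<m. s j * h j i) * u i)
        = (\<Sum>j<m. s j * (\<Sum>i<n. h j i * u i))"
      by (simp add: sum_distrib_left sum_distrib_right mult.assoc) (rule sum.swap)
    finally show ?thesis by (simp add: hu zu)
  qed
  define y' where "y' l i = (if l = m then u i else y l i - s l * u i)" for l i
  have split: "(\<Sum>i<n. h j i * y' l i) = (if l = m then (\<Sum>i<n. h j i * u i)
      else (\<Sum>i<n. h j i * y l i) - s l * (\<Sum>i<n. h j i * u i))" for j l
  proof -
    have "(\<Sum>i<n. h j i * (s * u i)) = s * (\<Sum>i<n. h j i * u i)" for s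
      by (simp add: sum_distrib_left mult_ac)
    then show ?thesis by (simp add: y'_def right_diff_distrib sum_subtractf)
  qed
  show ?case
  proof (intro exI[of _ y'] allI impI)
    fix j l assume "j < Suc m" "l < Suc m"
    then consider "j < m" "l < m" | "j < m" "l = m" | "j = m" "l < m" | "j = m" "l = m" by linarith
    then show "(\<Sum>i<n. h j i * y' l i) = (if j = l then 1 else 0)"
      by cases (auto simp: split hu hmu y s_def)
  qed
qed

lemma dual_bases_square:
  fixes g :: "nat \<Rightarrow> nat \<Rightarrow> 'a::field"
  assumes dual: "\<And>j l. j < n \<Longrightarrow> l < n \<Longrightarrow> (\<Sum>i<n. y j i * g l i) = (if j = l then 1 else 0)"
    and "i < n" "k < n"
  shows "(\<Sum>j<n. g j i * y j k) = (if i = k then 1 else 0)"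
proof -
  define Y where "Y = mat n n (\<lambda>(j, i). y j i)"
  define G where "G = mat n n (\<lambda>(i, l). g l i)"
  have "Y * G = 1\<^sub>m n"
    by (rule eq_matI) (auto simp: Y_def G_def scalar_prod_def dual lessThan_atLeast0[symmetric])
  then have "G * Y = 1\<^sub>m n"
    by (intro mat_mult_left_right_inverse[of Y n G]) (auto simp: Y_def G_def)
  then have "(G * Y) $$ (i, k) = (1\<^sub>m n :: 'a mat) $$ (i, k)" by simp
  then show ?thesis using assms(2,3)
    by (simp add: Y_def G_def scalar_prod_def lessThan_atLeast0[symmetric])
qed

lemma sum_lessThan_double: "(\<Sum>j<2 * (m :: nat). g j) = (\<Sum>j<m. g j) + (\<Sum>j<m. g (m + j))"
  for g :: "nat \<Rightarrow> 'a::comm_monoid_add"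
proof -
  have "(\<Sum>j<m + k. g j) = (\<Sum>j<m. g j) + (\<Sum>j<k. g (m + j))" for k
    by (induction k) (simp_all add: add.assoc)
  from this[of m] show ?thesis by (simp add: mult_2)
qed

text \<open>A maximal totally isotropic family \<open>h\<close> together with a dual family \<open>y\<close> is a basis.
  Correcting \<open>y\<close> by vectors in the span of \<open>h\<close> to \<open>y'\<close> makes \<open>y'\<close> followed by \<open>h\<close> the dual
  basis of \<open>h\<close> followed by \<open>y\<close>. The second statement shows that a vector orthogonal to all of
  \<open>h\<close> is a combination of \<open>h\<close>.\<close>

lemma self_dual_resolution:
  fixes h :: "nat \<Rightarrow> nat \<Rightarrow> bit"
  assumes indep: "\<And>x. (\<And>i. i < 2 * m \<Longrightarrow> (\<Sum>j<m. x j * h j i) = 0) \<Longrightarrow> (\<forall>j<m. x j = 0)"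
    and isotropic: "\<And>j l. j < m \<Longrightarrow> l < m \<Longrightarrow> (\<Sum>i<2 * m. h j i * h l i) = 0"
  obtains y y' where
    "\<And>j l. j < m \<Longrightarrow> l < m \<Longrightarrow> (\<Sum>i<2 * m. h j i * y l i) = (if j = l then 1 else 0)"
    "\<And>i k. i < 2 * m \<Longrightarrow> k < 2 * m \<Longrightarrow>
        (\<Sum>j<m. h j i * y' j k) + (\<Sum>j<m. y j i * h j k) = (if i = k then 1 else 0)"
proof -
  obtain y where y: "\<And>j l. j < m \<Longrightarrow> l < m \<Longrightarrow> (\<Sum>i<2 * m. h j i * y l i) = (if j = l then 1 else 0)"
    using dual_family_exists[where h = h and n = "2 * m" and m = m, OF indep] by blast
  define \<gamma> where "\<gamma> j l = (\<Sum>i<2 * m. y j i * y l i)" for j l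
  define y' where "y' j i = y j i - (\<Sum>l<m. \<gamma> j l * h l i)" for j i
  have y'_sum: "(\<Sum>i<2 * m. y' j i * g i) = (\<Sum>i<2 * m. y j i * g i)
      - (\<Sum>l<m. \<gamma> j l * (\<Sum>i<2 * m. h l i * g i))" for j g
  proof -
    have "(\<Sum>i<2 * m. (\<Sum>l<m. \<gamma> j l * h l i) * g i)
        = (\<Sum>l<m. \<gamma> j l * (\<Sum>i<2 * m. h l i * g i))"
      by (simp only: sum_distrib_left sum_distrib_right mult.assoc) (rule sum.swap)
    then show ?thesis unfolding y'_def left_diff_distrib sum_subtractf by (simp only:)
  qed
  have hy: "(\<Sum>i<2 * m. y l i * h j i) = (if j = l then 1 else 0)" if "j < m" "l < m" for j l
    using y[OF that] by (simp only: mult.commute)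
  define G where "G j i = (if j < m then h j i else y (j - m) i)" for j i
  define Y where "Y j i = (if j < m then y' j i else h (j - m) i)" for j i
  have dual: "(\<Sum>i<2 * m. Y j i * G l i) = (if j = l then 1 else 0)" if "j < 2 * m" "l < 2 * m" for j l
  proof -
    consider "j < m" "l < m" | "j < m" "l \<ge> m" | "j \<ge> m" "l < m" | "j \<ge> m" "l \<ge> m" by linarith
    then show ?thesis
    proof cases
      case 1
      then have "(\<Sum>i<2 * m. Y j i * G l i) = (\<Sum>i<2 * m. y j i * h l i)
          - (\<Sum>k<m. \<gamma> j k * (\<Sum>i<2 * m. h k i * h l i))"
        by (simp only: Y_def G_def if_True y'_sum)
      also have "(\<Sum>k<m. \<gamma> j k * (\<Sum>i<2 * m. h k i * h l i)) = 0"
        using isotropic 1 by (intro sum.neutral ballI) (simp only: lessThan_iff mult_zero_right)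
      finally show ?thesis using 1 hy[of l j] by auto
    next
      case 2
      have "(\<Sum>k<m. \<gamma> j k * (\<Sum>i<2 * m. h k i * y (l - m) i))
          = (\<Sum>k<m. if k = l - m then \<gamma> j k else 0)"
        using y[of _ "l - m"] 2 that by (intro sum.cong) (auto simp: less_diff_conv2)
      also have "\<dots> = \<gamma> j (l - m)" using 2 that by (simp add: less_diff_conv2)
      finally show ?thesis using 2 unfolding Y_def G_def by (simp only: if_True y'_sum) (auto simp: \<gamma>_def)
    next
      case 3
      then show ?thesis using isotropic[of "j - m" l] that by (auto simp: Y_def G_def)
    next
      case 4
      then show ?thesis using y[of "j - m" "l - m"] that by (auto simp: Y_def G_def)
    qed
  qed
  show ?thesis
  proof (rule that)
    show "\<And>j l. j < m \<Longrightarrow> l < m \<Longrightarrow> (\<Sum>i<2 * m. h j i * y l i) = (if j = l then 1 else 0)" by (rule y)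
    fix i k assume ik: "i < 2 * m" "k < 2 * m"
    have "(\<Sum>j<2 * m. G j i * Y j k) = (if i = k then 1 else 0)"
      by (rule dual_bases_square[OF _ ik]) (rule dual)
    then show "(\<Sum>j<m. h j i * y' j k) + (\<Sum>j<m. y j i * h j k) = (if i = k then 1 else 0)"
      by (simp only: sum_lessThan_double) (simp add: G_def Y_def)
  qed
qed

text \<open>The matrix lowers the index of the vectors \<open>h\<close> by one, up to multiples of the all-ones
  vector, which is the last of them. Applying it \<open>K\<close> times to a relation whose first nonzero
  coefficient has index \<open>K\<close> gives a relation with a nonzero coefficient at index 0.\<close>

lemma krylov_independent:
  fixes A :: "nat \<Rightarrow> nat \<Rightarrow> bit"
  assumes step: "\<And>i k. i < n \<Longrightarrow> k \<le> N \<Longrightarrow>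
        (\<Sum>j<n. A i j * h k j) = q k + (case k of 0 \<Rightarrow> 0 | Suc l \<Rightarrow> h l i)"
    and top: "\<And>i. i < n \<Longrightarrow> h N i = 1"
    and base: "\<And>x. (\<And>i. i < n \<Longrightarrow> (\<Sum>j<Suc N. x j * h j i) = 0) \<Longrightarrow> x 0 = 0"
    and relation: "\<And>i. i < n \<Longrightarrow> (\<Sum>j<Suc N. x j * h j i) = 0"
  shows "\<forall>j<Suc N. x j = 0"
proof -
  have "K < Suc N \<Longrightarrow> (\<And>i. i < n \<Longrightarrow> (\<Sum>j<Suc N. x j * h j i) = 0)
      \<Longrightarrow> (\<And>j. j < K \<Longrightarrow> x j = 0) \<Longrightarrow> x K = 0" for K x
  proof (induction K arbitrary: x)
    case 0
    show ?case by (rule base) (rule 0)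
  next
    case (Suc K)
    define y where "y j = (if j = N then (\<Sum>l<Suc N. x l * q l) else x (Suc j))" for j
    have x0: "x 0 = 0" using Suc.prems(3) by simp
    have "y K = 0"
    proof (rule Suc.IH)
      show "K < Suc N" using Suc.prems(1) by simp
      show "y j = 0" if "j < K" for j
        using that Suc.prems by (simp add: y_def)
      fix i assume i: "i < n"
      have "0 = (\<Sum>i'<n. A i i' * (\<Sum>j<Suc N. x j * h j i'))" using Suc.prems(2) by simp
      also have "\<dots> = (\<Sum>j<Suc N. x j * (\<Sum>i'<n. A i i' * h j i'))"
        by (simp only: sum_distrib_left mult.left_commute) (rule sum.swap)
      also have "\<dots> = (\<Sum>j<Suc N. x j * q j + x j * (case j of 0 \<Rightarrow> 0 | Suc l \<Rightarrow> h l i))"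
        by (intro sum.cong refl) (simp only: step[OF i] lessThan_iff less_Suc_eq_le distrib_left)
      also have "\<dots> = (\<Sum>j<Suc N. x j * q j) + (\<Sum>j<Suc N. x j * (case j of 0 \<Rightarrow> 0 | Suc l \<Rightarrow> h l i))"
        by (simp only: sum.distrib)
      also have "(\<Sum>j<Suc N. x j * (case j of 0 \<Rightarrow> 0 | Suc l \<Rightarrow> h l i)) = (\<Sum>j<N. x (Suc j) * h j i)"
        by (subst sum.lessThan_Suc_shift) (simp add: x0)
      also have "(\<Sum>j<Suc N. x j * q j) + (\<Sum>j<N. x (Suc j) * h j i) = (\<Sum>j<Suc N. y j * h j i)"
        using top[OF i] by (simp add: y_def add.commute)
      finally show "(\<Sum>j<Suc N. y j * h j i) = 0" by simp
    qed
    then show ?case using Suc.prems(1) by (simp add: y_def)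
  qed note claim = this
  have "j < Suc N \<longrightarrow> x j = 0" for j
  proof (induction j rule: less_induct)
    case (less j)
    show ?case
    proof
      assume j: "j < Suc N"
      show "x j = 0"
      proof (rule claim[OF j])
        show "x i = 0" if "i < j" for i using less that j by simp
      qed (rule relation)
    qed
  qed
  then show ?thesis by blast
qed

section \<open>Coefficient vectors of the adjugate\<close>

lemma coeff_bit_square: "coeff ((q :: bit poly)\<^sup>2) k = (if even k then coeff q (k div 2) else 0)"
proof (induction q arbitrary: k)
  case (pCons c q)
  have "pCons c q = [:c:] + tvar * q" by (simp add: tvar_def)
  then have "(pCons c q)\<^sup>2 = [:c:] + tvar * (tvar * q\<^sup>2)"
    by (simp add: char2_add_square power_mult_distrib power2_eq_square[of tvar] mult.assoc)
  then show ?case using pCons.IH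
    by (auto simp: coeff_tvar_mult coeff_pCons split: nat.split elim!: evenE oddE)
qed simp

lemma sum_const_poly: "(\<Sum>i\<in>I. [:g i:]) = [:\<Sum>i\<in>I. g i :: 'a::comm_monoid_add:]"
  by (induction I rule: infinite_finite_induct) simp_all

context adjugate_system
begin

lemma coeff_adj_step:
  assumes "i < n" "j < n"
  shows "coeff (a i j) k = (if i = j then coeff F (Suc k) else 0) + (\<Sum>l<n. A i l * coeff (a l j) (Suc k))"
proof -
  have "(\<Sum>l<n. char_entry A i l * a l j)
      = (\<Sum>l<n. (if i = l then tvar * a l j else 0) - [:A i l:] * a l j)"
    by (intro sum.cong) (auto simp: char_entry_def left_diff_distrib)
  then have "(if i = j then F else 0) = tvar * a i j - (\<Sum>l<n. [:A i l:] * a l j)"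
    using assms by (simp only: char_mult_adj sum_subtractf) simp
  then have "tvar * a i j = (if i = j then F else 0) + (\<Sum>l<n. [:A i l:] * a l j)"
    unfolding eq_diff_eq by (rule sym)
  then have "coeff (tvar * a i j) (Suc k) = coeff ((if i = j then F else 0) + (\<Sum>l<n. [:A i l:] * a l j)) (Suc k)"
    by simp
  then show ?thesis by (simp add: coeff_tvar_mult coeff_sum)
qed

lemma coeff_adj_high:
  assumes "i < n" "j < n" "n \<le> k"
  shows "coeff (a i j) k = 0"
proof -
  define N where "N = Max ((\<lambda>(i, j). degree (a i j)) ` ({..<n} \<times> {..<n}))"
  have N: "degree (a i j) \<le> N" if "i < n" "j < n" for i j
    unfolding N_def using that by (intro Max_ge) auto
  have "\<forall>i<n. \<forall>j<n. \<forall>k\<ge>n. N < k + x \<longrightarrow> coeff (a i j) k = 0" for x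
  proof (induction x)
    case 0
    then show ?case using N by (metis add_0_right coeff_eq_0 le_less_trans)
  next
    case (Suc x)
    show ?case
    proof (intro allI impI)
      fix i j k assume *: "i < n" "j < n" "n \<le> k" "N < k + Suc x"
      have "coeff (a l j) (Suc k) = 0" if "l < n" for l
        using Suc.IH that * by simp
      then show "coeff (a i j) k = 0"
        using * F_degree by (simp add: coeff_adj_step[of i j k] coeff_eq_0)
    qed
  qed
  from this[of "Suc N"] show ?thesis using assms by simp
qed

lemma coeff_adj_top:
  assumes "i < n" "j < n" "Suc k = n"
  shows "coeff (a i j) k = (if i = j then 1 else 0)"
  using assms F_monic F_degree coeff_adj_high[of _ j n]
  by (simp add: coeff_adj_step[of i j k])

text \<open>All diagonal entries have the same coefficient there as \<open>F\<close> one degree higher, because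
  \<open>A\<close> has zero diagonal; their sum is a coefficient of the derivative of \<open>F\<close>, and comparing
  the factors \<open>n\<close> and \<open>n - 1\<close> leaves zero.\<close>

lemma coeff_diag_second:
  assumes "i < n" "Suc (Suc k) = n"
  shows "coeff (a i i) k = 0"
proof -
  have second: "coeff (a j j) k = coeff F (Suc k)" if "j < n" for j
  proof -
    have "(\<Sum>l<n. A j l * coeff (a l j) (Suc k)) = (\<Sum>l<n. if l = j then A j l else 0)"
      using that assms(2) by (intro sum.cong) (auto simp: coeff_adj_top)
    then show ?thesis using that by (simp add: coeff_adj_step[of j j k] A_diag)
  qed
  have "int n * coeff F (Suc k) = (\<Sum>j<n. coeff (a j j) k)" by (simp add: second)
  also have "\<dots> = coeff (pderiv F) k" by (simp add: coeff_sum flip: trace_adj)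
  also have "\<dots> = (int n - 1) * coeff F (Suc k)"
    by (simp add: coeff_pderiv flip: assms(2))
  finally have "coeff F (Suc k) = 0" by (simp add: algebra_simps)
  then show ?thesis using second assms by simp
qed

definition Ab :: "nat \<Rightarrow> nat \<Rightarrow> bit" where "Ab i j = of_int (A i j)"

lemma Ab_sym: "i < n \<Longrightarrow> j < n \<Longrightarrow> Ab i j = Ab j i"
  by (simp add: Ab_def A_sym)

lemma M_eq: "M i j = (if i = j then tvar else 0) + [:Ab i j:]"
  by (simp add: M_def char_entry_def Ab_def)

lemma sum_M_mult:
  assumes "i < n"
  shows "(\<Sum>k<n. M i k * g k) = tvar * g i + (\<Sum>k<n. [:Ab i k:] * g k)"
proof -
  have "(\<Sum>k<n. M i k * g k) = (\<Sum>k<n. (if k = i then tvar * g k else 0) + [:Ab i k:] * g k)"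
    by (intro sum.cong) (auto simp: M_eq distrib_right)
  then show ?thesis using assms by (simp add: sum.distrib)
qed

lemma Ab_mult_coeff:
  assumes "(\<Sum>k<n. M i k * g k) = q" and "i < n"
  shows "(\<Sum>j<n. Ab i j * coeff (g j) k) = coeff q k + (case k of 0 \<Rightarrow> 0 | Suc l \<Rightarrow> coeff (g i) l)"
proof -
  have "coeff (tvar * g i + (\<Sum>j<n. [:Ab i j:] * g j)) k = coeff q k"
    using assms by (simp add: sum_M_mult)
  then have "(case k of 0 \<Rightarrow> 0 | Suc l \<Rightarrow> coeff (g i) l) + (\<Sum>j<n. Ab i j * coeff (g j) k) = coeff q k"
    by (simp add: coeff_sum coeff_tvar_mult cong: nat.case_cong)
  then show ?thesis by (rule iffD1[OF bit_add_eq_iff])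
qed

lemma M_square:
  assumes "i < n" "j < n"
  shows "(M i j)\<^sup>2 = (if i = j then tvar\<^sup>2 else 0) + [:Ab i j:]"
  by (cases "i = j") (simp_all add: M_eq char2_add_square)

lemma sum_M_square_mult:
  assumes "i < n"
  shows "(\<Sum>k<n. (M i k)\<^sup>2 * g k) = tvar\<^sup>2 * g i + (\<Sum>k<n. [:Ab i k:] * g k)"
proof -
  have "(\<Sum>k<n. (M i k)\<^sup>2 * g k) = (\<Sum>k<n. (if k = i then tvar\<^sup>2 * g k else 0) + [:Ab i k:] * g k)"
    using assms by (intro sum.cong) (auto simp: M_square distrib_right)
  then show ?thesis using assms by (simp add: sum.distrib)
qed

end

context even_system
begin

definition m :: nat where "m = n div 2"

lemma n_eq: "n = 2 * m" using even_n by (simp add: m_def)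

lemma degree_p: "degree p = m" using p_degree n_eq by linarith

definition h :: "nat \<Rightarrow> nat \<Rightarrow> bit" where "h k i = coeff (d i) k"

lemma h_eq: "i < n \<Longrightarrow> h k i = of_int (coeff (a i i) (2 * k + 1))"
  using arg_cong[OF diag_root(1)[of i], of "\<lambda>q. coeff q (2 * k + 1)"]
  by (simp add: h_def coeff_tvar_mult coeff_bit_square b_def)

lemma h_high:
  assumes "i < n" "m \<le> k"
  shows "h k i = 0"
proof -
  have "n \<le> 2 * k + 1" using n_eq assms(2) by linarith
  then show ?thesis using assms(1) by (simp add: h_eq coeff_adj_high)
qed

lemma h_top:
  assumes "i < n" "Suc k = m"
  shows "h k i = 1"
proof -
  have "Suc (2 * k + 1) = n" using assms n_eq by linarith
  then show ?thesis using assms by (simp only: h_eq coeff_adj_top) simp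
qed

lemma degree_d:
  assumes "i < n"
  shows "degree (d i) \<le> m - 1"
proof (intro degree_le allI impI)
  fix k assume "m - 1 < k"
  then show "coeff (d i) k = 0" using h_high[OF assms, of k] by (simp add: h_def)
qed

text \<open>The coefficients of \<open>M d = p 1\<close>: multiplication by \<open>A\<close> shifts the index of \<open>h\<close>, up to
  constant vectors.\<close>

lemma Ab_mult_h:
  assumes "i < n"
  shows "(\<Sum>j<n. Ab i j * h k j) = coeff p k + (case k of 0 \<Rightarrow> 0 | Suc l \<Rightarrow> h l i)"
  unfolding h_def by (rule Ab_mult_coeff[OF M_mult_d[OF assms] assms])

lemma sum_h: "(\<Sum>i<n. h k i) = 0"
  using arg_cong[OF sum_d, of "\<lambda>q. coeff q k"] by (simp add: coeff_sum h_def)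

lemma Ab_self_adjoint:
  "(\<Sum>i<n. x i * (\<Sum>j<n. Ab i j * y j)) = (\<Sum>i<n. (\<Sum>j<n. Ab i j * x j) * y i)"
proof -
  have "(\<Sum>i<n. x i * (\<Sum>j<n. Ab i j * y j)) = (\<Sum>j<n. \<Sum>i<n. x i * (Ab i j * y j))"
    by (simp add: sum_distrib_left) (rule sum.swap)
  also have "\<dots> = (\<Sum>j<n. (\<Sum>i<n. Ab j i * x i) * y j)"
    unfolding sum_distrib_right by (intro sum.cong refl) (simp add: Ab_sym mult_ac)
  finally show ?thesis .
qed

text \<open>Since \<open>A\<close> is symmetric and each \<open>h\<^sub>k\<close> has coordinate sum zero, \<open>Ab_mult_h\<close> allows one
  unit of index to move from one factor of the inner product to the other. At the top index
  the vector is constant and the product vanishes.\<close>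

lemma h_isotropic:
  assumes "k < m" "l < m"
  shows "(\<Sum>i<n. h k i * h l i) = 0"
proof -
  define g where "g k l = (\<Sum>i<n. h k i * h l i)" for k l
  have sym: "g k l = g l k" for k l by (simp add: g_def mult.commute)
  have top: "g k l = 0" if "Suc l = m" for k l
    using that by (simp add: g_def h_top sum_h)
  have shift: "(case k of 0 \<Rightarrow> 0 | Suc k \<Rightarrow> g k l) = (case l of 0 \<Rightarrow> 0 | Suc l \<Rightarrow> g k l)" for k l
  proof -
    have "(\<Sum>i<n. h k i * (coeff p l + (case l of 0 \<Rightarrow> 0 | Suc l \<Rightarrow> h l i)))
        = (\<Sum>i<n. (coeff p k + (case k of 0 \<Rightarrow> 0 | Suc k \<Rightarrow> h k i)) * h l i)"
      (is "?lhs = ?rhs")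
    proof -
      have "?lhs = (\<Sum>i<n. h k i * (\<Sum>j<n. Ab i j * h l j))"
        by (rule sum.cong[OF refl]) (simp only: Ab_mult_h lessThan_iff)
      moreover have "?rhs = (\<Sum>i<n. (\<Sum>j<n. Ab i j * h k j) * h l i)"
        by (rule sum.cong[OF refl]) (simp only: Ab_mult_h lessThan_iff)
      ultimately show ?thesis by (simp only: Ab_self_adjoint)
    qed
    then have "coeff p l * (\<Sum>i<n. h k i) + (case l of 0 \<Rightarrow> 0 | Suc l \<Rightarrow> g k l)
        = coeff p k * (\<Sum>i<n. h l i) + (case k of 0 \<Rightarrow> 0 | Suc k \<Rightarrow> g k l)"
      by (cases k; cases l) (simp_all add: g_def distrib_left distrib_right sum.distrib sum_distrib_left mult_ac)
    then show ?thesis by (simp add: sum_h)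
  qed
  have "\<forall>l<m. g k l = 0"
  proof (induction k)
    case 0
    show ?case
    proof (intro allI impI)
      fix l assume "l < m"
      then consider "Suc l = m" | "Suc l < m" by linarith
      then show "g 0 l = 0" using top shift[of "Suc l" 0] sym[of 0 l] by cases simp_all
    qed
  next
    case (Suc k)
    show ?case
    proof (intro allI impI)
      fix l assume "l < m"
      then consider "Suc l = m" | "Suc l < m" by linarith
      then show "g (Suc k) l = 0" using top shift[of "Suc k" "Suc l"] Suc.IH sym[of "Suc k" l] sym[of "Suc l" k]
        by cases simp_all
    qed
  qed
  then show ?thesis using assms by (simp add: g_def)
qed

text \<open>Half the quadratic form of \<open>P\<close> at row \<open>i\<close> of \<open>M\<close>; halving makes sense because \<open>P\<close> is
  alternating.\<close>

definition Q :: "nat \<Rightarrow> bit poly" where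
  "Q i = (\<Sum>k<n. \<Sum>l<k. M i k * M i l * P k l)"

text \<open>The diagonal entry of \<open>M a M = F M\<close> is \<open>t F\<close>. Substitute \<open>a\<^sub>k\<^sub>k = t D\<^sub>k\<^sup>2 + 2 \<beta>\<^sub>k\<close> and,
  modulo 2, \<open>a\<^sub>k\<^sub>l = t D\<^sub>k D\<^sub>l + p P\<^sub>k\<^sub>l\<close>, where \<open>D\<close> lifts \<open>d\<close>. The terms with \<open>D\<close> form \<open>t\<close>
  times the square of a lift of \<open>p\<close>, which cancels modulo 4 against the square in \<open>t F\<close>; half
  of what remains is the asserted identity.\<close>

lemma char_entry_square_sum:
  assumes F: "F = (lift2 p)\<^sup>2 + 2 * \<eta>"
    and diag: "\<And>i. i < n \<Longrightarrow> a i i = tvar * (lift2 (d i))\<^sup>2 + 2 * \<beta> i"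
    and "i < n"
  shows "(\<Sum>k<n. (M i k)\<^sup>2 * mod2 (\<beta> k)) + p * Q i = tvar * mod2 \<eta>"
proof -
  define x where "x k = char_entry A i k" for k
  define D where "D k = lift2 (d k)" for k
  have x_sym: "char_entry A k i = x k" if "k < n" for k
    using that assms(3) by (simp add: x_def char_entry_def A_sym)
  have "(\<Sum>k<n. \<Sum>l<n. x k * (a k l * x l)) = (\<Sum>l<n. (\<Sum>k<n. x k * a k l) * x l)"
    by (subst sum.swap) (simp add: sum_distrib_right mult.assoc)
  also have "\<dots> = (\<Sum>l<n. if l = i then F * x l else 0)"
    using assms(3) by (intro sum.cong) (auto simp: x_def char_mult_adj)
  also have "\<dots> = F * tvar" using assms(3) by (simp add: x_def char_entry_def A_diag)
  finally have "F * tvar = (\<Sum>k<n. x k * (a k k * x k)) + 2 * (\<Sum>k<n. \<Sum>l<k. x k * (a k l * x l))"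
    by (subst (asm) sum_symmetric) (simp_all add: a_sym mult_ac)
  moreover have "(\<Sum>k<n. x k * (a k k * x k))
      = tvar * (\<Sum>k<n. (x k * D k) * (x k * D k)) + 2 * (\<Sum>k<n. (x k)\<^sup>2 * \<beta> k)"
    unfolding sum_distrib_left sum.distrib[symmetric]
    by (intro sum.cong refl) (simp add: diag D_def power2_eq_square algebra_simps)
  moreover have "(\<Sum>k<n. x k * D k)\<^sup>2 = (\<Sum>k<n. (x k * D k) * (x k * D k))
      + 2 * (\<Sum>k<n. \<Sum>l<k. (x k * D k) * (x l * D l))"
    unfolding power2_eq_square sum_product by (rule sum_symmetric) (simp add: mult_ac)
  moreover have "(\<Sum>k<n. \<Sum>l<k. x k * (a k l * x l)) - tvar * (\<Sum>k<n. \<Sum>l<k. (x k * D k) * (x l * D l))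
      = (\<Sum>k<n. \<Sum>l<k. x k * x l * (a k l - tvar * D k * D l))"
    unfolding sum_distrib_left sum_subtractf[symmetric]
    by (intro sum.cong refl) (simp add: algebra_simps)
  ultimately have eq: "F * tvar - tvar * (\<Sum>k<n. x k * D k)\<^sup>2
      = 2 * ((\<Sum>k<n. (x k)\<^sup>2 * \<beta> k) + (\<Sum>k<n. \<Sum>l<k. x k * x l * (a k l - tvar * D k * D l)))"
    by (simp add: algebra_simps)
  have xM: "mod2 (x k) = M i k" for k by (simp add: x_def M_def)
  have "mod2 (\<Sum>k<n. x k * D k) = mod2 (lift2 p)"
    using assms(3) by (simp add: xM D_def M_mult_d)
  then have "4 dvd (\<Sum>k<n. x k * D k)\<^sup>2 - (lift2 p)\<^sup>2" by (rule mod2_eq_imp_square_cong)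
  then obtain w where w: "(\<Sum>k<n. x k * D k)\<^sup>2 = (lift2 p)\<^sup>2 + 4 * w"
    by (auto simp: dvd_def algebra_simps)
  have generic: "Z * tvar - tvar * Y = 2 * (tvar * \<eta> - 2 * (tvar * w))"
    if "Z = L + 2 * \<eta>" "Y = L + 4 * w" for Z Y L
    using that by (simp add: algebra_simps)
  have "2 * (tvar * \<eta> - 2 * (tvar * w))
      = 2 * ((\<Sum>k<n. (x k)\<^sup>2 * \<beta> k) + (\<Sum>k<n. \<Sum>l<k. x k * x l * (a k l - tvar * D k * D l)))"
    using generic[OF F w] eq by (rule trans[OF sym])
  then have "tvar * \<eta> - 2 * (tvar * w)
      = (\<Sum>k<n. (x k)\<^sup>2 * \<beta> k) + (\<Sum>k<n. \<Sum>l<k. x k * x l * (a k l - tvar * D k * D l))"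
    by (simp only: mult_cancel_left) simp
  from arg_cong[OF this, of mod2]
  have "tvar * mod2 \<eta> = (\<Sum>k<n. (M i k)\<^sup>2 * mod2 (\<beta> k))
      + (\<Sum>k<n. \<Sum>l<k. M i k * M i l * (b k l + tvar * d k * d l))"
    by (simp add: xM D_def b_def)
  also have "(\<Sum>k<n. \<Sum>l<k. M i k * M i l * (b k l + tvar * d k * d l)) = p * Q i"
    unfolding Q_def sum_distrib_left
    by (intro sum.cong refl) (simp add: b_eq add.assoc algebra_simps)
  finally show ?thesis by simp
qed

lemma exists_const_square_sum:
  assumes "\<And>i. i < n \<Longrightarrow> a i i = tvar * (lift2 (d i))\<^sup>2 + 2 * \<beta> i"
  shows "\<exists>z. \<forall>i<n. (\<Sum>k<n. (M i k)\<^sup>2 * mod2 (\<beta> k)) + p * Q i = z"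
proof -
  have "mod2 (F - (lift2 p)\<^sup>2) = 0" using f_eq by (simp add: f_def)
  then obtain \<eta> where "F - (lift2 p)\<^sup>2 = 2 * \<eta>" by (rule mod2_eq_0E)
  then have "F = (lift2 p)\<^sup>2 + 2 * \<eta>" by (simp only: diff_eq_eq add.commute)
  then show ?thesis using char_entry_square_sum[OF _ assms] by blast
qed

end

section \<open>Even order: the quadratic correction of the diagonal\<close>

lemma coeff_square_top:
  fixes D :: "'a::comm_ring_1 poly"
  assumes "degree D \<le> Suc N"
  shows "2 * N + 2 < k \<Longrightarrow> coeff (D\<^sup>2) k = 0"
    and "coeff (D\<^sup>2) (2 * N + 2) = (coeff D (Suc N))\<^sup>2"
    and "coeff (D\<^sup>2) (2 * N + 1) = 2 * (coeff D N * coeff D (Suc N))"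
proof -
  have D0: "coeff D j = 0" if "Suc N < j" for j
    using assms that by (simp add: coeff_eq_0)
  show "coeff (D\<^sup>2) k = 0" if "2 * N + 2 < k"
    unfolding power2_eq_square coeff_mult
  proof (intro sum.neutral ballI)
    fix i assume "i \<in> {..k}"
    then have "Suc N < i \<or> Suc N < k - i" using that by auto
    then show "coeff D i * coeff D (k - i) = 0" using D0 by auto
  qed
  have "(\<Sum>i\<le>2 * N + 2. coeff D i * coeff D (2 * N + 2 - i)) = (\<Sum>i\<in>{Suc N}. coeff D i * coeff D (2 * N + 2 - i))"
  proof (intro sum.mono_neutral_right ballI)
    fix i assume "i \<in> {..2 * N + 2} - {Suc N}"
    then have "Suc N < i \<or> Suc N < 2 * N + 2 - i" by auto
    then show "coeff D i * coeff D (2 * N + 2 - i) = 0" using D0 by auto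
  qed auto
  then show "coeff (D\<^sup>2) (2 * N + 2) = (coeff D (Suc N))\<^sup>2"
    by (simp add: power2_eq_square coeff_mult)
  have "(\<Sum>i\<le>2 * N + 1. coeff D i * coeff D (2 * N + 1 - i)) = (\<Sum>i\<in>{N, Suc N}. coeff D i * coeff D (2 * N + 1 - i))"
  proof (intro sum.mono_neutral_right ballI)
    fix i assume "i \<in> {..2 * N + 1} - {N, Suc N}"
    then have "Suc N < i \<or> Suc N < 2 * N + 1 - i" by auto
    then show "coeff D i * coeff D (2 * N + 1 - i) = 0" using D0 by auto
  qed auto
  then show "coeff (D\<^sup>2) (2 * N + 1) = 2 * (coeff D N * coeff D (Suc N))"
    by (simp add: power2_eq_square coeff_mult algebra_simps Suc_diff_le)
qed

lemma coeff_two_mult: "coeff (2 * q :: int poly) k = 2 * coeff q k"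
  by (simp add: numeral_poly)

lemma coeff_lift2: "coeff (lift2 q) k = (if coeff q k = 1 then 1 else 0)"
  by (simp add: lift2_def coeff_map_poly)

context even_system
begin

text \<open>Modulo 2 the entrywise square of \<open>M\<close> is \<open>t\<^sup>2 I + A\<close>, which moves to \<open>h\<^sub>k\<close> in the inner
  product and shifts it by \<open>Ab_mult_h\<close>. The constant vector \<open>z\<close> is orthogonal to \<open>h\<^sub>k\<close>, so
  only a multiple of \<open>p\<close> is left.\<close>

lemma pair_with_h:
  assumes "\<And>i. i < n \<Longrightarrow> (\<Sum>k<n. (M i k)\<^sup>2 * g k) + p * Q i = z"
  shows "p dvd tvar\<^sup>2 * (\<Sum>i<n. [:h k i:] * g i)
      + (case k of 0 \<Rightarrow> 0 | Suc l \<Rightarrow> \<Sum>i<n. [:h l i:] * g i) + [:coeff p k:] * (\<Sum>i<n. g i)"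
proof -
  have "(\<Sum>i<n. [:h k i:] * (\<Sum>j<n. (M i j)\<^sup>2 * g j)) = (\<Sum>j<n. (\<Sum>i<n. (M j i)\<^sup>2 * [:h k i:]) * g j)"
  proof -
    have "(\<Sum>i<n. [:h k i:] * (\<Sum>j<n. (M i j)\<^sup>2 * g j)) = (\<Sum>j<n. \<Sum>i<n. [:h k i:] * ((M i j)\<^sup>2 * g j))"
      by (simp only: sum_distrib_left) (rule sum.swap)
    also have "\<dots> = (\<Sum>j<n. (\<Sum>i<n. (M j i)\<^sup>2 * [:h k i:]) * g j)"
      unfolding sum_distrib_right by (intro sum.cong refl) (simp add: M_sym mult_ac)
    finally show ?thesis .
  qed
  also have "\<dots> = (\<Sum>j<n. tvar\<^sup>2 * ([:h k j:] * g j)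
      + ((case k of 0 \<Rightarrow> 0 | Suc l \<Rightarrow> [:h l j:] * g j) + [:coeff p k:] * g j))"
  proof (intro sum.cong refl)
    fix j assume "j \<in> {..<n}"
    then have j: "j < n" by simp
    have "(\<Sum>i<n. [:Ab j i:] * [:h k i:]) = [:coeff p k + (case k of 0 \<Rightarrow> 0 | Suc l \<Rightarrow> h l j):]"
      using Ab_mult_h[OF j, of k] by (simp add: sum_const_poly mult.commute)
    also have "\<dots> = (case k of 0 \<Rightarrow> 0 | Suc l \<Rightarrow> [:h l j:]) + [:coeff p k:]"
      by (cases k) simp_all
    finally show "(\<Sum>i<n. (M j i)\<^sup>2 * [:h k i:]) * g j = tvar\<^sup>2 * ([:h k j:] * g j)
      + ((case k of 0 \<Rightarrow> 0 | Suc l \<Rightarrow> [:h l j:] * g j) + [:coeff p k:] * g j)"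
      by (simp only: sum_M_square_mult[OF j]) (cases k; simp add: algebra_simps smult_add_left)
  qed
  also have "\<dots> = tvar\<^sup>2 * (\<Sum>i<n. [:h k i:] * g i)
      + (case k of 0 \<Rightarrow> 0 | Suc l \<Rightarrow> \<Sum>i<n. [:h l i:] * g i) + [:coeff p k:] * (\<Sum>i<n. g i)"
    by (cases k) (simp_all add: sum.distrib sum_distrib_left add.assoc)
  finally have lhs: "(\<Sum>i<n. [:h k i:] * (\<Sum>j<n. (M i j)\<^sup>2 * g j)) = \<dots>" .
  have "(\<Sum>i<n. [:h k i:] * (\<Sum>j<n. (M i j)\<^sup>2 * g j)) = (\<Sum>i<n. [:h k i:] * (z + p * Q i))"
    using assms by (intro sum.cong refl arg_cong2[of _ _ _ _ "(*)"]) (simp add: bit_poly_add_eq_iff)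
  also have "\<dots> = (\<Sum>i<n. [:h k i:]) * z + p * (\<Sum>i<n. [:h k i:] * Q i)"
    by (simp add: distrib_left sum.distrib sum_distrib_left sum_distrib_right mult_ac)
  also have "\<dots> = p * (\<Sum>i<n. [:h k i:] * Q i)"
    by (simp only: sum_const_poly sum_h) simp
  finally show ?thesis unfolding lhs by simp
qed

end

text \<open>The case of even order that has to be excluded: \<open>c\<close> is odd, hence the two square roots
  are \<open>p\<close> and \<open>p + 1\<close>, and the equation for \<open>p\<close> is the outcome of \<open>p_shape\<close> after a possible
  exchange of the systems.\<close>

locale parity_clash = even_pair +
  assumes odd_c: "odd c" and p_form: "L.p = tvar * pderiv L.p + 1" and n_ge_4: "4 \<le> n"
begin

abbreviation p :: "bit poly" where "p \<equiv> L.p"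
abbreviation h :: "nat \<Rightarrow> nat \<Rightarrow> bit" where "h \<equiv> L.h"

text \<open>The last two coefficient vectors are \<open>h\<^sub>N\<close> and the all-ones vector \<open>h\<^sub>N\<^sub>+\<^sub>1\<close>.\<close>

definition N :: nat where "N = n div 2 - 2"

lemma m_eq: "L.m = N + 2" "R.m = N + 2"
  using n_ge_4 by (simp_all add: N_def L.m_def R.m_def)

lemma n_eq: "n = 2 * N + 4"
  using L.n_eq m_eq by linarith

lemma Rp: "R.p = p + 1" using p_shape odd_c by blast

lemma same_d: "i < n \<Longrightarrow> R.d i = L.d i"
  by (simp add: L.d_def R.d_def L.b_def R.b_def same_diag)

lemma same_h: "i < n \<Longrightarrow> R.h k i = h k i"
  by (simp add: L.h_def R.h_def same_d)

definition Db :: "nat \<Rightarrow> nat \<Rightarrow> bit" where "Db i j = L.Ab i j + R.Ab i j"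

lemma coeff_Rp: "coeff R.p k = coeff p k + (if k = 0 then 1 else 0)"
  by (simp add: Rp)

lemma Db_h:
  assumes "i < n"
  shows "(\<Sum>j<n. Db i j * h k j) = (if k = 0 then 1 else 0)"
proof -
  have "(\<Sum>j<n. R.Ab i j * h k j) = (\<Sum>j<n. R.Ab i j * R.h k j)" by (simp add: same_h)
  then have "(\<Sum>j<n. Db i j * h k j) = (\<Sum>j<n. L.Ab i j * h k j) + (\<Sum>j<n. R.Ab i j * R.h k j)"
    by (simp add: Db_def distrib_right sum.distrib)
  also have "\<dots> = (coeff p k + (case k of 0 \<Rightarrow> 0 | Suc l \<Rightarrow> h l i))
      + (coeff p k + (if k = 0 then 1 else 0) + (case k of 0 \<Rightarrow> 0 | Suc l \<Rightarrow> h l i))"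
    using assms by (simp only: L.Ab_mult_h R.Ab_mult_h coeff_Rp same_h)
  finally show ?thesis
    by (cases k; cases "coeff p k"; cases "h (k - 1) i") (simp_all add: bit_add_self_eq_0)
qed

text \<open>By \<open>Db_h\<close> the difference of the adjacency matrices sends a combination of the \<open>h\<^sub>j\<close> to
  its coefficient at \<open>h\<^sub>0\<close> times the all-ones vector, so no relation involves \<open>h\<^sub>0\<close>.\<close>

lemma h_independent:
  assumes "\<And>i. i < n \<Longrightarrow> (\<Sum>j<N + 2. x j * h j i) = 0"
  shows "\<forall>j<N + 2. x j = 0"
proof -
  have base: "y 0 = 0" if rel: "\<And>i. i < n \<Longrightarrow> (\<Sum>j<Suc (Suc N). y j * h j i) = 0" for y
  proof -
    have n0: "0 < n" using n_ge_4 by simp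
    have "0 = (\<Sum>i<n. Db 0 i * (\<Sum>j<Suc (Suc N). y j * h j i))" using rel by simp
    also have "\<dots> = (\<Sum>j<Suc (Suc N). y j * (\<Sum>i<n. Db 0 i * h j i))"
      by (simp only: sum_distrib_left mult.left_commute) (rule sum.swap)
    also have "\<dots> = (\<Sum>j<Suc (Suc N). if j = 0 then y j else 0)"
      by (intro sum.cong refl) (simp only: Db_h[OF n0], simp)
    finally show ?thesis by (simp add: sum.delta del: sum.lessThan_Suc)
  qed
  have "\<forall>j<Suc (Suc N). x j = 0"
  proof (rule krylov_independent)
    show "(\<Sum>j<n. L.Ab i j * h k j) = coeff p k + (case k of 0 \<Rightarrow> 0 | Suc l \<Rightarrow> h l i)"
      if "i < n" for i k using that by (rule L.Ab_mult_h)
    show "h (Suc N) i = 1" if "i < n" for i using that m_eq by (intro L.h_top) simp_all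
    show "z 0 = 0" if "\<And>i. i < n \<Longrightarrow> (\<Sum>j<Suc (Suc N). z j * h j i) = 0" for z
      using that by (rule base)
    show "(\<Sum>j<Suc (Suc N). x j * h j i) = 0" if "i < n" for i
      using assms[OF that] by simp
  qed
  then show ?thesis by simp
qed

definition \<beta> :: "nat \<Rightarrow> int poly" where
  "\<beta> i = (SOME x. a i i = tvar * (lift2 (L.d i))\<^sup>2 + 2 * x)"

lemma diag_eq:
  assumes "i < n"
  shows "a i i = tvar * (lift2 (L.d i))\<^sup>2 + 2 * \<beta> i"
proof -
  have "mod2 (a i i - tvar * (lift2 (L.d i))\<^sup>2) = 0"
    using L.diag_root(1)[OF assms] by (simp add: L.b_def)
  then obtain x where "a i i - tvar * (lift2 (L.d i))\<^sup>2 = 2 * x" by (rule mod2_eq_0E)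
  then have "a i i = tvar * (lift2 (L.d i))\<^sup>2 + 2 * x" by (simp add: algebra_simps)
  then show ?thesis unfolding \<beta>_def by (rule someI)
qed

definition g :: "nat \<Rightarrow> bit poly" where "g i = mod2 (\<beta> i)"

text \<open>The top coefficients of \<open>a\<^sub>i\<^sub>i\<close> are 1 and 0, so those of \<open>2 \<beta>\<^sub>i\<close> are given by the square
  of the lift of \<open>d\<^sub>i\<close>, whose second coefficient is twice a product.\<close>

lemma coeff_beta:
  assumes "i < n"
  shows "2 * N + 2 < k \<Longrightarrow> coeff (g i) k = 0" and "coeff (g i) (2 * N + 2) = h N i"
proof -
  let ?D = "lift2 (L.d i)"
  have deg: "degree ?D \<le> Suc N"
    using L.degree_d[OF assms] m_eq by (intro degree_le allI impI) (simp add: coeff_lift2 coeff_eq_0)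
  have twice: "2 * coeff (\<beta> i) (Suc k) = coeff (a i i) (Suc k) - coeff (?D\<^sup>2) k" for k
    using arg_cong[OF diag_eq[OF assms], of "\<lambda>q. coeff q (Suc k)"]
    by (simp add: coeff_tvar_mult coeff_two_mult)
  have top: "coeff ?D (Suc N) = 1"
    using L.h_top[OF assms, of "Suc N"] m_eq by (simp add: coeff_lift2 L.h_def)
  show "coeff (g i) k = 0" if k: "2 * N + 2 < k"
  proof -
    obtain k' where k': "k = Suc k'" using k by (cases k) auto
    have "2 * coeff (\<beta> i) k = 0"
    proof (cases "k' = 2 * N + 2")
      case True
      then have "coeff (a i i) (Suc k') = 1"
        using L.coeff_adj_top[OF assms assms, of "Suc k'"] n_eq by simp
      then show ?thesis using twice[of k'] coeff_square_top(2)[OF deg] top True k' by simp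
    next
      case False
      then have "coeff (a i i) (Suc k') = 0" "2 * N + 2 < k'"
        using L.coeff_adj_high[OF assms assms, of "Suc k'"] n_eq k k' by simp_all
      then show ?thesis using twice[of k'] coeff_square_top(1)[OF deg] k' by simp
    qed
    then show ?thesis by (simp add: g_def)
  qed
  have "Suc (Suc (Suc (2 * N + 1))) = n" using n_eq by simp
  then have "coeff (a i i) (Suc (2 * N + 1)) = 0" by (rule L.coeff_diag_second[OF assms])
  then have "coeff (\<beta> i) (2 * N + 2) = - coeff ?D N"
    using twice[of "2 * N + 1"] coeff_square_top(3)[OF deg] top by simp
  then show "coeff (g i) (2 * N + 2) = h N i"
    by (cases "coeff (L.d i) N") (simp_all add: g_def coeff_lift2 L.h_def)
qed

end

lemma coprime_shift_dvd:
  assumes "(q :: bit poly) dvd Z" "q + 1 dvd Z"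
  shows "q * (q + 1) dvd Z"
proof -
  have "q * (q + 1) dvd Z * (q + 1)" and "(q + 1) * q dvd Z * q"
    by (rule mult_dvd_mono[OF assms(1) dvd_refl], rule mult_dvd_mono[OF assms(2) dvd_refl])
  then have "q * (q + 1) dvd Z * (q + 1) + Z * q"
    by (intro dvd_add) (simp_all only: mult.commute)
  also have "Z * (q + 1) + Z * q = Z * ((q + q) + 1)" by (simp only: algebra_simps)
  finally show ?thesis by simp
qed

context parity_clash
begin

text \<open>The left hand sides of the equations of \<open>char_entry_square_sum\<close> for the first graph,
  without the multiple of \<open>p\<close>; \<open>hg k\<close> is the inner product of \<open>h\<^sub>k\<close> and \<open>g\<close>.\<close>

definition E :: "nat \<Rightarrow> bit poly" where "E i = (\<Sum>k<n. (L.M i k)\<^sup>2 * g k)"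

definition hg :: "nat \<Rightarrow> bit poly" where "hg k = (\<Sum>i<n. [:h k i:] * g i)"

lemma exists_E_eq: "\<exists>z. \<forall>i<n. E i + p * L.Q i = z"
  unfolding E_def g_def by (rule L.exists_const_square_sum) (rule diag_eq)

lemma exists_R_eq: "\<exists>z. \<forall>i<n. (\<Sum>k<n. (R.M i k)\<^sup>2 * g k) + (p + 1) * R.Q i = z"
proof -
  have "b i i = tvar * (lift2 (R.d i))\<^sup>2 + 2 * \<beta> i" if "i < n" for i
    using diag_eq[OF that] same_diag[OF that] same_d[OF that] by metis
  then show ?thesis unfolding g_def Rp[symmetric] by (rule R.exists_const_square_sum)
qed

lemma coeff_hg_high:
  assumes "k < N + 2" "2 * N + 2 \<le> j"
  shows "coeff (hg k) j = 0"
proof (cases "j = 2 * N + 2")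
  case True
  have "coeff (hg k) j = (\<Sum>i<n. h k i * h N i)"
    using True by (simp add: hg_def coeff_sum coeff_beta(2)[simplified])
  then show ?thesis using L.h_isotropic[of k N] assms m_eq by simp
next
  case False
  then show ?thesis using assms by (simp add: hg_def coeff_sum coeff_beta(1))
qed

lemma degree_pp: "degree (p * (p + 1)) = n"
proof -
  have "degree p = N + 2" using L.degree_p m_eq by simp
  moreover have "degree (p + 1) = N + 2" using R.degree_p m_eq by (simp flip: Rp)
  ultimately show ?thesis using n_eq L.p_neq_0 R.p_neq_0
    by (subst degree_mult_eq) (simp_all add: Rp)
qed

text \<open>The product of the coprime polynomials \<open>p\<close> and \<open>p + 1\<close> has degree \<open>n\<close>.\<close>

lemma pp_dvd_imp_0:
  assumes "p dvd Z" "p + 1 dvd Z" "\<And>j. n \<le> j \<Longrightarrow> coeff Z j = 0"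
  shows "Z = 0"
proof (rule ccontr)
  assume "Z \<noteq> 0"
  then have "n \<le> degree Z"
    using dvd_imp_degree_le[OF coprime_shift_dvd[OF assms(1,2)]] degree_pp by simp
  then have "lead_coeff Z = 0" by (rule assms(3))
  then show False using \<open>Z \<noteq> 0\<close> by simp
qed

lemma coeff_tvar_square_mult: "coeff (tvar\<^sup>2 * q) j = (if j < 2 then 0 else coeff q (j - 2))"
  by (auto simp: power2_eq_square mult.assoc coeff_tvar_mult numeral_2_eq_2 less_Suc_eq split: nat.split)

lemma sum_g: "(\<Sum>i<n. g i) = hg (Suc N)"
  using L.h_top[of _ "Suc N"] m_eq by (simp add: hg_def flip: one_pCons)

text \<open>By \<open>pair_with_h\<close> for the two graphs the difference of both sides is divisible by \<open>p\<close> and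
  by \<open>p + 1\<close>, and its degree is less than \<open>n\<close>.\<close>

lemma hg_recurrence:
  assumes "Suc k < N + 2"
  shows "hg k = tvar\<^sup>2 * hg (Suc k) + [:coeff p (Suc k):] * hg (Suc N)"
proof -
  define Z where "Z = tvar\<^sup>2 * hg (Suc k) + hg k + [:coeff p (Suc k):] * hg (Suc N)"
  obtain z where z: "\<And>i. i < n \<Longrightarrow> (\<Sum>k<n. (L.M i k)\<^sup>2 * g k) + p * L.Q i = z"
    using exists_E_eq unfolding E_def by blast
  obtain z' where z': "\<And>i. i < n \<Longrightarrow> (\<Sum>k<n. (R.M i k)\<^sup>2 * g k) + R.p * R.Q i = z'"
    using exists_R_eq unfolding Rp by blast
  have "p dvd Z"
    using L.pair_with_h[OF z, of "Suc k"] unfolding Z_def sum_g[symmetric] by (simp add: hg_def)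
  moreover have "p + 1 dvd Z"
    using R.pair_with_h[OF z', of "Suc k"] unfolding Z_def sum_g[symmetric]
    by (simp add: hg_def coeff_Rp Rp same_h)
  moreover have "coeff Z j = 0" if "n \<le> j" for j
    using that n_eq assms by (simp add: Z_def coeff_tvar_square_mult coeff_hg_high)
  ultimately have "Z = 0" by (rule pp_dvd_imp_0)
  then show ?thesis by (simp add: Z_def bit_poly_add_eq_iff bit_poly_add_eq_0_iff add.assoc)
qed

text \<open>If \<open>hg\<close> were nonzero at the top index, the recurrence would raise the degree by two at
  each step down, up to a degree at index 0 that exceeds the bound of \<open>coeff_hg_high\<close>.\<close>

lemma hg_top: "hg (Suc N) = 0"
proof (rule ccontr)
  assume nz: "hg (Suc N) \<noteq> 0"
  define \<delta> where "\<delta> = degree (hg (Suc N))"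
  have "hg (Suc N - j) \<noteq> 0 \<and> degree (hg (Suc N - j)) = \<delta> + 2 * j" if "j \<le> Suc N" for j
    using that
  proof (induction j)
    case 0
    show ?case using nz by (simp add: \<delta>_def)
  next
    case (Suc j)
    let ?k = "Suc N - Suc j"
    have Sk: "Suc ?k = Suc N - j" using Suc.prems by simp
    then have "hg ?k = tvar\<^sup>2 * hg (Suc N - j) + [:coeff p (Suc N - j):] * hg (Suc N)"
      using hg_recurrence[of ?k] by simp
    moreover have "degree (tvar\<^sup>2 * hg (Suc N - j)) = \<delta> + 2 * j + 2"
      using Suc by (subst degree_mult_eq) (auto simp: degree_power_eq tvar_def)
    moreover have "degree ([:coeff p (Suc N - j):] * hg (Suc N)) \<le> \<delta>"
      by (simp add: \<delta>_def)
    ultimately have deg: "degree (hg ?k) = \<delta> + 2 * j + 2"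
      by (simp add: degree_add_eq_left)
    then have "hg ?k \<noteq> 0" by (intro notI) simp
    then show ?case using deg by simp
  qed
  from this[of "Suc N"] have "hg 0 \<noteq> 0" "degree (hg 0) = \<delta> + 2 * Suc N" by simp_all
  moreover have "coeff (hg 0) (\<delta> + 2 * Suc N) = 0" by (rule coeff_hg_high) simp_all
  ultimately show False by (metis leading_coeff_0_iff)
qed

lemma hg_zero: "k < N + 2 \<Longrightarrow> hg k = 0"
proof (induction "Suc N - k" arbitrary: k)
  case 0
  then have "k = Suc N" by simp
  then show ?case by (simp add: hg_top)
next
  case (Suc x)
  then have "hg (Suc k) = 0" by simp
  then show ?case using hg_recurrence[of k] hg_top Suc by simp
qed

text \<open>Now \<open>g\<close> is orthogonal to every \<open>h\<^sub>k\<close>, hence in their span by \<open>self_dual_resolution\<close>. The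
  vector dual to \<open>h\<^sub>0\<close> shows that the entries of \<open>d\<close> have no common zero in any extension
  field.\<close>

lemma dual_vector: "\<exists>y. (\<Sum>i<n. [:y i:] * L.d i) = 1"
  and g_in_span: "\<exists>c. \<forall>i<n. g i = (\<Sum>j<N + 2. [:h j i:] * c j)"
proof -
  have n2: "n = 2 * (N + 2)" using n_eq by simp
  have iso: "\<And>j l. j < N + 2 \<Longrightarrow> l < N + 2 \<Longrightarrow> (\<Sum>i<n. h j i * h l i) = 0"
    using L.h_isotropic m_eq by simp
  obtain y y' where y: "\<And>j l. j < N + 2 \<Longrightarrow> l < N + 2 \<Longrightarrow> (\<Sum>i<n. h j i * y l i) = (if j = l then 1 else 0)"
    and res: "\<And>i k. i < n \<Longrightarrow> k < n \<Longrightarrow>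
        (\<Sum>j<N + 2. h j i * y' j k) + (\<Sum>j<N + 2. y j i * h j k) = (if i = k then 1 else 0)"
    by (rule self_dual_resolution[of "N + 2" h, folded n2, OF h_independent iso])
      (assumption | rule that)+
  have "(\<Sum>i<n. [:y 0 i:] * L.d i) = 1"
  proof (rule poly_eqI)
    fix k
    have "coeff (\<Sum>i<n. [:y 0 i:] * L.d i) k = (\<Sum>i<n. h k i * y 0 i)"
      by (simp add: coeff_sum L.h_def mult.commute)
    also have "\<dots> = (if k = 0 then 1 else 0)"
    proof (cases "k < N + 2")
      case True
      then show ?thesis using y[of k 0] by simp
    next
      case False
      then have "h k i = 0" if "i < n" for i using L.h_high[OF that, of k] m_eq by simp
      then show ?thesis using False by simp
    qed
    finally show "coeff (\<Sum>i<n. [:y 0 i:] * L.d i) k = coeff 1 k" by simp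
  qed
  then show "\<exists>y. (\<Sum>i<n. [:y i:] * L.d i) = 1" by blast
  have span: "g i = (\<Sum>j<N + 2. [:h j i:] * (\<Sum>k<n. [:y' j k:] * g k))" if i: "i < n" for i
  proof -
    have "g i = (\<Sum>k<n. if k = i then g k else 0)" using i by simp
    also have "\<dots> = (\<Sum>k<n. [:(\<Sum>j<N + 2. h j i * y' j k) + (\<Sum>j<N + 2. y j i * h j k):] * g k)"
      using i by (intro sum.cong refl) (simp only: res lessThan_iff, simp add: eq_commute)
    also have "\<dots> = (\<Sum>k<n. (\<Sum>j<N + 2. [:h j i:] * ([:y' j k:] * g k)))
        + (\<Sum>k<n. (\<Sum>j<N + 2. [:y j i:] * ([:h j k:] * g k)))"
      unfolding sum.distrib[symmetric]
      by (intro sum.cong refl) (simp add: smult_add_left smult_sum mult.commute)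
    also have "(\<Sum>k<n. (\<Sum>j<N + 2. [:y j i:] * ([:h j k:] * g k))) = (\<Sum>j<N + 2. [:y j i:] * hg j)"
      unfolding hg_def sum_distrib_left by (rule sum.swap)
    also have "\<dots> = 0" by (intro sum.neutral ballI) (simp only: hg_zero lessThan_iff mult_zero_right)
    also have "(\<Sum>k<n. (\<Sum>j<N + 2. [:h j i:] * ([:y' j k:] * g k)))
        = (\<Sum>j<N + 2. [:h j i:] * (\<Sum>k<n. [:y' j k:] * g k))"
      unfolding sum_distrib_left by (rule sum.swap)
    finally show ?thesis by simp
  qed
  show "\<exists>c. \<forall>i<n. g i = (\<Sum>j<N + 2. [:h j i:] * c j)"
    by (rule exI[where x = "\<lambda>j. \<Sum>k<n. [:y' j k:] * g k"]) (intro allI impI span)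
qed

lemma Db_mult_g: "\<exists>c0. \<forall>i<n. (\<Sum>k<n. [:Db i k:] * g k) = c0"
proof -
  obtain c where c: "\<And>i. i < n \<Longrightarrow> g i = (\<Sum>j<N + 2. [:h j i:] * c j)"
    using g_in_span by blast
  have "(\<Sum>k<n. [:Db i k:] * g k) = c 0" if i: "i < n" for i
  proof -
    have "(\<Sum>k<n. [:Db i k:] * g k) = (\<Sum>k<n. \<Sum>j<N + 2. [:Db i k:] * ([:h j k:] * c j))"
      by (intro sum.cong refl) (simp only: c lessThan_iff sum_distrib_left)
    also have "\<dots> = (\<Sum>j<N + 2. (\<Sum>k<n. [:Db i k * h j k:]) * c j)"
      unfolding sum_distrib_right by (subst sum.swap) (intro sum.cong refl, simp add: mult.commute)
    also have "\<dots> = (\<Sum>j<N + 2. if j = 0 then c j else 0)"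
      by (intro sum.cong refl) (simp only: sum_const_poly Db_h[OF i], simp)
    finally show ?thesis by simp
  qed
  then show ?thesis by blast
qed

text \<open>As \<open>g\<close> lies in the span of the \<open>h\<^sub>k\<close>, replacing one adjacency matrix by the other
  changes \<open>E\<close> by a constant vector (\<open>Db_mult_g\<close>). So the difference of two entries of \<open>E\<close> is
  divisible by \<open>p\<close> and by \<open>p + 1\<close>; having degree at most \<open>n\<close>, it is \<open>p (p + 1)\<close> times its
  coefficient of degree \<open>n\<close>.\<close>

lemma E_diff:
  assumes "i < n" "j < n"
  shows "E i + E j = p * (p + 1) * [:h N i + h N j:]"
proof -
  obtain z where z: "\<And>i. i < n \<Longrightarrow> E i + p * L.Q i = z"
    using exists_E_eq by blast
  obtain z' where z': "\<And>i. i < n \<Longrightarrow> (\<Sum>k<n. (R.M i k)\<^sup>2 * g k) + (p + 1) * R.Q i = z'"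
    using exists_R_eq by blast
  obtain c0 where c0: "\<And>i. i < n \<Longrightarrow> (\<Sum>k<n. [:Db i k:] * g k) = c0"
    using Db_mult_g by blast
  have ER: "(\<Sum>k<n. (R.M i k)\<^sup>2 * g k) = E i + c0" if "i < n" for i
  proof -
    have "E i + (\<Sum>k<n. [:Db i k:] * g k) = tvar\<^sup>2 * g i + ((\<Sum>k<n. [:L.Ab i k:] * g k) + (\<Sum>k<n. [:Db i k:] * g k))"
      by (simp only: E_def L.sum_M_square_mult[OF that] add.assoc)
    also have "(\<Sum>k<n. [:L.Ab i k:] * g k) + (\<Sum>k<n. [:Db i k:] * g k) = (\<Sum>k<n. [:R.Ab i k:] * g k)"
      unfolding sum.distrib[symmetric]
    proof (intro sum.cong refl)
      fix k
      have "L.Ab i k + Db i k = R.Ab i k"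
        unfolding Db_def by (simp add: bit_add_self_eq_0 flip: add.assoc)
      then show "[:L.Ab i k:] * g k + [:Db i k:] * g k = [:R.Ab i k:] * g k"
        by (metis add_pCons add_0 distrib_right)
    qed
    finally show ?thesis by (simp only: c0[OF that] R.sum_M_square_mult[OF that])
  qed
  define Z where "Z = E i + E j + p * (p + 1) * [:h N i + h N j:]"
  have "E i + E j = p * (L.Q i + L.Q j)"
    using z[OF assms(1)] z[OF assms(2)]
    by (metis (no_types, lifting) bit_poly_add_eq_0_iff add.commute add.left_commute bit_poly_add_eq_iff distrib_left)
  then have "p dvd Z" by (simp only: Z_def) (intro dvd_add dvd_mult2 dvd_triv_left)
  moreover have "E i + E j = (p + 1) * (R.Q i + R.Q j)"
  proof -
    have "(E i + c0) + (p + 1) * R.Q i = (E j + c0) + (p + 1) * R.Q j"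
      using z'[OF assms(1)] z'[OF assms(2)] ER assms by simp
    then have "((E i + c0) + (p + 1) * R.Q i) + ((E j + c0) + (p + 1) * R.Q j) = 0"
      by (simp only: bit_poly_add_self)
    then have "(E i + E j) + (p + 1) * (R.Q i + R.Q j) + (c0 + c0) = 0"
      by (simp only: distrib_left add_ac)
    then show ?thesis by (simp only: bit_poly_add_self add_0_right bit_poly_add_eq_0_iff)
  qed
  then have "p + 1 dvd Z" unfolding Z_def by (simp only:) (intro dvd_add dvd_mult2 dvd_mult dvd_triv_left dvd_refl)
  moreover have "coeff Z k = 0" if k: "n \<le> k" for k
  proof -
    have monic: "coeff (p * (p + 1)) n = 1" and high: "n < k \<Longrightarrow> coeff (p * (p + 1)) k = 0"
      using degree_pp L.p_neq_0 R.p_neq_0 Rp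
      by (metis bit_not_zero_iff leading_coeff_0_iff mult_eq_0_iff, simp add: coeff_eq_0)
    have n2: "n - 2 = 2 * N + 2" using n_eq by simp
    have "coeff (E l) k = (if k = n then h N l else 0)" if "l < n" for l
      using k that n_eq coeff_beta(2)[OF that]
      by (auto simp: E_def L.sum_M_square_mult coeff_tvar_square_mult coeff_sum coeff_beta(1) n2)
    then show ?thesis using k monic high assms
      by (cases "k = n") (simp_all add: Z_def mult.commute[of "p * (p + 1)"] bit_add_self_eq_0)
  qed
  ultimately have "Z = 0" by (rule pp_dvd_imp_0)
  then show ?thesis by (simp only: Z_def bit_poly_add_eq_0_iff)
qed

lemma Q_diff:
  assumes "i < n" "j < n"
  shows "L.Q i + L.Q j = (p + 1) * [:h N i + h N j:]"
proof -
  obtain z where z: "\<And>i. i < n \<Longrightarrow> E i + p * L.Q i = z"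
    using exists_E_eq by blast
  have "(E i + p * L.Q i) + (E j + p * L.Q j) = 0" using z assms by simp
  then have "(E i + E j) + p * (L.Q i + L.Q j) = 0" by (simp only: distrib_left add_ac)
  then have "p * (L.Q i + L.Q j) = p * ((p + 1) * [:h N i + h N j:])"
    using E_diff[OF assms] by (simp only: bit_poly_add_eq_0_iff mult.assoc)
  then show ?thesis by (rule mult_left_cancel[OF L.p_neq_0, THEN iffD1])
qed

end

section \<open>Even order: specialisation at a root\<close>

definition eval_ac :: "bit alg_closure \<Rightarrow> bit poly \<Rightarrow> bit alg_closure" where
  "eval_ac \<theta> f = poly (map_poly to_ac f) \<theta>"

lemma map_poly_to_ac_mult: "map_poly to_ac (f * g) = map_poly to_ac f * map_poly to_ac (g :: 'a::field poly)"
  by (rule poly_eqI) (simp add: coeff_map_poly coeff_mult to_ac_sum)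

lemma eval_ac_0 [simp]: "eval_ac \<theta> 0 = 0"
  and eval_ac_1 [simp]: "eval_ac \<theta> 1 = 1"
  and eval_ac_tvar [simp]: "eval_ac \<theta> tvar = \<theta>"
  and eval_ac_const: "eval_ac \<theta> [:c:] = to_ac c"
  by (cases "c = 0"; simp add: eval_ac_def tvar_def map_poly_pCons)+

lemma eval_ac_add [simp]: "eval_ac \<theta> (f + g) = eval_ac \<theta> f + eval_ac \<theta> g"
proof -
  have "map_poly to_ac (f + g) = map_poly to_ac f + map_poly to_ac g"
    by (rule poly_eqI) (simp add: coeff_map_poly)
  then show ?thesis by (simp add: eval_ac_def)
qed

lemma eval_ac_mult [simp]: "eval_ac \<theta> (f * g) = eval_ac \<theta> f * eval_ac \<theta> g"
  by (simp add: eval_ac_def map_poly_to_ac_mult)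

lemma eval_ac_sum [simp]: "eval_ac \<theta> (sum f I) = (\<Sum>i\<in>I. eval_ac \<theta> (f i))"
  by (induction I rule: infinite_finite_induct) simp_all

lemma alg_closure_bit_add_self [simp]: "(x :: bit alg_closure) + x = 0"
proof -
  have "x + x = x * to_ac (1 + 1)" by (simp only: to_ac_add to_ac_1 distrib_left mult_1_right)
  also have "(1 + 1 :: bit) = 0" by simp
  finally show ?thesis by simp
qed

lemma alg_closure_bit_add_eq_iff: "(x :: bit alg_closure) + y = z \<longleftrightarrow> x = z + y"
  by (metis add.assoc add_0_right alg_closure_bit_add_self)

lemma alg_closure_bit_add_eq_0_iff: "(x :: bit alg_closure) + y = 0 \<longleftrightarrow> x = y"
  by (simp add: alg_closure_bit_add_eq_iff)

lemma alg_closure_bit_square_add: "((x :: bit alg_closure) + y)\<^sup>2 = x\<^sup>2 + y\<^sup>2"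
proof -
  have "(x + y)\<^sup>2 = x\<^sup>2 + y\<^sup>2 + (x * y + x * y)" by (simp only: power2_eq_square algebra_simps)
  then show ?thesis by simp
qed

lemma alg_closure_bit_square_sum: "(sum f I :: bit alg_closure)\<^sup>2 = (\<Sum>i\<in>I. (f i)\<^sup>2)"
  by (induction I rule: infinite_finite_induct) (simp_all add: alg_closure_bit_square_add)

lemma to_ac_bit_square: "(to_ac (c :: bit))\<^sup>2 = to_ac c"
  by (cases c) simp_all

lemma sum_mult_sum_pairs:
  fixes u v :: "nat \<Rightarrow> 'a::comm_ring_1"
  shows "(\<Sum>i<n. u i) * (\<Sum>i<n. v i) = (\<Sum>i<n. u i * v i) + (\<Sum>i<n. \<Sum>j<i. u i * v j + u j * v i)"
  unfolding sum_product by (rule sum_square_split)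

text \<open>Write \<open>A d = \<theta> d\<close>, \<open>A k = \<theta> k + \<theta> 1\<close>, and let \<open>e\<close> be the entrywise product of \<open>d\<close> and
  \<open>k\<close>, so that the last assumption reads \<open>A e = \<theta>\<^sup>2 e + A 1 + C 1\<close>. Pair this with \<open>k\<close> and
  with the entrywise square \<open>k\<^sup>2\<close>, moving the symmetric matrix \<open>A\<close> to the other factor; by
  Frobenius \<open>A k\<^sup>2\<close> is the entrywise square of \<open>A k\<close>. The two results are \<open>1 = \<theta> + C\<close> and
  \<open>\<theta> = \<theta>\<^sup>2 + C\<close>.\<close>

lemma rank_two_contradiction:
  fixes d k w :: "nat \<Rightarrow> bit alg_closure" and A :: "nat \<Rightarrow> nat \<Rightarrow> bit"
  assumes sym: "\<And>i j. i < n \<Longrightarrow> j < n \<Longrightarrow> A i j = A j i"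
    and d: "\<And>i. i < n \<Longrightarrow> \<theta> * d i + (\<Sum>j<n. to_ac (A i j) * d j) = 0"
    and k: "\<And>i. i < n \<Longrightarrow> \<theta> * k i + (\<Sum>j<n. to_ac (A i j) * k j) = \<theta>"
    and sum_d: "(\<Sum>i<n. d i) = 0" and sum_k: "(\<Sum>i<n. k i) = 1"
    and dk: "(\<Sum>i<n. d i * k i) = c" and c: "\<theta> * c = 1"
    and even_n: "even n"
    and prod: "\<And>i. i < n \<Longrightarrow> \<theta>\<^sup>2 * (d i * k i) + (\<Sum>j<n. to_ac (A i j) * (d j * k j))
                  = (\<Sum>j<n. to_ac (A i j)) + C"
  shows "\<theta> = 1"
proof -
  define W where "W i = (\<Sum>j<n. to_ac (A i j))" for i
  define T where "T x i = (\<Sum>j<n. to_ac (A i j) * x j)" for x :: "nat \<Rightarrow> bit alg_closure" and i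
  have T_adj: "(\<Sum>i<n. x i * T y i) = (\<Sum>i<n. T x i * y i)" for x y
  proof -
    have "(\<Sum>i<n. x i * T y i) = (\<Sum>j<n. \<Sum>i<n. x i * (to_ac (A i j) * y j))"
      by (simp add: T_def sum_distrib_left) (rule sum.swap)
    also have "\<dots> = (\<Sum>j<n. T x j * y j)"
      unfolding T_def sum_distrib_right by (intro sum.cong refl) (simp add: sym mult_ac)
    finally show ?thesis .
  qed
  have Td: "T d i = \<theta> * d i" if "i < n" for i
    using d[OF that] by (simp only: T_def alg_closure_bit_add_eq_0_iff)
  have Tk: "T k i = \<theta> + \<theta> * k i" if "i < n" for i
  proof -
    have "T k i + \<theta> * k i = \<theta>" using k[OF that] by (simp only: T_def add.commute)
    then show ?thesis by (rule iffD1[OF alg_closure_bit_add_eq_iff])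
  qed
  have T_sq: "(T x i)\<^sup>2 = T (\<lambda>j. (x j)\<^sup>2) i" for x i
    by (simp add: T_def alg_closure_bit_square_sum power_mult_distrib to_ac_bit_square)
  have n0: "(\<Sum>i<n. \<theta>) = 0"
  proof -
    obtain l where "n = l + l" using even_n by (metis evenE mult_2)
    then have "(of_nat n :: bit alg_closure) = of_nat l + of_nat l" by (simp only: of_nat_add)
    also have "\<dots> = 0" by (rule alg_closure_bit_add_self)
    finally have "(of_nat n :: bit alg_closure) = 0" .
    then show ?thesis by (simp only: sum_constant card_lessThan mult_zero_left)
  qed
  have W_eq: "(\<Sum>i<n. W i * x i) = (\<Sum>i<n. T x i)" for x
    using T_adj[of "\<lambda>_. 1" x] by (simp add: T_def W_def)
  have Wk: "(\<Sum>i<n. W i * k i) = \<theta>"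
  proof -
    have "(\<Sum>i<n. T k i) = (\<Sum>i<n. \<theta>) + \<theta> * (\<Sum>i<n. k i)"
      unfolding sum_distrib_left sum.distrib[symmetric] by (intro sum.cong refl) (simp add: Tk)
    then show ?thesis by (simp only: W_eq n0 sum_k) simp
  qed
  have Wk2: "(\<Sum>i<n. W i * (k i)\<^sup>2) = \<theta>\<^sup>2"
  proof -
    have "(\<Sum>i<n. W i * (k i)\<^sup>2) = (\<Sum>i<n. T k i)\<^sup>2"
      unfolding W_eq by (simp add: T_sq alg_closure_bit_square_sum)
    also have "(\<Sum>i<n. T k i) = \<theta>" using Wk by (simp add: W_eq)
    finally show ?thesis .
  qed
  have sum_k2: "(\<Sum>i<n. (k i)\<^sup>2) = 1"
    using alg_closure_bit_square_sum[of k "{..<n}"] sum_k by simp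
  have Tk2: "T (\<lambda>j. (k j)\<^sup>2) i = \<theta>\<^sup>2 + \<theta>\<^sup>2 * (k i)\<^sup>2" if "i < n" for i
    using Tk[OF that] by (simp add: alg_closure_bit_square_add power_mult_distrib flip: T_sq)
  define e where "e i = d i * k i" for i
  have prod': "T e i = \<theta>\<^sup>2 * e i + (W i + C)" if "i < n" for i
  proof -
    have "T e i + \<theta>\<^sup>2 * e i = W i + C"
      using prod[OF that] by (simp only: T_def e_def W_def add.commute)
    then have "T e i = W i + C + \<theta>\<^sup>2 * e i" by (rule iffD1[OF alg_closure_bit_add_eq_iff])
    then show ?thesis by (simp only: add.commute)
  qed
  \<comment> \<open>Two evaluations of one pairing: the cubic sum has the same product with \<open>\<theta>\<close> and with \<open>\<theta>\<^sup>2\<close>,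
      which lets it cancel below.\<close>
  have "(\<Sum>i<n. d i * T (\<lambda>j. (k j)\<^sup>2) i) = (\<Sum>i<n. \<theta> * (d i * (k i)\<^sup>2))"
    unfolding T_adj by (intro sum.cong refl) (simp add: Td mult_ac)
  moreover have "(\<Sum>i<n. d i * T (\<lambda>j. (k j)\<^sup>2) i) = \<theta>\<^sup>2 * (\<Sum>i<n. d i) + (\<Sum>i<n. \<theta>\<^sup>2 * (d i * (k i)\<^sup>2))"
    unfolding sum_distrib_left sum.distrib[symmetric]
    by (intro sum.cong refl) (simp add: Tk2 algebra_simps)
  ultimately have cubic: "\<theta>\<^sup>2 * (\<Sum>i<n. d i * (k i)\<^sup>2) = \<theta> * (\<Sum>i<n. d i * (k i)\<^sup>2)"
    by (simp add: sum_d flip: sum_distrib_left)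
  have cub: "(\<Sum>i<n. e i * k i) = (\<Sum>i<n. d i * (k i)\<^sup>2)"
    by (simp add: e_def power2_eq_square mult_ac)
  have sum_e: "(\<Sum>i<n. e i) = c" using dk by (simp add: e_def)
  have "(\<Sum>i<n. T e i * k i) = (\<Sum>i<n. e i * T k i)" by (rule T_adj[symmetric])
  also have "\<dots> = \<theta> * c + \<theta> * (\<Sum>i<n. e i * k i)"
    unfolding sum_e[symmetric] sum_distrib_left sum.distrib[symmetric]
    by (intro sum.cong refl) (simp add: Tk algebra_simps)
  finally have k1: "(\<Sum>i<n. T e i * k i) = \<theta> * c + \<theta> * (\<Sum>i<n. e i * k i)" .
  have "(\<Sum>i<n. T e i * k i) = \<theta>\<^sup>2 * (\<Sum>i<n. e i * k i) + ((\<Sum>i<n. W i * k i) + C * (\<Sum>i<n. k i))"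
    unfolding sum_distrib_left sum.distrib[symmetric]
    by (intro sum.cong refl) (simp add: prod' algebra_simps)
  then have "1 + \<theta> * (\<Sum>i<n. e i * k i) = \<theta> * (\<Sum>i<n. e i * k i) + (\<theta> + C)"
    using k1 c Wk sum_k cubic cub by simp
  then have C: "1 = \<theta> + C" by (metis add.commute add_left_cancel)
  have "(\<Sum>i<n. T e i * (k i)\<^sup>2) = (\<Sum>i<n. e i * T (\<lambda>j. (k j)\<^sup>2) i)" by (rule T_adj[symmetric])
  also have "\<dots> = \<theta>\<^sup>2 * c + \<theta>\<^sup>2 * (\<Sum>i<n. e i * (k i)\<^sup>2)"
    unfolding sum_e[symmetric] sum_distrib_left sum.distrib[symmetric]
    by (intro sum.cong refl) (simp add: Tk2 algebra_simps)
  finally have k2: "(\<Sum>i<n. T e i * (k i)\<^sup>2) = \<theta>\<^sup>2 * c + \<theta>\<^sup>2 * (\<Sum>i<n. e i * (k i)\<^sup>2)" .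
  have "(\<Sum>i<n. T e i * (k i)\<^sup>2) = \<theta>\<^sup>2 * (\<Sum>i<n. e i * (k i)\<^sup>2)
      + ((\<Sum>i<n. W i * (k i)\<^sup>2) + C * (\<Sum>i<n. (k i)\<^sup>2))"
    unfolding sum_distrib_left sum.distrib[symmetric]
    by (intro sum.cong refl) (simp add: prod' algebra_simps)
  then have "\<theta>\<^sup>2 * c = \<theta>\<^sup>2 + C"
    using k2 Wk2 sum_k2 by (simp add: add.commute)
  moreover have "\<theta>\<^sup>2 * c = \<theta>" using c by (simp add: power2_eq_square mult.assoc)
  ultimately have "\<theta> = \<theta>\<^sup>2 + C" by simp
  then have "\<theta>\<^sup>2 + \<theta> = \<theta> + 1"
    using C by (metis add.commute add.left_commute alg_closure_bit_add_self add_0_right)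
  then have "(\<theta> + 1)\<^sup>2 = 0"
    by (simp add: alg_closure_bit_square_add)
  then show ?thesis by (simp add: alg_closure_bit_add_eq_0_iff)
qed

lemma eval_ac_one: "eval_ac 1 f = to_ac (poly f 1)"
  by (induction f) (simp_all add: eval_ac_def map_poly_pCons)

lemma eval_ac_has_root:
  assumes "0 < degree q"
  obtains \<theta> where "eval_ac \<theta> q = 0"
proof -
  have "degree (map_poly to_ac q) = degree q"
    by (intro degree_map_poly) simp
  then show ?thesis
    using alg_closed_imp_poly_has_root[of "map_poly to_ac q"] assms that
    by (auto simp: eval_ac_def)
qed

text \<open>If 1 is a root, the equation gives derivative 1 there, so 1 is a simple root and the
  remaining factor, not being constant, has a different root.\<close>

lemma root_other_than_one:
  assumes "2 \<le> degree q" and form: "q = tvar * pderiv q + 1"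
  obtains \<theta> where "eval_ac \<theta> q = 0" "\<theta> \<noteq> 1"
proof (cases "eval_ac 1 q = 0")
  case False
  have "0 < degree q" using assms(1) by simp
  then obtain \<theta> where "eval_ac \<theta> q = 0" by (rule eval_ac_has_root)
  then show ?thesis using False that by metis
next
  case True
  then have "poly q 1 = 0" by (simp add: eval_ac_one)
  then obtain s where "q = [:-1, 1:] * s" by (auto simp: poly_eq_0_iff_dvd dvd_def)
  moreover have "[:-1, 1 :: bit:] = tvar + 1" by (simp add: tvar_def one_pCons)
  ultimately have s: "q = (tvar + 1) * s" by (simp only:)
  have deg_t: "degree (tvar + 1 :: bit poly) = 1" by (simp add: tvar_def one_pCons)
  have "q \<noteq> 0" using assms(1) by auto
  then have "degree q = 1 + degree s"
    using deg_t by (simp only: s) (subst degree_mult_eq, auto)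
  then have "0 < degree s" using assms(1) by simp
  then obtain \<theta> where \<theta>: "eval_ac \<theta> s = 0" by (rule eval_ac_has_root)
  have "eval_ac 1 (pderiv q) = eval_ac 1 (s + (tvar + 1) * pderiv s)"
    by (subst s) (simp only: pderiv_mult pderiv_add pderiv_tvar pderiv_1, simp add: add.commute)
  also have "\<dots> = eval_ac 1 s" by simp
  finally have "eval_ac 1 q = eval_ac 1 s + 1"
    using arg_cong[OF form, of "eval_ac 1"] by simp
  then have "eval_ac 1 s = 1" using True by (simp add: alg_closure_bit_add_eq_0_iff)
  then have "\<theta> \<noteq> 1" using \<theta> by auto
  moreover have "eval_ac \<theta> q = 0" by (subst s) (simp add: \<theta>)
  ultimately show ?thesis by (rule that[rotated])
qed

text \<open>At a root \<open>\<theta>\<close> of \<open>p\<close> the Pluecker relations turn \<open>P\<close> into \<open>d k\<^sup>T + k d\<^sup>T\<close>, where \<open>k\<close> is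
  a row of \<open>P\<close> divided by an entry of \<open>d\<close> that does not vanish. The equations for \<open>P\<close> and \<open>d\<close>
  and the explicit form of \<open>Q\<close> are then the hypotheses of \<open>rank_two_contradiction\<close>.\<close>

theorem (in parity_clash) contradiction: False
proof -
  have "2 \<le> degree p" using L.degree_p m_eq by simp
  then obtain \<theta> where p0: "eval_ac \<theta> p = 0" and \<theta>1: "\<theta> \<noteq> 1"
    using root_other_than_one[OF _ p_form] by blast
  define c' where "c' = eval_ac \<theta> (pderiv p)"
  have "eval_ac \<theta> p = \<theta> * c' + 1"
    by (subst p_form) (simp add: c'_def)
  then have c': "\<theta> * c' = 1" using p0 by (simp add: alg_closure_bit_add_eq_0_iff)
  then have \<theta>0: "\<theta> \<noteq> 0" by auto
  define ev where "ev = eval_ac \<theta>"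
  define d where "d i = ev (L.d i)" for i
  define P where "P i j = ev (L.P i j)" for i j
  obtain y where y: "(\<Sum>i<n. [:y i:] * L.d i) = 1" using dual_vector by blast
  have "\<exists>i0<n. d i0 \<noteq> 0"
  proof (rule ccontr)
    assume "\<not> ?thesis"
    then have "\<And>i. i < n \<Longrightarrow> ev (L.d i) = 0" by (auto simp: d_def)
    then have "ev (\<Sum>i<n. [:y i:] * L.d i) = 0"
      by (simp only: ev_def eval_ac_sum eval_ac_mult) (simp add: ev_def)
    then show False unfolding y by (simp add: ev_def)
  qed
  then obtain i0 where i0: "i0 < n" "d i0 \<noteq> 0" by blast
  define k where "k j = P i0 j / d i0" for j
  have P_sym: "P i j = P j i" if "i < n" "j < n" for i j
    using that by (simp add: P_def L.P_sym)
  have P_eq: "P j l = d l * k j + d j * k l" if jl: "j < n" "l < n" for j l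
  proof -
    obtain u where u: "tvar * L.d i0 * (L.d i0 * L.P j l + L.d l * L.P j i0 + L.d j * L.P i0 l) = p * u"
      using L.pluecker[OF i0(1) jl] by (auto simp: dvd_def)
    have "\<theta> * d i0 * (d i0 * P j l + d l * P j i0 + d j * P i0 l) = 0"
      using arg_cong[OF u, of ev] by (simp add: ev_def d_def P_def p0)
    then have "d i0 * P j l + (d l * P j i0 + d j * P i0 l) = 0"
      using \<theta>0 i0 by (simp add: add.assoc)
    then have "d i0 * P j l = d l * P i0 j + d j * P i0 l"
      using P_sym[OF jl(1) i0(1)] by (simp add: alg_closure_bit_add_eq_0_iff)
    then show ?thesis using i0(2) by (simp add: k_def field_simps)
  qed
  have M_row: "\<theta> * ev (g i) + (\<Sum>j<n. to_ac (L.Ab i j) * ev (g j)) = ev (\<Sum>j<n. L.M i j * g j)"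
    if "i < n" for i and g :: "nat \<Rightarrow> bit poly"
    by (simp add: L.sum_M_mult[OF that] ev_def eval_ac_const del: mult_pCons_left)
  have d_eq: "\<theta> * d i + (\<Sum>j<n. to_ac (L.Ab i j) * d j) = 0" if "i < n" for i
    using M_row[OF that, of L.d] by (simp add: d_def L.M_mult_d that p0[folded ev_def])
  have k_eq: "\<theta> * k i + (\<Sum>j<n. to_ac (L.Ab i j) * k j) = \<theta>" if i: "i < n" for i
  proof -
    have "\<theta> * P i i0 + (\<Sum>j<n. to_ac (L.Ab i j) * P j i0) = \<theta> * d i0"
      using M_row[OF i, of "\<lambda>j. L.P j i0"] i0 p0
      by (simp add: P_def d_def L.M_mult_P i) (simp add: ev_def)
    moreover have "(\<Sum>j<n. to_ac (L.Ab i j) * P j i0) = (\<Sum>j<n. to_ac (L.Ab i j) * P i0 j)"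
      using i0 by (intro sum.cong refl) (simp add: P_sym)
    ultimately have "\<theta> * P i0 i + (\<Sum>j<n. to_ac (L.Ab i j) * P i0 j) = \<theta> * d i0"
      using P_sym[OF i i0(1)] by simp
    then have "(\<theta> * P i0 i + (\<Sum>j<n. to_ac (L.Ab i j) * P i0 j)) / d i0 = \<theta>"
      using i0 by simp
    then show ?thesis by (simp add: k_def add_divide_distrib sum_divide_distrib)
  qed
  have sum_d: "(\<Sum>i<n. d i) = 0"
    using arg_cong[OF L.sum_d, of ev] by (simp add: d_def ev_def)
  have "(\<Sum>j<n. P i0 j) = d i0"
    using arg_cong[OF L.sum_P[OF i0(1)], of ev] by (simp add: P_def d_def ev_def)
  then have sum_k: "(\<Sum>i<n. k i) = 1"
    using i0 by (simp add: k_def flip: sum_divide_distrib)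
  \<comment> \<open>Differentiate \<open>M d = p 1\<close>, evaluate at \<open>\<theta>\<close> and pair with \<open>k\<close>, which turns \<open>M\<close> into a
      multiple of the coordinate sum of the derivative of \<open>d\<close>; that sum is zero.\<close>
  have dk: "(\<Sum>i<n. d i * k i) = c'"
  proof -
    define d' where "d' i = ev (pderiv (L.d i))" for i
    have deriv: "d i + (\<theta> * d' i + (\<Sum>j<n. to_ac (L.Ab i j) * d' j)) = c'" if "i < n" for i
    proof -
      have "pderiv (tvar * L.d i + (\<Sum>j<n. [:L.Ab i j:] * L.d j)) = pderiv p"
        using L.M_mult_d[OF that] by (simp only: L.sum_M_mult[OF that])
      moreover have "pderiv (tvar * L.d i + (\<Sum>j<n. [:L.Ab i j:] * L.d j))
          = L.d i + (tvar * pderiv (L.d i) + (\<Sum>j<n. [:L.Ab i j:] * pderiv (L.d j)))"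
        by (simp add: pderiv_add pderiv_mult pderiv_sum pderiv_smult add_ac)
      ultimately have "ev (L.d i + (tvar * pderiv (L.d i) + (\<Sum>j<n. [:L.Ab i j:] * pderiv (L.d j)))) = c'"
        by (simp add: c'_def ev_def)
      then show ?thesis
        by (simp add: d_def d'_def ev_def eval_ac_const del: mult_pCons_left)
    qed
    have "c' = (\<Sum>i<n. c' * k i)" using sum_k by (simp flip: sum_distrib_left)
    also have "\<dots> = (\<Sum>i<n. (d i + (\<theta> * d' i + (\<Sum>j<n. to_ac (L.Ab i j) * d' j))) * k i)"
      by (intro sum.cong refl) (simp add: deriv)
    also have "\<dots> = (\<Sum>i<n. d i * k i) + ((\<Sum>i<n. \<theta> * d' i * k i) + (\<Sum>i<n. \<Sum>j<n. to_ac (L.Ab i j) * d' j * k i))"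
      by (simp add: distrib_right sum.distrib sum_distrib_right)
    also have "(\<Sum>i<n. \<Sum>j<n. to_ac (L.Ab i j) * d' j * k i) = (\<Sum>j<n. d' j * (\<Sum>i<n. to_ac (L.Ab j i) * k i))"
      by (subst sum.swap) (simp add: sum_distrib_left L.Ab_sym mult_ac)
    also have "(\<Sum>i<n. \<theta> * d' i * k i) + (\<Sum>j<n. d' j * (\<Sum>i<n. to_ac (L.Ab j i) * k i))
        = (\<Sum>j<n. d' j * (\<theta> * k j + (\<Sum>i<n. to_ac (L.Ab j i) * k i)))"
      by (simp add: distrib_left sum.distrib mult_ac)
    also have "\<dots> = (\<Sum>j<n. d' j) * \<theta>"
      by (simp add: k_eq sum_distrib_right)
    also have "(\<Sum>j<n. d' j) = ev (pderiv (\<Sum>i<n. L.d i))"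
      by (simp add: d'_def ev_def pderiv_sum)
    also have "\<dots> = 0" by (simp add: L.sum_d ev_def)
    finally show ?thesis by simp
  qed
  \<comment> \<open>Inserting the rank two form into \<open>Q\<close> gives the product of two row sums, one of which
      is zero at \<open>\<theta>\<close>, minus its diagonal terms.\<close>
  have evQ: "ev (L.Q i) = \<theta>\<^sup>2 * (d i * k i) + (\<Sum>j<n. to_ac (L.Ab i j) * (d j * k j))" if i: "i < n" for i
  proof -
    define x where "x j = ev (L.M i j)" for j
    have x2: "(x j)\<^sup>2 = (if i = j then \<theta>\<^sup>2 else 0) + to_ac (L.Ab i j)" if "j < n" for j
    proof -
      have "(x j)\<^sup>2 = ev ((L.M i j)\<^sup>2)" by (simp add: x_def ev_def power2_eq_square)
      then show ?thesis
        by (simp only: L.M_square[OF i that]) (simp add: ev_def eval_ac_const power2_eq_square)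
    qed
    have "(\<Sum>j<n. x j * d j) = ev (\<Sum>j<n. L.M i j * L.d j)"
      by (simp add: x_def d_def ev_def)
    then have xd: "(\<Sum>j<n. x j * d j) = 0" using p0 by (simp add: L.M_mult_d[OF i] ev_def)
    have "ev (L.Q i) = (\<Sum>j<n. \<Sum>l<j. x j * x l * P j l)"
      by (simp add: L.Q_def x_def P_def ev_def)
    also have "\<dots> = (\<Sum>j<n. \<Sum>l<j. (x j * d j) * (x l * k l) + (x l * d l) * (x j * k j))"
      by (intro sum.cong refl) (simp add: P_eq algebra_simps)
    also have "\<dots> = (\<Sum>j<n. (x j * d j) * (x j * k j))"
      using sum_mult_sum_pairs[of "\<lambda>j. x j * d j" n "\<lambda>j. x j * k j"] xd
      by (simp add: alg_closure_bit_add_eq_0_iff)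
    also have "\<dots> = (\<Sum>j<n. (x j)\<^sup>2 * (d j * k j))"
      by (simp add: power2_eq_square mult_ac)
    also have "\<dots> = (\<Sum>j<n. (if j = i then \<theta>\<^sup>2 * (d j * k j) else 0) + to_ac (L.Ab i j) * (d j * k j))"
      by (intro sum.cong refl) (auto simp: x2 distrib_right)
    finally show ?thesis using i by (simp add: sum.distrib)
  qed
  have n0: "0 < n" using n_ge_4 by simp
  \<comment> \<open>The vector \<open>h\<^sub>N\<close> in \<open>Q_diff\<close> is the vector of degrees up to a constant, by
      \<open>Ab_mult_h\<close> at the top index.\<close>
  define C where "C = ev (L.Q 0) + to_ac (h N 0) + to_ac (coeff p (Suc N))"
  have prod: "\<theta>\<^sup>2 * (d i * k i) + (\<Sum>j<n. to_ac (L.Ab i j) * (d j * k j)) = (\<Sum>j<n. to_ac (L.Ab i j)) + C"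
    if i: "i < n" for i
  proof -
    have "ev (L.Q i) + ev (L.Q 0) = ev ((p + 1) * [:h N i + h N 0:])"
      using arg_cong[OF Q_diff[OF i n0], of ev] by (simp add: ev_def)
    also have "\<dots> = to_ac (h N i) + to_ac (h N 0)"
      using p0 by (simp only: ev_def eval_ac_mult eval_ac_add eval_ac_const eval_ac_1) simp
    finally have Qi: "ev (L.Q i) = to_ac (h N i) + to_ac (h N 0) + ev (L.Q 0)"
      by (rule iffD1[OF alg_closure_bit_add_eq_iff])
    have "(\<Sum>j<n. L.Ab i j) = coeff p (Suc N) + h N i"
      using L.Ab_mult_h[OF i, of "Suc N"] L.h_top[of _ "Suc N"] m_eq by simp
    then have "(\<Sum>j<n. to_ac (L.Ab i j)) = to_ac (coeff p (Suc N)) + to_ac (h N i)"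
      by (metis to_ac_add to_ac_sum)
    then have "(\<Sum>j<n. to_ac (L.Ab i j)) + C
        = to_ac (h N i) + to_ac (h N 0) + ev (L.Q 0) + (to_ac (coeff p (Suc N)) + to_ac (coeff p (Suc N)))"
      by (simp only: C_def add_ac)
    then show ?thesis using evQ[OF i] Qi by simp
  qed
  have "\<theta> = 1"
    by (rule rank_two_contradiction[OF L.Ab_sym d_eq k_eq sum_d sum_k dk c' L.even_n prod])
  then show False using \<theta>1 by simp
qed

lemma (in even_pair) swapped: "even_pair n B G b A F a"
  using same_diag by unfold_locales simp_all

text \<open>The constant \<open>k\<close> of \<open>p_shape\<close> is 1 for exactly one of \<open>p\<close> and \<open>p + 1\<close>, which decides
  whether the systems have to be exchanged before \<open>parity_clash\<close> applies.\<close>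

theorem (in even_pair) const_coeff_cong_4:
  assumes "4 \<le> n"
  shows "4 dvd c"
proof (cases "even c")
  case True
  then show ?thesis by (rule const_cong_4)
next
  case False
  obtain k where k: "L.p = tvar * pderiv L.p + [:k:]" using p_shape(2)[OF False] ..
  show ?thesis
  proof (cases "k = 0")
    case nz: False
    have "L.p = tvar * pderiv L.p + 1" using k nz by (simp add: one_pCons)
    then have "parity_clash n A F a B G b"
      using False assms by unfold_locales simp_all
    then show ?thesis using parity_clash.contradiction by blast
  next
    case True
    interpret swap: even_pair n B G b A F a by (rule swapped)
    have "swap.c = - c" by (simp add: swap.c_def c_def)
    then have odd: "odd swap.c" using False by simp
    have "R.p = tvar * pderiv R.p + 1"
      using k True p_shape(1)[OF False] by (simp add: pderiv_add)
    then have "parity_clash n B G b A F a"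
      using odd assms by unfold_locales simp_all
    then show ?thesis using parity_clash.contradiction by blast
  qed
qed

section \<open>Odd order\<close>

text \<open>The \<open>y\<^sub>l\<close> lie in the kernel of the bilinear form \<open>D\<close>, on which the associated quadratic
  form \<open>q\<close> has no cross terms.\<close>

lemma quadratic_additive:
  fixes D y :: "nat \<Rightarrow> nat \<Rightarrow> bit poly"
  assumes D_sym: "\<And>i j. i < n \<Longrightarrow> j < n \<Longrightarrow> D i j = D j i"
    and D_diag: "\<And>i. i < n \<Longrightarrow> D i i = 0"
    and kernel: "\<And>i l. i < n \<Longrightarrow> l < m \<Longrightarrow> (\<Sum>j<n. D i j * y l j) = 0"
  defines "q \<equiv> \<lambda>x. \<Sum>i<n. \<Sum>j<i. x i * x j * D i j"
  shows "q (\<lambda>i. \<Sum>l<m. z l * y l i) = (\<Sum>l<m. (z l)\<^sup>2 * q (y l))"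
proof -
  have q_add: "q (\<lambda>i. u i + v i) = q u + q v"
    if "\<And>i. i < n \<Longrightarrow> (\<Sum>j<n. D i j * v j) = 0" for u v
  proof -
    have "0 = (\<Sum>i<n. u i * (\<Sum>j<n. D i j * v j))" by (simp add: that)
    also have "\<dots> = (\<Sum>i<n. \<Sum>j<i. u i * (D i j * v j) + u j * (D j i * v i))"
      unfolding sum_distrib_left sum_square_split by (simp add: D_diag)
    also have "\<dots> = (\<Sum>i<n. \<Sum>j<i. (u i * v j + u j * v i) * D i j)"
      by (intro sum.cong refl) (simp add: D_sym algebra_simps)
    finally have cross: "(\<Sum>i<n. \<Sum>j<i. (u i * v j + u j * v i) * D i j) = 0" ..
    have "q (\<lambda>i. u i + v i) = q u + q v + (\<Sum>i<n. \<Sum>j<i. (u i * v j + u j * v i) * D i j)"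
      unfolding q_def sum.distrib[symmetric] by (intro sum.cong refl) (simp add: algebra_simps)
    then show ?thesis by (simp add: cross)
  qed
  have q_scale: "q (\<lambda>i. s * u i) = s\<^sup>2 * q u" for s u
    unfolding q_def sum_distrib_left by (intro sum.cong refl) (simp add: power2_eq_square mult_ac)
  have "k \<le> m \<Longrightarrow> q (\<lambda>i. \<Sum>l<k. z l * y l i) = (\<Sum>l<k. (z l)\<^sup>2 * q (y l))" for k
  proof (induction k)
    case 0
    show ?case by (simp add: q_def)
  next
    case (Suc k)
    have "(\<Sum>j<n. D i j * (z k * y k j)) = 0" if "i < n" for i
      using kernel[OF that, of k] Suc.prems by (simp add: mult.left_commute flip: sum_distrib_left)
    then have "q (\<lambda>i. (\<Sum>l<k. z l * y l i) + z k * y k i) = q (\<lambda>i. \<Sum>l<k. z l * y l i) + q (\<lambda>i. z k * y k i)"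
      by (rule q_add)
    then show ?case using Suc by (simp add: q_scale)
  qed
  then show ?thesis by simp
qed

text \<open>By the shifting of \<open>h\<close>, the vector \<open>w\<^sub>j\<close> is \<open>h\<^sub>N\<^sub>-\<^sub>j\<close> plus a combination of the \<open>h\<^sub>l\<close>
  with larger index: the change between the two families is triangular.\<close>

lemma walks_independent:
  fixes A :: "nat \<Rightarrow> nat \<Rightarrow> bit"
  assumes step: "\<And>i k. i < n \<Longrightarrow> k \<le> N \<Longrightarrow>
        (\<Sum>j<n. A i j * h k j) = q k + (case k of 0 \<Rightarrow> 0 | Suc l \<Rightarrow> h l i)"
    and top: "\<And>i. i < n \<Longrightarrow> h N i = 1"
    and indep: "\<And>x. (\<And>i. i < n \<Longrightarrow> (\<Sum>j<Suc N. x j * h j i) = 0) \<Longrightarrow> (\<forall>j<Suc N. x j = 0)"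
    and w0: "\<And>i. i < n \<Longrightarrow> w 0 i = 1"
    and w_Suc: "\<And>i k. i < n \<Longrightarrow> w (Suc k) i = (\<Sum>j<n. A i j * w k j)"
    and relation: "\<And>i. i < n \<Longrightarrow> (\<Sum>j<Suc N. x j * w j i) = 0"
  shows "\<forall>j<Suc N. x j = 0"
proof -
  have "\<exists>u. \<forall>i<n. w j i = (\<Sum>l<Suc j. u l * h (N - l) i) \<and> u j = 1" if "j \<le> N" for j
    using that
  proof (induction j)
    case 0
    show ?case by (rule exI[of _ "\<lambda>_. 1"]) (simp add: w0 top)
  next
    case (Suc j)
    then obtain u where u: "\<And>i. i < n \<Longrightarrow> w j i = (\<Sum>l<Suc j. u l * h (N - l) i)" "\<And>i. i < n \<Longrightarrow> u j = 1"
      by auto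
    define v where "v l = (case l of 0 \<Rightarrow> (\<Sum>l<Suc j. u l * q (N - l)) | Suc l \<Rightarrow> u l)" for l
    have "w (Suc j) i = (\<Sum>l<Suc (Suc j). v l * h (N - l) i)" if i: "i < n" for i
    proof -
      have "w (Suc j) i = (\<Sum>i'<n. A i i' * (\<Sum>l<Suc j. u l * h (N - l) i'))"
        using w_Suc[OF i] u(1) by simp
      also have "\<dots> = (\<Sum>l<Suc j. u l * (\<Sum>i'<n. A i i' * h (N - l) i'))"
        by (simp only: sum_distrib_left mult.left_commute) (rule sum.swap)
      also have "\<dots> = (\<Sum>l<Suc j. u l * q (N - l) + u l * h (N - Suc l) i)"
      proof (intro sum.cong refl)
        fix l assume "l \<in> {..<Suc j}"
        then have "N - l = Suc (N - Suc l)" using Suc.prems by auto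
        then show "u l * (\<Sum>i'<n. A i i' * h (N - l) i') = u l * q (N - l) + u l * h (N - Suc l) i"
          using step[OF i, of "N - l"] by (simp add: distrib_left)
      qed
      also have "\<dots> = (\<Sum>l<Suc j. u l * q (N - l)) + (\<Sum>l<Suc j. u l * h (N - Suc l) i)"
        by (rule sum.distrib)
      also have "\<dots> = (\<Sum>l<Suc (Suc j). v l * h (N - l) i)"
        by (subst (3) sum.lessThan_Suc_shift) (simp add: v_def top[OF i])
      finally show ?thesis .
    qed
    moreover have "v (Suc j) = 1" if "i < n" for i using u(2)[OF that] by (simp add: v_def)
    ultimately show ?case by blast
  qed
  then have "\<forall>j. \<exists>u. j \<le> N \<longrightarrow> (\<forall>i<n. w j i = (\<Sum>l<Suc j. u l * h (N - l) i) \<and> u j = 1)" by blast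
  then obtain u where u: "\<And>j i. j \<le> N \<Longrightarrow> i < n \<Longrightarrow> w j i = (\<Sum>l<Suc j. u j l * h (N - l) i)"
      and u1: "\<And>j i. j \<le> N \<Longrightarrow> i < n \<Longrightarrow> u j j = 1"
    by metis
  show ?thesis
  proof (cases "n = 0")
    case True
    then show ?thesis using indep[of x] by simp
  next
    case False
    \<comment> \<open>The given relation, rewritten in terms of the vectors \<open>h\<close>.\<close>
    define s where "s l = (\<Sum>j\<in>{l..N}. x j * u j l)" for l
    have "(\<Sum>l<Suc N. s (N - l) * h l i) = 0" if i: "i < n" for i
    proof -
      have "0 = (\<Sum>j<Suc N. x j * w j i)" using relation[OF i] by simp
      also have "\<dots> = (\<Sum>j<Suc N. \<Sum>l<Suc j. x j * (u j l * h (N - l) i))"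
        by (intro sum.cong refl) (simp only: u[OF _ i] sum_distrib_left lessThan_iff less_Suc_eq_le)
      also have "\<dots> = (\<Sum>j<Suc N. \<Sum>l<Suc N. if l \<le> j then x j * (u j l * h (N - l) i) else 0)"
        by (intro sum.cong refl sum.mono_neutral_cong_left) auto
      also have "\<dots> = (\<Sum>l<Suc N. \<Sum>j<Suc N. if l \<le> j then x j * (u j l * h (N - l) i) else 0)"
        by (rule sum.swap)
      also have "\<dots> = (\<Sum>l<Suc N. s l * h (N - l) i)"
        unfolding s_def sum_distrib_right
        by (intro sum.cong refl sum.mono_neutral_cong_right) (auto simp: mult.assoc)
      also have "\<dots> = (\<Sum>l<Suc N. s (N - l) * h l i)"
        by (rule sum.reindex_bij_witness[of _ "\<lambda>l. N - l" "\<lambda>l. N - l"]) auto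
      finally show ?thesis by simp
    qed
    then have "\<forall>l<Suc N. s (N - l) = 0" by (rule indep)
    then have s0: "s l = 0" if "l \<le> N" for l
      using that by (metis diff_diff_cancel diff_le_self le_imp_less_Suc)
    have "x (N - l) = 0" if "l \<le> N" for l
      using that
    proof (induction l rule: less_induct)
      case (less l)
      have "{N - l..N} = insert (N - l) {Suc (N - l)..N}" using less.prems by auto
      moreover have "x j = 0" if "j \<in> {Suc (N - l)..N}" for j
        using less.IH[of "N - j"] that less.prems by auto
      ultimately have "s (N - l) = x (N - l) * u (N - l) (N - l)"
        by (simp add: s_def)
      then show ?case using s0[of "N - l"] u1[of "N - l" 0] False by simp
    qed
    then show ?thesis by (metis diff_diff_cancel diff_le_self less_Suc_eq_le)
  qed
qed

locale odd_pair = system_pair n A F a B G b + L: odd_system n A F a + R: odd_system n B G b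
  for n A F a B G b
begin

lemma same_e: "R.e = L.e"
proof -
  have "R.e\<^sup>2 = L.e\<^sup>2"
    using L.pderiv_f R.pderiv_f arg_cong[OF same_pderiv, of mod2] by (simp add: L.f_def R.f_def)
  then show ?thesis by (simp only: char2_square_eq_iff)
qed

lemma same_k: "i < n \<Longrightarrow> R.k i = L.k i"
  by (simp add: L.k_def R.k_def L.b_def R.b_def same_diag)

lemma even_c: "even c"
proof -
  have "[:of_int c :: bit:] = L.f + R.f"
    using arg_cong[OF F_minus_G, of mod2] by (simp add: L.f_def R.f_def)
  also have "\<dots> = 0" by (simp add: L.f_eq R.f_eq same_e)
  finally show ?thesis by (simp add: of_int_bit_eq_0_iff)
qed

end

text \<open>With \<open>x\<close> the vector of row sums this is an equality, because \<open>tI - A\<close> maps the row sums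
  to \<open>F 1\<close>. Changing \<open>x\<close> by \<open>2 s\<close> changes the symmetric form by a multiple of 4.\<close>

lemma (in adjugate_system) F_mult_\<Omega>:
  assumes "\<And>i. i < n \<Longrightarrow> mod2 (\<Sum>j<n. a i j) = mod2 (x i)"
  shows "4 dvd F * \<Omega> - (\<Sum>i<n. \<Sum>j<n. x i * (char_entry A i j * x j))"
proof -
  define R where "R i = (\<Sum>j<n. a i j)" for i
  have "\<exists>s. \<forall>i<n. R i = x i + 2 * s i"
  proof -
    have "\<exists>s. R i = x i + 2 * s" if "i < n" for i
    proof -
      have "mod2 (R i - x i) = 0" using assms[OF that] by (simp add: R_def bit_poly_add_eq_0_iff del: mod2_sum)
      then obtain s where "R i - x i = 2 * s" by (rule mod2_eq_0E)
      then show ?thesis by (metis diff_add_cancel add.commute)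
    qed
    then show ?thesis by metis
  qed
  then obtain s where s: "\<And>i. i < n \<Longrightarrow> R i = x i + 2 * s i" by blast
  have "F * \<Omega> = (\<Sum>i<n. R i * F)" by (simp add: \<Omega>_def R_def sum_distrib_left mult.commute)
  also have "\<dots> = (\<Sum>i<n. \<Sum>j<n. R i * (char_entry A i j * R j))"
    by (intro sum.cong refl) (simp add: char_mult_row_sums R_def flip: sum_distrib_left)
  also have "\<dots> = (\<Sum>i<n. \<Sum>j<n. x i * (char_entry A i j * x j)
      + 2 * (x i * (char_entry A i j * s j) + s i * (char_entry A i j * x j))
      + 4 * (s i * (char_entry A i j * s j)))"
    by (intro sum.cong refl) (simp add: s algebra_simps)
  also have "\<dots> = (\<Sum>i<n. \<Sum>j<n. x i * (char_entry A i j * x j))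
      + 2 * ((\<Sum>i<n. \<Sum>j<n. x i * (char_entry A i j * s j)) + (\<Sum>i<n. \<Sum>j<n. s i * (char_entry A i j * x j)))
      + 4 * (\<Sum>i<n. \<Sum>j<n. s i * (char_entry A i j * s j))"
    by (simp add: sum.distrib sum_distrib_left algebra_simps)
  also have "(\<Sum>i<n. \<Sum>j<n. x i * (char_entry A i j * s j)) = (\<Sum>i<n. \<Sum>j<n. s i * (char_entry A i j * x j))"
    by (subst sum.swap) (intro sum.cong refl, simp add: char_entry_def A_sym mult_ac)
  finally have "F * \<Omega> - (\<Sum>i<n. \<Sum>j<n. x i * (char_entry A i j * x j))
      = 4 * ((\<Sum>i<n. \<Sum>j<n. s i * (char_entry A i j * x j)) + (\<Sum>i<n. \<Sum>j<n. s i * (char_entry A i j * s j)))"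
    by (simp add: algebra_simps)
  then show ?thesis by simp
qed

lemma coeff_tvar_power_mult_const:
  "coeff (tvar ^ l * [:c :: 'a::idom:]) j = (if j = l then c else 0)"
proof -
  have "coeff (tvar ^ l :: 'a poly) j = (if j = l then 1 else 0)"
    by (induction l arbitrary: j) (auto simp: coeff_tvar_mult split: nat.split)
  then show ?thesis by simp
qed

context odd_system
begin

definition h :: "nat \<Rightarrow> nat \<Rightarrow> bit" where "h l i = coeff (k i) l"

lemma h_eq: "i < n \<Longrightarrow> h l i = of_int (coeff (a i i) (2 * l))"
  using arg_cong[OF diag_root(1)[of i], of "\<lambda>q. coeff q (2 * l)"]
  by (simp add: h_def coeff_bit_square b_def)

lemma h_high: "i < n \<Longrightarrow> n div 2 < l \<Longrightarrow> h l i = 0"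
  by (simp add: h_eq coeff_adj_high)

lemma h_top:
  assumes "i < n"
  shows "h (n div 2) i = 1"
proof -
  have "Suc (2 * (n div 2)) = n" using odd_n by (auto elim!: oddE)
  then show ?thesis using assms by (simp only: h_eq coeff_adj_top) simp
qed

lemma k_expansion:
  assumes "i < n"
  shows "k i = (\<Sum>l<Suc (n div 2). tvar ^ l * [:h l i:])"
proof (rule poly_eqI)
  fix j
  have "coeff (\<Sum>l<Suc (n div 2). tvar ^ l * [:h l i:]) j = (if j < Suc (n div 2) then h j i else 0)"
    unfolding coeff_sum by (simp only: coeff_tvar_power_mult_const) (simp add: sum.delta' del: sum.lessThan_Suc)
  then show "coeff (k i) j = coeff (\<Sum>l<Suc (n div 2). tvar ^ l * [:h l i:]) j"
    using h_high[OF assms, of j] by (auto simp: h_def)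
qed

lemma Ab_mult_h:
  assumes "i < n"
  shows "(\<Sum>j<n. Ab i j * h l j) = coeff (tvar * e) l + (case l of 0 \<Rightarrow> 0 | Suc l' \<Rightarrow> h l' i)"
  unfolding h_def by (rule Ab_mult_coeff[OF M_mult_k[OF assms] assms])

lemma mod2_\<Omega>: "mod2 \<Omega> = e\<^sup>2"
proof -
  have "mod2 \<Omega> = pderiv f" by (simp add: \<Omega>_eq f_def)
  then show ?thesis by (simp add: pderiv_f)
qed

lemma row_sum_adj: "i < n \<Longrightarrow> mod2 (\<Sum>j<n. a i j) = e * k i"
  using diag_root(2)[of i] by (simp add: r_def b_def)

end

context odd_pair
begin

definition D :: "nat \<Rightarrow> nat \<Rightarrow> bit" where "D i j = L.Ab i j + R.Ab i j"

text \<open>Half the quadratic form of the difference of the two adjacency matrices.\<close>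

definition q :: "(nat \<Rightarrow> bit poly) \<Rightarrow> bit poly" where
  "q x = (\<Sum>i<n. \<Sum>j<i. x i * x j * [:D i j:])"

text \<open>Subtract the instances of \<open>F_mult_\<Omega>\<close> for the two systems, with the same lift \<open>x\<close> of the
  row sums \<open>e k\<close>. Modulo 4 the left side becomes \<open>c \<Omega>\<close>, where \<open>\<Omega>\<close> is \<open>e\<^sup>2\<close> modulo 2; the right
  side is twice \<open>q x\<close> up to sign.\<close>

lemma q_k:
  assumes "\<not> 4 dvd c"
  shows "q L.k = 1"
proof -
  obtain c' where c': "c = 2 * c'" using even_c by (rule evenE)
  have "odd c'" using assms c' by auto
  then have c'1: "(of_int c' :: bit) = 1" using of_int_bit_eq_0_iff[of c'] by auto
  define x where "x i = lift2 (L.e * L.k i)" for i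
  have x: "mod2 (x i) = L.e * L.k i" for i by (simp add: x_def)
  have "4 dvd F * L.\<Omega> - (\<Sum>i<n. \<Sum>j<n. x i * (char_entry A i j * x j))"
    by (rule L.F_mult_\<Omega>) (simp only: L.row_sum_adj x)
  moreover have "4 dvd G * R.\<Omega> - (\<Sum>i<n. \<Sum>j<n. x i * (char_entry B i j * x j))"
    by (rule R.F_mult_\<Omega>) (simp only: R.row_sum_adj x same_e same_k)
  moreover have "4 dvd G * (L.\<Omega> - R.\<Omega>)" using \<Omega>_cong(2)[OF even_c] by (rule dvd_mult)
  ultimately have "4 dvd (F * L.\<Omega> - (\<Sum>i<n. \<Sum>j<n. x i * (char_entry A i j * x j)))
      - (G * R.\<Omega> - (\<Sum>i<n. \<Sum>j<n. x i * (char_entry B i j * x j))) - G * (L.\<Omega> - R.\<Omega>)"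
    by (rule dvd_diff[OF dvd_diff])
  also have "\<dots> = (F - G) * L.\<Omega> - (\<Sum>i<n. \<Sum>j<n. x i * x j * (char_entry A i j - char_entry B i j))"
    by (simp add: sum_subtractf algebra_simps)
  also have "(\<Sum>i<n. \<Sum>j<n. x i * x j * (char_entry A i j - char_entry B i j))
      = - (\<Sum>i<n. \<Sum>j<n. x i * x j * [:A i j - B i j:])"
  proof -
    have "char_entry A i j - char_entry B i j = - [:A i j - B i j:]" for i j
      by (simp add: char_entry_def)
    then show ?thesis by (simp only: mult_minus_right sum_negf)
  qed
  also have "(\<Sum>i<n. \<Sum>j<n. x i * x j * [:A i j - B i j:]) = 2 * (\<Sum>i<n. \<Sum>j<i. x i * x j * [:A i j - B i j:])"
    by (subst sum_symmetric) (simp_all add: L.A_sym R.A_sym L.A_diag R.A_diag mult_ac)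
  also have "F - G = 2 * [:c':]" by (simp add: F_minus_G c' numeral_poly)
  finally have "4 dvd 2 * ([:c':] * L.\<Omega> + (\<Sum>i<n. \<Sum>j<i. x i * x j * [:A i j - B i j:]))"
    by (simp only: algebra_simps) simp
  then have "mod2 ([:c':] * L.\<Omega> + (\<Sum>i<n. \<Sum>j<i. x i * x j * [:A i j - B i j:])) = 0"
    by (simp only: four_dvd_double_iff)
  then have "L.e\<^sup>2 + (\<Sum>i<n. \<Sum>j<i. mod2 (x i) * mod2 (x j) * [:D i j:]) = 0"
    using c'1 by (simp add: L.mod2_\<Omega> D_def L.Ab_def R.Ab_def)
  then have "(\<Sum>i<n. \<Sum>j<i. mod2 (x i) * mod2 (x j) * [:D i j:]) = L.e\<^sup>2"
    by (rule sym[OF iffD1[OF bit_poly_add_eq_0_iff]])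
  moreover have "(\<Sum>i<n. \<Sum>j<i. mod2 (x i) * mod2 (x j) * [:D i j:]) = L.e\<^sup>2 * q L.k"
    unfolding q_def sum_distrib_left
    by (intro sum.cong refl) (simp add: x power2_eq_square mult_ac)
  ultimately show ?thesis using L.e_neq_0 by simp
qed

text \<open>The shifting formula \<open>Ab_mult_h\<close> is the same for both graphs, as \<open>e\<close> and \<open>k\<close> are.\<close>

lemma D_mult_h: "i < n \<Longrightarrow> (\<Sum>j<n. D i j * L.h l j) = 0"
proof -
  assume i: "i < n"
  have "R.h l j = L.h l j" if "j < n" for l j using that by (simp add: L.h_def R.h_def same_k)
  then have "(\<Sum>j<n. R.Ab i j * L.h l j) = (\<Sum>j<n. L.Ab i j * L.h l j)"
    using R.Ab_mult_h[OF i, of l] L.Ab_mult_h[OF i, of l] i by (simp add: same_e cong: nat.case_cong)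
  then show ?thesis by (simp add: D_def distrib_right sum.distrib bit_add_self_eq_0)
qed

lemma q_combination:
  "q (\<lambda>i. \<Sum>l<Suc N. z l * [:L.h l i:]) = (\<Sum>l<Suc N. (z l)\<^sup>2 * q (\<lambda>i. [:L.h l i:]))"
  unfolding q_def
proof (rule quadratic_additive)
  show "(\<Sum>j<n. [:D i j:] * [:L.h l j:]) = 0" if "i < n" for i l
    using D_mult_h[OF that, of l] by (simp add: sum_const_poly mult.commute)
  show "[:D i j:] = [:D j i:]" if "i < n" "j < n" for i j
    using L.Ab_sym[OF that] R.Ab_sym[OF that] by (simp add: D_def)
qed (simp add: D_def L.Ab_def R.Ab_def L.A_diag R.A_diag)

lemma q_cong: "(\<And>i. i < n \<Longrightarrow> x i = y i) \<Longrightarrow> q x = q y"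
  unfolding q_def by (intro sum.cong refl) simp

lemma q_const: "q (\<lambda>i. [:u i:]) = [:\<Sum>i<n. \<Sum>j<i. u i * u j * D i j:]"
  by (simp add: q_def sum_const_poly mult_ac)

text \<open>By additivity \<open>q_k\<close> reads: the sum of the \<open>t\<^sup>2\<^sup>l q h\<^sub>l\<close> is 1, and the values \<open>q h\<^sub>l\<close> are
  constants.\<close>

lemma q_h:
  assumes "\<not> 4 dvd c" and "l < Suc (n div 2)"
  shows "q (\<lambda>i. [:L.h l i:]) = (if l = 0 then 1 else 0)"
proof -
  define u where "u l = (\<Sum>i<n. \<Sum>j<i. L.h l i * L.h l j * D i j)" for l
  have "1 = q (\<lambda>i. \<Sum>l<Suc (n div 2). tvar ^ l * [:L.h l i:])"
    unfolding q_k[OF assms(1), symmetric] by (rule q_cong) (rule L.k_expansion)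
  also have "\<dots> = (\<Sum>l<Suc (n div 2). (tvar ^ l)\<^sup>2 * [:u l:])"
    unfolding q_combination q_const u_def ..
  also have "\<dots> = (\<Sum>l<Suc (n div 2). tvar ^ l * [:u l:])\<^sup>2"
    unfolding char2_sum_square by (simp only: power_mult_distrib bit_poly_square_const)
  finally have "(\<Sum>l<Suc (n div 2). tvar ^ l * [:u l:])\<^sup>2 = 1\<^sup>2" by simp
  then have *: "(\<Sum>l<Suc (n div 2). tvar ^ l * [:u l:]) = 1" by (simp only: char2_square_eq_iff)
  have "coeff (\<Sum>l<Suc (n div 2). tvar ^ l * [:u l:]) l = u l"
    unfolding coeff_sum by (simp only: coeff_tvar_power_mult_const) (simp add: sum.delta' assms(2) del: sum.lessThan_Suc)
  then have "u l = coeff 1 l" by (simp only: *)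
  then show ?thesis unfolding q_const u_def[symmetric] by (simp add: one_pCons coeff_pCons split: nat.split)
qed

text \<open>The quadratic form maps a combination of the \<open>h\<^sub>l\<close> to the square of its coefficient at
  \<open>h\<^sub>0\<close>, so that no relation involves \<open>h\<^sub>0\<close>.\<close>

theorem walk_vectors_independent:
  assumes "\<not> 4 dvd c"
    and "\<And>i. i < n \<Longrightarrow> w 0 i = 1"
    and "\<And>i k. i < n \<Longrightarrow> w (Suc k) i = (\<Sum>j<n. L.Ab i j * w k j)"
    and "\<And>i. i < n \<Longrightarrow> (\<Sum>j<Suc (n div 2). x j * w j i) = 0"
  shows "\<forall>j<Suc (n div 2). x j = 0"
proof -
  have base: "x 0 = 0" if x: "\<And>i. i < n \<Longrightarrow> (\<Sum>j<Suc (n div 2). x j * L.h j i) = 0" for x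
  proof -
    have "0 = q (\<lambda>i. \<Sum>l<Suc (n div 2). [:x l:] * [:L.h l i:])"
    proof -
      have "q (\<lambda>i. \<Sum>l<Suc (n div 2). [:x l:] * [:L.h l i:]) = q (\<lambda>i. 0)"
        by (rule q_cong) (use x in \<open>simp add: sum_const_poly mult.commute del: sum.lessThan_Suc\<close>)
      then show ?thesis by (simp add: q_def)
    qed
    also have "\<dots> = (\<Sum>l<Suc (n div 2). ([:x l:])\<^sup>2 * q (\<lambda>i. [:L.h l i:]))"
      by (rule q_combination)
    also have "\<dots> = (\<Sum>l<Suc (n div 2). if l = 0 then [:x l:] else 0)"
      by (intro sum.cong refl) (simp add: q_h assms(1))
    also have "\<dots> = [:x 0:]" by (simp add: sum.delta del: sum.lessThan_Suc)
    finally show ?thesis by simp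
  qed
  have indep: "\<forall>j<Suc (n div 2). y j = 0"
    if y: "\<And>i. i < n \<Longrightarrow> (\<Sum>j<Suc (n div 2). y j * L.h j i) = 0" for y
  proof (rule krylov_independent)
    show "(\<Sum>j<n. L.Ab i j * L.h k j) = coeff (tvar * L.e) k + (case k of 0 \<Rightarrow> 0 | Suc l \<Rightarrow> L.h l i)"
      if "i < n" for i k using that by (rule L.Ab_mult_h)
    show "L.h (n div 2) i = 1" if "i < n" for i using that by (rule L.h_top)
    show "z 0 = 0" if "\<And>i. i < n \<Longrightarrow> (\<Sum>j<Suc (n div 2). z j * L.h j i) = 0" for z
      using that by (rule base)
  qed (rule y)
  show ?thesis
  proof (rule walks_independent)
    show "(\<Sum>j<n. L.Ab i j * L.h k j) = coeff (tvar * L.e) k + (case k of 0 \<Rightarrow> 0 | Suc l \<Rightarrow> L.h l i)"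
      if "i < n" for i k using that by (rule L.Ab_mult_h)
    show "L.h (n div 2) i = 1" if "i < n" for i using that by (rule L.h_top)
    show "\<forall>j<Suc (n div 2). y j = 0"
      if "\<And>i. i < n \<Longrightarrow> (\<Sum>j<Suc (n div 2). y j * L.h j i) = 0" for y
      using that by (rule indep)
  qed (rule assms, assumption)+
qed

end

section \<open>Determinants\<close>

abbreviation sqmat :: "nat \<Rightarrow> (nat \<Rightarrow> nat \<Rightarrow> 'a) \<Rightarrow> 'a mat" where
  "sqmat n N \<equiv> mat n n (\<lambda>(i, j). N i j)"

lemma mat_mult_cofactor:
  fixes N :: "nat \<Rightarrow> nat \<Rightarrow> 'a::comm_ring_1"
  assumes "i < n" "j < n"
  shows "(\<Sum>k<n. N i k * cofactor (sqmat n N) j k) = (if i = j then det (sqmat n N) else 0)"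
proof -
  have "(sqmat n N * adj_mat (sqmat n N)) $$ (i, j) = (det (sqmat n N) \<cdot>\<^sub>m 1\<^sub>m n) $$ (i, j)"
    using adj_mat(2)[of "sqmat n N" n] by simp
  then show ?thesis using assms by (simp add: adj_mat_def scalar_prod_def atLeast0LessThan)
qed

lemma cofactor_mult_mat:
  fixes N :: "nat \<Rightarrow> nat \<Rightarrow> 'a::comm_ring_1"
  assumes "i < n" "j < n"
  shows "(\<Sum>k<n. cofactor (sqmat n N) k i * N k j) = (if i = j then det (sqmat n N) else 0)"
proof -
  have "(adj_mat (sqmat n N) * sqmat n N) $$ (i, j) = (det (sqmat n N) \<cdot>\<^sub>m 1\<^sub>m n) $$ (i, j)"
    using adj_mat(3)[of "sqmat n N" n] by simp
  then show ?thesis using assms by (simp add: adj_mat_def scalar_prod_def atLeast0LessThan)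
qed

lemma cofactor_cong_row:
  assumes "k < n" and "\<And>i j. i < n \<Longrightarrow> j < n \<Longrightarrow> i \<noteq> k \<Longrightarrow> N i j = N' i j"
  shows "cofactor (sqmat n N) k l = cofactor (sqmat n N') k l"
proof -
  have "mat_delete (sqmat n N) k l = mat_delete (sqmat n N') k l"
    using assms by (intro eq_matI) (auto simp: mat_delete_def)
  then show ?thesis by (simp add: cofactor_def)
qed

lemma det_replace_row:
  fixes N :: "nat \<Rightarrow> nat \<Rightarrow> 'a::comm_ring_1"
  assumes "k < n"
  shows "det (sqmat n (\<lambda>i j. if i = k then f j else N i j)) = (\<Sum>j<n. f j * cofactor (sqmat n N) k j)"
proof -
  have "det (sqmat n (\<lambda>i j. if i = k then f j else N i j))
      = (\<Sum>j<n. sqmat n (\<lambda>i j. if i = k then f j else N i j) $$ (k, j)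
          * cofactor (sqmat n (\<lambda>i j. if i = k then f j else N i j)) k j)"
    using assms by (intro laplace_expansion_row) auto
  also have "\<dots> = (\<Sum>j<n. f j * cofactor (sqmat n N) k j)"
  proof (intro sum.cong refl arg_cong2[of _ _ _ _ "(*)"])
    show "cofactor (sqmat n (\<lambda>i j. if i = k then f j else N i j)) k j = cofactor (sqmat n N) k j" for j
      using assms by (rule cofactor_cong_row) simp
  qed (use assms in simp)
  finally show ?thesis .
qed

lemma det_expand_row:
  fixes N :: "nat \<Rightarrow> nat \<Rightarrow> 'a::comm_ring_1"
  assumes "k < n"
  shows "det (sqmat n N) = (\<Sum>j<n. N k j * cofactor (sqmat n N) k j)"
  using mat_mult_cofactor[of k n k N] assms by simp

lemma det_add_to_row:
  fixes N :: "nat \<Rightarrow> nat \<Rightarrow> 'a::comm_ring_1"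
  assumes "k < n"
  shows "det (sqmat n (\<lambda>i j. N i j + (if i = k then f j else 0)))
    = det (sqmat n N) + (\<Sum>j<n. f j * cofactor (sqmat n N) k j)"
proof -
  have "(\<lambda>i j. N i j + (if i = k then f j else 0)) = (\<lambda>i j. if i = k then N k j + f j else N i j)"
    by (intro ext) simp
  then show ?thesis
    by (simp only: det_replace_row[OF assms] distrib_right sum.distrib det_expand_row[OF assms, of N])
qed

text \<open>Jacobi's identity. Let \<open>N'\<close> be \<open>N\<close> with 1 added to the entry \<open>(i, i)\<close>, and \<open>a'\<close> its
  adjugate, which agrees with \<open>a\<close> in row and column \<open>i\<close>. The claim compares two evaluations of
  \<open>a' N' a\<close>. If \<open>j = l \<noteq> i\<close>, the difference on the right is the minor of \<open>N\<close> without the rows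
  and columns \<open>i\<close> and \<open>j\<close>.\<close>

lemma cofactor_minors:
  fixes N :: "nat \<Rightarrow> nat \<Rightarrow> 'a::comm_ring_1"
  assumes "i < n" "j < n" "l < n"
  defines "a \<equiv> \<lambda>r s. cofactor (sqmat n N) s r"
    and "a' \<equiv> \<lambda>r s. cofactor (sqmat n (\<lambda>r s. N r s + (if r = i then if s = i then 1 else 0 else 0))) s r"
  shows "a i i * a j l - a j i * a i l = det (sqmat n N) * (a' j l - a j l)"
proof -
  define N' where "N' r s = N r s + (if r = i then if s = i then 1 else 0 else 0)" for r s
  have a': "a' r s = cofactor (sqmat n N') s r" for r s
    by (simp add: a'_def N'_def[abs_def])
  have col: "a' r i = a r i" for r
    unfolding a' a_def by (rule cofactor_cong_row) (simp_all add: assms(1) N'_def)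
  have det': "det (sqmat n N') = det (sqmat n N) + a i i"
  proof -
    have "det (sqmat n N') = det (sqmat n N) + (\<Sum>s<n. (if s = i then 1 else 0) * cofactor (sqmat n N) i s)"
      unfolding N'_def using assms(1) by (rule det_add_to_row)
    also have "(\<Sum>s<n. (if s = i then 1 else 0) * cofactor (sqmat n N) i s) = (\<Sum>s<n. if s = i then a i i else 0)"
      by (intro sum.cong refl) (simp add: a_def)
    finally show ?thesis using assms(1) by simp
  qed
  have "(\<Sum>s<n. (\<Sum>r<n. a' j r * N' r s) * a s l) = (\<Sum>s<n. if s = j then det (sqmat n N') * a j l else 0)"
    unfolding a' by (intro sum.cong refl) (auto simp: cofactor_mult_mat assms(2))
  also have "\<dots> = det (sqmat n N') * a j l" using assms(2) by simp
  also have "(\<Sum>s<n. (\<Sum>r<n. a' j r * N' r s) * a s l) = (\<Sum>r<n. a' j r * (\<Sum>s<n. N' r s * a s l))"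
    by (simp only: sum_distrib_left sum_distrib_right mult.assoc) (rule sum.swap)
  also have "\<dots> = (\<Sum>r<n. (if r = l then det (sqmat n N) * a' j l else 0) + (if r = i then a' j i * a i l else 0))"
  proof (intro sum.cong refl)
    fix r assume "r \<in> {..<n}"
    then have r: "r < n" by simp
    have "(\<Sum>s<n. N' r s * a s l) = (\<Sum>s<n. N r s * a s l + (if s = i then if r = i then a i l else 0 else 0))"
      by (intro sum.cong refl) (simp add: N'_def distrib_right)
    also have "\<dots> = (if r = l then det (sqmat n N) else 0) + (if r = i then a i l else 0)"
      unfolding sum.distrib a_def mat_mult_cofactor[OF r assms(3)] using assms(1) by simp
    finally show "a' j r * (\<Sum>s<n. N' r s * a s l)
        = (if r = l then det (sqmat n N) * a' j l else 0) + (if r = i then a' j i * a i l else 0)"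
      by (simp add: distrib_left mult.commute)
  qed
  also have "\<dots> = det (sqmat n N) * a' j l + a j i * a i l"
    using assms(1,3) by (simp add: sum.distrib col)
  finally show ?thesis by (simp add: det' algebra_simps)
qed

text \<open>The cofactors of row \<open>k\<close> add up to the determinant with row \<open>k\<close> replaced by ones, and
  adding a multiple of that row to another one does not change it.\<close>

lemma sum_cofactors_add_const_row:
  fixes N :: "nat \<Rightarrow> nat \<Rightarrow> 'a::comm_ring_1"
  assumes "k < n" "l < n" "l \<noteq> k"
  shows "(\<Sum>j<n. cofactor (sqmat n (\<lambda>i j. N i j + (if i = l then s else 0))) k j)
    = (\<Sum>j<n. cofactor (sqmat n N) k j)"
proof -
  define R where "R = sqmat n (\<lambda>i j. if i = k then 1 else N i j)"
  have "sqmat n (\<lambda>i j. if i = k then 1 else N i j + (if i = l then s else 0)) = addrow s l k R"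
    using assms by (intro eq_matI) (auto simp: R_def add.commute)
  moreover have "det (addrow s l k R) = det R"
    using assms by (intro det_addrow) (auto simp: R_def)
  ultimately show ?thesis
    using det_replace_row[OF assms(1), of "\<lambda>_. 1" "\<lambda>i j. N i j + (if i = l then s else 0)"]
      det_replace_row[OF assms(1), of "\<lambda>_. 1" N] by (simp add: R_def)
qed

text \<open>Add the constant to one row after the other.\<close>

lemma det_add_const:
  fixes N :: "nat \<Rightarrow> nat \<Rightarrow> 'a::comm_ring_1"
  shows "det (sqmat n (\<lambda>i j. N i j + s)) = det (sqmat n N) + s * (\<Sum>i<n. \<Sum>j<n. cofactor (sqmat n N) i j)"
proof -
  define P where "P k i j = N i j + (if i < k then s else 0)" for k i j :: nat
  have P_Suc: "P (Suc k) = (\<lambda>i j. P k i j + (if i = k then s else 0))" for k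
    by (intro ext) (simp add: P_def)
  have P_0: "P 0 = N" by (intro ext) (simp add: P_def)
  have cof: "l \<le> k \<Longrightarrow> (\<Sum>j<n. cofactor (sqmat n (P l)) k j) = (\<Sum>j<n. cofactor (sqmat n N) k j)"
    if "k < n" for k l
  proof (induction l)
    case (Suc l)
    then show ?case unfolding P_Suc using that by (subst sum_cofactors_add_const_row) auto
  qed (simp add: P_0)
  have "k \<le> n \<Longrightarrow> det (sqmat n (P k)) = det (sqmat n N) + s * (\<Sum>i<k. \<Sum>j<n. cofactor (sqmat n N) i j)" for k
  proof (induction k)
    case 0
    show ?case by (simp add: P_0)
  next
    case (Suc k)
    then have k: "k < n" by simp
    have "det (sqmat n (P (Suc k))) = det (sqmat n (P k)) + (\<Sum>j<n. s * cofactor (sqmat n (P k)) k j)"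
      unfolding P_Suc using k by (rule det_add_to_row)
    also have "(\<Sum>j<n. s * cofactor (sqmat n (P k)) k j) = s * (\<Sum>j<n. cofactor (sqmat n N) k j)"
      by (simp add: cof k flip: sum_distrib_left)
    finally show ?case using Suc by (simp add: algebra_simps)
  qed
  moreover have "sqmat n (P n) = sqmat n (\<lambda>i j. N i j + s)"
    by (intro eq_matI) (auto simp: P_def)
  ultimately show ?thesis by (metis order_refl)
qed

lemma cofactor_symmetric:
  fixes N :: "nat \<Rightarrow> nat \<Rightarrow> 'a::comm_ring_1"
  assumes "\<And>i j. i < n \<Longrightarrow> j < n \<Longrightarrow> N i j = N j i" "i < n" "j < n"
  shows "cofactor (sqmat n N) i j = cofactor (sqmat n N) j i"
proof -
  have "mat_delete (sqmat n N) i j = (mat_delete (sqmat n N) j i)\<^sup>T"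
    using assms by (intro eq_matI) (auto simp: mat_delete_def)
  moreover have "mat_delete (sqmat n N) j i \<in> carrier_mat (n - 1) (n - 1)"
    by (rule mat_delete_carrier) simp
  ultimately show ?thesis by (simp add: cofactor_def det_transpose add.commute)
qed

lemma char_poly_matrix_sqmat: "char_poly_matrix (sqmat n A) = sqmat n (char_entry A)"
  by (intro eq_matI) (auto simp: char_poly_matrix_def char_entry_def tvar_def)

lemma diagonal_cofactor_char_poly:
  assumes "i < n"
  shows "cofactor (sqmat n (char_entry A)) i i = char_poly (mat_delete (sqmat n A) i i)"
proof -
  have "mat_delete (char_poly_matrix (sqmat n A)) i i = char_poly_matrix (mat_delete (sqmat n A) i i)"
    using assms by (intro eq_matI) (auto simp: mat_delete_def char_poly_matrix_def)
  then show ?thesis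
    by (simp add: cofactor_def char_poly_def flip: char_poly_matrix_sqmat power_add mult_2)
qed

lemma adjugate_system_char_poly:
  assumes "\<And>i j. i < n \<Longrightarrow> j < n \<Longrightarrow> A i j = A j i" and "\<And>i. i < n \<Longrightarrow> A i i = 0"
  shows "adjugate_system n A (char_poly (sqmat n A)) (cofactor (sqmat n (char_entry A)))"
  (is "adjugate_system n A ?F ?a")
proof
  have sym: "char_entry A i j = char_entry A j i" if "i < n" "j < n" for i j
    using assms(1)[OF that] by (simp add: char_entry_def)
  have F: "?F = det (sqmat n (char_entry A))"
    by (simp add: char_poly_def char_poly_matrix_sqmat)
  fix i j l assume *: "i < n" "j < n"
  show "A i j = A j i" using assms(1) * .
  show csym: "?a i j = ?a j i"
    using sym * by (rule cofactor_symmetric)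
  have "(\<Sum>k<n. char_entry A i k * ?a k j)
      = (\<Sum>k<n. char_entry A i k * ?a j k)"
    using sym *(2) by (intro sum.cong refl arg_cong2[of _ _ _ _ "(*)"] cofactor_symmetric) auto
  then show "(\<Sum>k<n. char_entry A i k * ?a k j)
      = (if i = j then ?F else 0)"
    using * by (simp add: mat_mult_cofactor F)
  assume l: "l < n"
  show "?F dvd
      ?a i i * ?a j l
      - ?a j i * ?a i l"
    unfolding F using cofactor_minors[OF *(1) l *(2), of "char_entry A"]
    by (simp only: mult.commute[of "?a i l"] dvd_triv_left)
next
  show "A i i = 0" if "i < n" for i using assms(2) that .
  show "(\<Sum>i<n. ?a i i) = pderiv (?F)"
    by (subst pderiv_char_poly[of _ n]) (simp_all add: diagonal_cofactor_char_poly)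
  have "degree (?F) = n \<and> coeff (?F) n = 1"
    by (rule degree_monic_char_poly) simp
  then show "lead_coeff (?F) = 1" and "degree (?F) = n"
    by simp_all
qed

text \<open>The quadratic form of \<open>N\<close> vanishes modulo 2, since off-diagonal terms come in pairs; at
  row \<open>i\<close> of the adjugate its value is the cofactor times the determinant.\<close>

lemma hollow_even_diagonal_cofactor:
  fixes N :: "nat \<Rightarrow> nat \<Rightarrow> int poly"
  assumes sym: "\<And>i j. i < n \<Longrightarrow> j < n \<Longrightarrow> N i j = N j i" and diag: "\<And>i. i < n \<Longrightarrow> N i i = 0"
    and "mod2 (det (sqmat n N)) \<noteq> 0" "i < n"
  shows "mod2 (cofactor (sqmat n N) i i) = 0"
proof -
  define x where "x k = cofactor (sqmat n N) i k" for k
  have "x i * det (sqmat n N) = (\<Sum>k<n. if k = i then x k * det (sqmat n N) else 0)"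
    using assms(4) by simp
  also have "\<dots> = (\<Sum>k<n. \<Sum>l<n. x k * (N k l * x l))"
    unfolding x_def sum_distrib_left[symmetric]
    by (intro sum.cong refl) (auto simp: mat_mult_cofactor assms(4))
  also have "\<dots> = 2 * (\<Sum>k<n. \<Sum>l<k. x k * (N k l * x l))"
    by (subst sum_symmetric) (simp_all add: diag sym mult_ac)
  finally have "mod2 (x i * det (sqmat n N)) = mod2 (2 * (\<Sum>k<n. \<Sum>l<k. x k * (N k l * x l)))"
    by (rule arg_cong)
  then have "mod2 (x i) * mod2 (det (sqmat n N)) = 0"
    by (simp only: mod2_mult mod2_numeral_2 mult_zero_left)
  then show ?thesis using assms(3) by (simp add: x_def)
qed

lemma four_dvd_imp_mod2:
  assumes "4 dvd (x :: int poly)"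
  shows "mod2 x = 0"
proof -
  have "4 = 2 * (2 :: int poly)" by simp
  then have "2 dvd x" using assms by (metis dvd_mult_left)
  then show ?thesis by (simp only: mod2_eq_0_iff)
qed

lemma four_dvd_square_mult_cancel:
  assumes "4 dvd (s :: int poly)\<^sup>2 * y" "mod2 s \<noteq> 0"
  shows "4 dvd y"
proof -
  have "mod2 (s\<^sup>2 * y) = 0" using assms(1) by (rule four_dvd_imp_mod2)
  then have "mod2 y = 0" using assms(2) by simp
  then obtain z where z: "y = 2 * z" by (rule mod2_eq_0E)
  have "4 dvd 2 * (s\<^sup>2 * z)" using assms(1) by (simp add: z mult.left_commute)
  then have "mod2 (s\<^sup>2 * z) = 0" by (simp only: four_dvd_double_iff)
  then have "mod2 z = 0" using assms(2) by simp
  then show ?thesis by (simp add: z four_dvd_double_iff)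
qed

text \<open>Induction by Jacobi's identity for the last two indices \<open>i\<close> and \<open>j\<close>: the determinants
  \<open>\<Delta>\<close> and \<open>\<Delta>''\<close> of sizes differing by two satisfy \<open>\<Delta> \<Delta>'' = a\<^sub>i\<^sub>i a\<^sub>j\<^sub>j - a\<^sub>i\<^sub>j\<^sup>2\<close>, and the
  diagonal cofactors are even. So \<open>\<Delta> \<Delta>''\<close> is a square up to sign modulo 4, and by induction so
  is \<open>\<Delta>''\<close>, whose root can be cancelled because it is nonzero modulo 2.\<close>

theorem hollow_det_square_mod_4:
  fixes N :: "nat \<Rightarrow> nat \<Rightarrow> int poly"
  assumes "\<And>i j. N i j = N j i" "\<And>i. N i i = 0"
    and "\<And>k. k \<le> m \<Longrightarrow> mod2 (det (sqmat (2 * k) N)) \<noteq> 0"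
  shows "\<exists>s. 4 dvd det (sqmat (2 * m) N) - (-1) ^ m * s\<^sup>2"
  using assms(3)
proof (induction m)
  case 0
  have "det (sqmat 0 N) = 1" by (simp add: det_dim_zero)
  then show ?case by (intro exI[of _ 1]) simp
next
  case (Suc m)
  then obtain s'' where s'': "4 dvd det (sqmat (2 * m) N) - (-1) ^ m * s''\<^sup>2" by auto
  define n where "n = 2 * Suc m"
  define \<Delta> where "\<Delta> = det (sqmat n N)"
  define \<Delta>'' where "\<Delta>'' = det (sqmat (2 * m) N)"
  define a where "a = cofactor (sqmat n N)"
  define i where "i = 2 * m"
  define j where "j = Suc (2 * m)"
  have ij: "i < n" "j < n" "i \<noteq> j" by (simp_all add: i_def j_def n_def)
  have \<Delta>0: "mod2 \<Delta> \<noteq> 0" using Suc.prems[of "Suc m"] by (simp add: \<Delta>_def n_def)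
  have \<Delta>''0: "mod2 \<Delta>'' \<noteq> 0" using Suc.prems[of m] by (simp add: \<Delta>''_def)
  have even_diag: "mod2 (a k k) = 0" if "k < n" for k
    unfolding a_def using that \<Delta>0 by (intro hollow_even_diagonal_cofactor) (simp_all add: assms \<Delta>_def)
  have a_sym: "a i j = a j i" unfolding a_def using assms(1) ij(1,2) by (rule cofactor_symmetric)
  define N' where "N' r s = N r s + (if r = i then if s = i then 1 else 0 else 0)" for r s
  have jacobi: "a i i * a j j - a i j * a i j = \<Delta> * \<Delta>''"
  proof -
    have last: "mat_delete (sqmat n K) j j = sqmat (Suc (2 * m)) K" for K :: "nat \<Rightarrow> nat \<Rightarrow> int poly"
      by (intro eq_matI) (auto simp: mat_delete_def n_def j_def)
    have "cofactor (sqmat n N') j j - cofactor (sqmat n N) j j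
        = det (sqmat (Suc (2 * m)) N') - det (sqmat (Suc (2 * m)) N)"
      by (simp add: cofactor_def last flip: power_add mult_2)
    also have "\<dots> = (\<Sum>s<Suc (2 * m). (if s = i then 1 else 0) * cofactor (sqmat (Suc (2 * m)) N) i s)"
      unfolding N'_def by (subst det_add_to_row) (simp_all add: i_def)
    also have "\<dots> = (\<Sum>s<Suc (2 * m). if s = i then cofactor (sqmat (Suc (2 * m)) N) i i else 0)"
      by (intro sum.cong refl) simp
    also have "\<dots> = cofactor (sqmat (Suc (2 * m)) N) i i"
      by (simp add: i_def)
    also have "mat_delete (sqmat (Suc (2 * m)) N) i i = sqmat (2 * m) N"
      by (intro eq_matI) (auto simp: mat_delete_def i_def)
    then have "cofactor (sqmat (Suc (2 * m)) N) i i = \<Delta>''"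
      by (simp add: cofactor_def \<Delta>''_def flip: power_add mult_2)
    finally have "cofactor (sqmat n N') j j - cofactor (sqmat n N) j j = \<Delta>''" .
    then show ?thesis
      using cofactor_minors[OF ij(1,2,2), of N] a_sym by (simp add: a_def \<Delta>_def N'_def[abs_def])
  qed
  have "4 dvd a i i * a j j"
  proof -
    obtain x y where "a i i = 2 * x" "a j j = 2 * y"
      using even_diag ij(1,2) by (metis mod2_eq_0E)
    then have "a i i * a j j = 4 * (x * y)" by simp
    then show ?thesis by simp
  qed
  then have a_square: "4 dvd (a i j)\<^sup>2 + \<Delta> * \<Delta>''"
    using jacobi by (simp add: power2_eq_square algebra_simps)
  have s''_mod2: "mod2 \<Delta>'' = (mod2 s'')\<^sup>2"
  proof -
    have "mod2 (\<Delta>'' - (-1) ^ m * s''\<^sup>2) = 0"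
      using s'' unfolding \<Delta>''_def by (rule four_dvd_imp_mod2)
    then show ?thesis by (cases "even m") (simp_all add: bit_poly_add_eq_0_iff)
  qed
  then have s''0: "mod2 s'' \<noteq> 0" using \<Delta>''0 by auto
  define u where "u = even_root (mod2 \<Delta>)"
  define v where "v = odd_root (mod2 \<Delta>)"
  have uv: "mod2 \<Delta> = u\<^sup>2 + tvar * v\<^sup>2" unfolding u_def v_def by (rule even_odd_roots)
  have "mod2 ((a i j)\<^sup>2 + \<Delta> * \<Delta>'') = 0"
    using a_square by (rule four_dvd_imp_mod2)
  then have "(mod2 (a i j))\<^sup>2 + tvar * 0\<^sup>2 = (u * mod2 s'')\<^sup>2 + tvar * (v * mod2 s'')\<^sup>2"
    by (simp add: s''_mod2 uv bit_poly_add_eq_0_iff power_mult_distrib algebra_simps)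
  then have a_root: "mod2 (a i j) = u * mod2 s''" by (rule even_odd_unique)
  define s where "s = lift2 u"
  have "4 dvd (a i j)\<^sup>2 - (s * s'')\<^sup>2"
    by (rule mod2_eq_imp_square_cong) (simp add: a_root s_def)
  then have "4 dvd ((a i j)\<^sup>2 + \<Delta> * \<Delta>'') - ((a i j)\<^sup>2 - (s * s'')\<^sup>2) - \<Delta> * (\<Delta>'' - (-1) ^ m * s''\<^sup>2)"
    using a_square s'' unfolding \<Delta>''_def by (intro dvd_diff[OF dvd_diff] dvd_mult)
  also have "\<dots> = s''\<^sup>2 * (s\<^sup>2 + (-1) ^ m * \<Delta>)"
    by (simp add: power_mult_distrib algebra_simps)
  finally have "4 dvd s\<^sup>2 + (-1) ^ m * \<Delta>" using s''0 by (rule four_dvd_square_mult_cancel)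
  then have "4 dvd (-1) ^ m * (s\<^sup>2 + (-1) ^ m * \<Delta>)" by (rule dvd_mult)
  also have "(-1) ^ m * (s\<^sup>2 + (-1) ^ m * \<Delta>) = \<Delta> - (-1) ^ Suc m * s\<^sup>2"
    by (simp add: algebra_simps flip: power_add mult_2 mult.assoc)
  finally show ?case unfolding \<Delta>_def n_def by blast
qed

lemma (in adjugate_system) det_char_entry_minus_tvar:
  assumes "a = cofactor (sqmat n (char_entry A))" "F = det (sqmat n (char_entry A))"
  shows "det (sqmat n (\<lambda>i j. char_entry A i j - tvar)) = F - tvar * \<Omega>"
  unfolding \<Omega>_def using det_add_const[of n "char_entry A" "- tvar"] by (simp add: assms)

text \<open>The leading minors of even size of \<open>tI - A - tJ\<close> are, modulo 2, the characteristic
  polynomials of the leading submatrices of \<open>A\<close>, which are monic, so \<open>hollow_det_square_mod_4\<close>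
  applies.\<close>

theorem square_det_system_char_poly:
  assumes sym: "\<And>i j. A i j = A j i" and diag: "\<And>i. A i i = 0" and "even n"
  shows "square_det_system n A (char_poly (sqmat n A)) (cofactor (sqmat n (char_entry A)))"
proof -
  have det: "char_poly (sqmat k A) = det (sqmat k (char_entry A))" for k
    by (simp add: char_poly_def char_poly_matrix_sqmat)
  have even_system: "even_system k A (char_poly (sqmat k A)) (cofactor (sqmat k (char_entry A)))"
    if "even k" for k
    using adjugate_system_char_poly[of k A] sym diag that
    by (simp add: even_system_def even_system_axioms_def)
  define N where "N i j = char_entry A i j - tvar" for i j
  have N_det: "det (sqmat k N) = char_poly (sqmat k A)
      - tvar * adjugate_system.\<Omega> k (cofactor (sqmat k (char_entry A)))" if "even k" for k
  proof -
    interpret even_system k A "char_poly (sqmat k A)" "cofactor (sqmat k (char_entry A))"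
      using that by (rule even_system)
    show ?thesis unfolding N_def by (rule det_char_entry_minus_tvar) (simp_all add: det)
  qed
  interpret even_system n A "char_poly (sqmat n A)" "cofactor (sqmat n (char_entry A))"
    using \<open>even n\<close> by (rule even_system)
  have "\<exists>s. 4 dvd det (sqmat (2 * (n div 2)) N) - (-1) ^ (n div 2) * s\<^sup>2"
  proof (rule hollow_det_square_mod_4)
    show "N i j = N j i" and "N i i = 0" for i j
      using sym[of i j] diag[of i] by (simp_all add: N_def char_entry_def)
    fix k
    interpret k: even_system "2 * k" A "char_poly (sqmat (2 * k) A)" "cofactor (sqmat (2 * k) (char_entry A))"
      by (rule even_system) simp
    have "mod2 (det (sqmat (2 * k) N)) = k.f"
      using k.pderiv_f by (simp add: N_det k.\<Omega>_eq k.f_def)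
    then show "mod2 (det (sqmat (2 * k) N)) \<noteq> 0" using k.f_neq_0 by simp
  qed
  moreover have "2 * (n div 2) = n" using \<open>even n\<close> by simp
  ultimately obtain s0 where s0: "4 dvd char_poly (sqmat n A) - tvar * \<Omega> - (-1) ^ (n div 2) * s0\<^sup>2"
    using N_det[OF \<open>even n\<close>] by auto
  have "p\<^sup>2 = (mod2 s0)\<^sup>2"
  proof -
    have "mod2 (char_poly (sqmat n A) - tvar * \<Omega> - (-1) ^ (n div 2) * s0\<^sup>2) = 0"
      using s0 by (rule four_dvd_imp_mod2)
    then have "f + tvar * pderiv f + (mod2 s0)\<^sup>2 = 0"
      by (cases "even (n div 2)") (simp_all add: \<Omega>_eq f_def)
    then show ?thesis by (simp add: pderiv_f f_eq bit_poly_add_eq_0_iff)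
  qed
  then have p: "p = mod2 s0" by (simp only: char2_square_eq_iff)
  show ?thesis
  proof
    fix s assume "mod2 s = p"
    then have "4 dvd s0\<^sup>2 - s\<^sup>2" by (intro mod2_eq_imp_square_cong) (simp add: p)
    then have "4 dvd (char_poly (sqmat n A) - tvar * \<Omega> - (-1) ^ (n div 2) * s0\<^sup>2)
        + (-1) ^ (n div 2) * (s0\<^sup>2 - s\<^sup>2)"
      using s0 by (intro dvd_add dvd_mult)
    also have "\<dots> = char_poly (sqmat n A) - tvar * \<Omega> - (-1) ^ (n div 2) * s\<^sup>2"
      by (simp add: algebra_simps)
    finally show "4 dvd char_poly (sqmat n A) - tvar * \<Omega> - (-1) ^ (n div 2) * s\<^sup>2" .
  qed
qed

section \<open>Relabelling and complements\<close>

lemma relabel_sum: "\<pi> permutes {..<n} \<Longrightarrow> (\<Sum>i<n. g (\<pi> i)) = (\<Sum>i<n. g i)"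
  using sum.permute[of \<pi> "{..<n}" g] by (simp add: comp_def)

context adjugate_system
begin

context
  fixes \<pi> :: "nat \<Rightarrow> nat"
  assumes \<pi>: "\<pi> permutes {..<n}"
begin

lemma relabel_less: "i < n \<Longrightarrow> \<pi> i < n"
  using permutes_in_image[OF \<pi>, of i] by simp

lemma relabelled_system: "adjugate_system n (\<lambda>i j. A (\<pi> i) (\<pi> j)) F (\<lambda>i j. a (\<pi> i) (\<pi> j))"
proof
  have inj: "\<pi> i = \<pi> j \<longleftrightarrow> i = j" for i j
    using permutes_inj[OF \<pi>] by (rule inj_eq)
  have entry: "char_entry (\<lambda>i j. A (\<pi> i) (\<pi> j)) i k = char_entry A (\<pi> i) (\<pi> k)" for i k
    by (simp add: char_entry_def inj)
  fix i j assume *: "i < n" "j < n"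
  show "(\<Sum>k<n. char_entry (\<lambda>i j. A (\<pi> i) (\<pi> j)) i k * a (\<pi> k) (\<pi> j)) = (if i = j then F else 0)"
    unfolding entry relabel_sum[OF \<pi>, of "\<lambda>k. char_entry A (\<pi> i) k * a k (\<pi> j)"]
    by (simp add: char_mult_adj relabel_less * inj)
next
  show "(\<Sum>i<n. a (\<pi> i) (\<pi> i)) = pderiv F"
    unfolding relabel_sum[OF \<pi>, of "\<lambda>i. a i i"] by (rule trace_adj)
  show "lead_coeff F = 1" by (rule F_monic)
  show "F dvd a (\<pi> i) (\<pi> i) * a (\<pi> j) (\<pi> l) - a (\<pi> j) (\<pi> i) * a (\<pi> i) (\<pi> l)"
    if "i < n" "j < n" "l < n" for i j l
    using that by (intro minors relabel_less)
qed (simp_all add: A_sym A_diag a_sym F_degree relabel_less)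

lemma relabelled_\<Omega>: "adjugate_system.\<Omega> n (\<lambda>i j. a (\<pi> i) (\<pi> j)) = \<Omega>"
proof -
  have "adjugate_system.\<Omega> n (\<lambda>i j. a (\<pi> i) (\<pi> j)) = (\<Sum>i<n. \<Sum>j<n. a (\<pi> i) (\<pi> j))"
    by (rule adjugate_system.\<Omega>_def[OF relabelled_system])
  also have "\<dots> = (\<Sum>i<n. \<Sum>j<n. a (\<pi> i) j)"
    by (intro sum.cong refl relabel_sum \<pi>)
  also have "\<dots> = \<Omega>"
    unfolding \<Omega>_def by (rule relabel_sum[OF \<pi>, of "\<lambda>i. \<Sum>j<n. a i j"])
  finally show ?thesis .
qed

end

end

lemma (in square_det_system) relabelled_square_det_system:
  assumes \<pi>: "\<pi> permutes {..<n}"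
  shows "square_det_system n (\<lambda>i j. A (\<pi> i) (\<pi> j)) F (\<lambda>i j. a (\<pi> i) (\<pi> j))"
proof -
  have even: "even_system n (\<lambda>i j. A (\<pi> i) (\<pi> j)) F (\<lambda>i j. a (\<pi> i) (\<pi> j))"
    using relabelled_system[OF \<pi>] even_n by (simp add: even_system_def even_system_axioms_def)
  interpret relab: even_system n "\<lambda>i j. A (\<pi> i) (\<pi> j)" F "\<lambda>i j. a (\<pi> i) (\<pi> j)" by (rule even)
  have "relab.p = p" by (simp add: relab.p_def p_def relab.f_def f_def)
  then show ?thesis
    by unfold_locales (simp add: relabelled_\<Omega>[OF \<pi>] det_square)
qed

text \<open>The complement has the adjacency matrix \<open>J - I - A\<close>, and \<open>tI - (J - I - A)\<close> is the
  negative of \<open>(-1 - t) I - A + J\<close>.\<close>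

lemma (in adjugate_system) char_poly_complement:
  assumes a: "a = cofactor (sqmat n (char_entry A))" and F: "F = char_poly (sqmat n A)"
  shows "char_poly (sqmat n (\<lambda>i j. if i = j then 0 else 1 - A i j)) = (-1) ^ n * pcompose (F + \<Omega>) [:-1, -1:]"
proof -
  let ?C = "\<lambda>i j. if i = j then 0 else 1 - A i j"
  have entry: "char_entry ?C i j = -1 * pcompose (char_entry A i j + 1) [:-1, -1:]" if "i < n" for i j
    using A_diag[OF that] by (cases "i = j") (simp_all add: char_entry_def tvar_def one_pCons pcompose_pCons)
  have "sqmat n (char_entry ?C) = (-1) \<cdot>\<^sub>m map_mat (\<lambda>f. pcompose f [:-1, -1:]) (sqmat n (\<lambda>i j. char_entry A i j + 1))"
    by (intro eq_matI) (simp_all only: entry index_mat index_map_mat index_smult_mat dim_col_mat dim_row_mat case_prod_conv)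
  then have "det (sqmat n (char_entry ?C)) = (-1) ^ n * pcompose (det (sqmat n (\<lambda>i j. char_entry A i j + 1))) [:-1, -1:]"
    using comm_ring_hom.hom_det[OF pcompose_hom.comm_ring_hom_axioms, of "[:-1, -1:]" "sqmat n (\<lambda>i j. char_entry A i j + 1)"] by (simp only: det_smult) simp
  also have "det (sqmat n (\<lambda>i j. char_entry A i j + 1)) = F + \<Omega>"
    unfolding \<Omega>_def by (simp add: det_add_const a F char_poly_def char_poly_matrix_sqmat)
  finally show ?thesis by (simp add: char_poly_def char_poly_matrix_sqmat)
qed

section \<open>Adjacency matrices, decks and walk rank\<close>

definition adjacency :: "(nat, 'b) pre_digraph \<Rightarrow> nat \<Rightarrow> nat \<Rightarrow> int" where
  "adjacency G i j = (if (Suc i, Suc j) \<in> arcs_ends G then 1 else 0)"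

lemma adjacency_sym: "graph G \<Longrightarrow> adjacency G i j = adjacency G j i"
proof -
  assume "graph G"
  then interpret graph G .
  show ?thesis using sym_arcs arcs_ends_symmetric unfolding adjacency_def by metis
qed

lemma adjacency_diag: "graph G \<Longrightarrow> adjacency G i i = 0"
proof -
  assume "graph G"
  then interpret graph G .
  show ?thesis using adj_not_same unfolding adjacency_def by auto
qed

lemma sorted_list_of_set_eqI: "sorted xs \<Longrightarrow> distinct xs \<Longrightarrow> set xs = S \<Longrightarrow> sorted_list_of_set S = xs"
  by (metis sorted_list_of_set.idem_if_sorted_distinct)

lemma adj_matrix_interval:
  assumes "verts G = {1..n}"
  shows "adj_matrix G = sqmat n (adjacency G)"
proof -
  have "sorted_list_of_set (verts G) = map Suc [0..<n]"
    by (rule sorted_list_of_set_eqI) (auto simp: assms map_Suc_upt simp del: upt_Suc)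
  then show ?thesis by (auto simp: adj_matrix_def adjacency_def Let_def intro!: eq_matI)
qed

lemma graph_char_poly_del_vert:
  assumes "verts G = {1..n}" "i < n"
  shows "graph_char_poly (pre_digraph.del_vert G (Suc i)) = char_poly (mat_delete (sqmat n (adjacency G)) i i)"
proof -
  define xs where "xs = map (\<lambda>k. if k < i then Suc k else Suc (Suc k)) [0..<n - 1]"
  have verts_del: "verts (pre_digraph.del_vert G (Suc i)) = {1..n} - {Suc i}"
    using assms(1) by (simp only: pre_digraph.verts_del_vert)
  have "sorted_list_of_set (verts (pre_digraph.del_vert G (Suc i))) = xs"
  proof (rule sorted_list_of_set_eqI)
    have "sorted_wrt (<) xs"
      unfolding xs_def sorted_wrt_map by (rule sorted_wrt_mono_rel[OF _ sorted_wrt_upt]) simp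
    then show "sorted xs" "distinct xs" by (simp_all add: strict_sorted_iff)
    show "set xs = verts (pre_digraph.del_vert G (Suc i))"
    proof
      show "set xs \<subseteq> verts (pre_digraph.del_vert G (Suc i))"
      proof
        fix v assume "v \<in> set xs"
        then obtain k where "k < n - 1" "v = (if k < i then Suc k else Suc (Suc k))"
          unfolding xs_def by auto
        then show "v \<in> verts (pre_digraph.del_vert G (Suc i))"
          using assms(2) by (cases "k < i") (simp_all add: verts_del)
      qed
      show "verts (pre_digraph.del_vert G (Suc i)) \<subseteq> set xs"
      proof
        fix v assume "v \<in> verts (pre_digraph.del_vert G (Suc i))"
        then have v: "1 \<le> v" "v \<le> n" "v \<noteq> Suc i" unfolding verts_del by auto
        show "v \<in> set xs"
        proof (cases "v < Suc i")
          case True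
          then show ?thesis using v assms(2) unfolding xs_def by (auto intro!: image_eqI[of _ _ "v - 1"])
        next
          case False
          then show ?thesis using v unfolding xs_def by (auto intro!: image_eqI[of _ _ "v - 2"])
        qed
      qed
    qed
  qed
  moreover have "(u, v) \<in> arcs_ends (pre_digraph.del_vert G (Suc i)) \<longleftrightarrow> (u, v) \<in> arcs_ends G"
    if "u \<noteq> Suc i" "v \<noteq> Suc i" for u v
    using that by (auto simp: arcs_ends_conv pre_digraph.del_vert_simps)
  ultimately have "adj_matrix (pre_digraph.del_vert G (Suc i)) = mat_delete (sqmat n (adjacency G)) i i"
    using assms(2) by (intro eq_matI) (auto simp: adj_matrix_def Let_def xs_def mat_delete_def adjacency_def)
  then show ?thesis by (simp add: graph_char_poly_def)
qed

lemma poly_deck_interval: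
  assumes "verts G = {1..n}"
  shows "poly_deck G = image_mset (\<lambda>i. cofactor (sqmat n (char_entry (adjacency G))) i i) (mset_set {..<n})"
proof -
  have "mset_set {1..n} = image_mset Suc (mset_set {..<n})"
    by (simp add: image_mset_mset_set image_Suc_lessThan)
  then show ?thesis unfolding poly_deck_def assms
    by (auto simp: image_mset.compositionality comp_def assms diagonal_cofactor_char_poly
        graph_char_poly_del_vert[of _ n] intro!: image_mset_cong)
qed

lemma adj_matrix_complement:
  assumes "verts G = {1..n}"
  shows "adj_matrix (graph_complement G) = sqmat n (\<lambda>i j. if i = j then 0 else 1 - adjacency G i j)"
proof -
  have "adj_matrix (graph_complement G) = sqmat n (adjacency (graph_complement G))"
    by (rule adj_matrix_interval) (simp add: graph_complement_def assms)
  moreover have "adjacency (graph_complement G) i j = (if i = j then 0 else 1 - adjacency G i j)"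
    if "i < n" "j < n" for i j
    using that by (auto simp: adjacency_def graph_complement_def arcs_ends_conv assms image_def)
  ultimately show ?thesis by (auto intro!: eq_matI)
qed

lemma walk_column:
  assumes "A \<in> carrier_mat n n" "i < n"
  shows "((A ^\<^sub>m 0) *\<^sub>v vec n (\<lambda>_. 1)) $ i = (1 :: int)"
    and "((A ^\<^sub>m Suc k) *\<^sub>v vec n (\<lambda>_. 1 :: int)) $ i = (\<Sum>j<n. A $$ (i, j) * ((A ^\<^sub>m k) *\<^sub>v vec n (\<lambda>_. 1)) $ j)"
proof -
  show "((A ^\<^sub>m 0) *\<^sub>v vec n (\<lambda>_. 1)) $ i = (1 :: int)" using assms by simp
  have comm: "A ^\<^sub>m Suc k = A * A ^\<^sub>m k" for k
  proof (induction k)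
    case (Suc k)
    have "A ^\<^sub>m Suc (Suc k) = (A * A ^\<^sub>m k) * A" using Suc by simp
    also have "\<dots> = A * A ^\<^sub>m Suc k" using assms by (simp add: assoc_mult_mat[of _ n n _ n _ n] pow_carrier_mat)
    finally show ?case .
  qed (use assms in simp)
  have "(A ^\<^sub>m Suc k) *\<^sub>v vec n (\<lambda>_. 1) = A *\<^sub>v ((A ^\<^sub>m k) *\<^sub>v vec n (\<lambda>_. 1))"
    unfolding comm using assms by (intro assoc_mult_mat_vec[of _ n n _ n]) (auto simp: pow_carrier_mat)
  then show "((A ^\<^sub>m Suc k) *\<^sub>v vec n (\<lambda>_. 1 :: int)) $ i = (\<Sum>j<n. A $$ (i, j) * ((A ^\<^sub>m k) *\<^sub>v vec n (\<lambda>_. 1)) $ j)"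
    using assms by (simp add: scalar_prod_def atLeast0LessThan)
qed

lemma rank_ge_independent_columns:
  fixes w :: "nat \<Rightarrow> nat \<Rightarrow> bit"
  assumes "W \<in> carrier_mat n n" "N < n"
    and col: "\<And>i k. i < n \<Longrightarrow> k < n \<Longrightarrow> W $$ (i, k) = w k i"
    and indep: "\<And>x. (\<And>i. i < n \<Longrightarrow> (\<Sum>j<Suc N. x j * w j i) = 0) \<Longrightarrow> \<forall>j<Suc N. x j = 0"
  shows "Suc N \<le> vec_space.rank n W"
proof -
  interpret vec_space "TYPE(bit)" n .
  define v where "v k = col W k" for k
  have v_index: "v k $ i = w k i" if "i < n" "k < Suc N" for i k
    using that assms(1,2) by (simp add: v_def col)
  have v_carrier: "v k \<in> carrier_vec n" for k using assms(1) by (intro carrier_vecI) (simp add: v_def)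
  have inj: "inj_on v {..<Suc N}"
  proof (rule inj_onI)
    fix k l assume kl: "k \<in> {..<Suc N}" "l \<in> {..<Suc N}" "v k = v l"
    define x :: "nat \<Rightarrow> bit" where "x j = (if j = k then 1 else 0) + (if j = l then 1 else 0)" for j
    have "(\<Sum>j<Suc N. x j * w j i) = 0" if i: "i < n" for i
    proof -
      have "(\<Sum>j<Suc N. x j * w j i) = (\<Sum>j<Suc N. (if j = k then w k i else 0) + (if j = l then w l i else 0))"
        by (intro sum.cong refl) (auto simp: x_def distrib_right)
      also have "\<dots> = w k i + w l i" unfolding sum.distrib using kl(1,2) by (simp del: sum.lessThan_Suc)
      also have "w l i = w k i" using v_index[OF i] kl by (metis lessThan_iff)
      finally show ?thesis by (simp add: bit_add_self_eq_0)
    qed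
    then have "\<forall>j<Suc N. x j = 0" by (rule indep)
    then have "x k = 0" using kl(1) unfolding lessThan_iff by blast
    then show "k = l" by (auto simp: x_def split: if_splits)
  qed
  have "lin_indpt (v ` {..<Suc N})"
  proof (rule finite_lin_indpt2)
    fix \<gamma> assume "lincomb \<gamma> (v ` {..<Suc N}) = 0\<^sub>v n"
    then have "(\<Sum>j<Suc N. \<gamma> (v j) * w j i) = 0" if "i < n" for i
    proof -
      have "0 = lincomb \<gamma> (v ` {..<Suc N}) $ i" using that \<open>lincomb _ _ = _\<close> by simp
      also have "\<dots> = (\<Sum>u\<in>v ` {..<Suc N}. \<gamma> u * u $ i)"
        using v_carrier that by (intro lincomb_index) auto
      also have "\<dots> = (\<Sum>j<Suc N. \<gamma> (v j) * v j $ i)" by (simp only: sum.reindex[OF inj] comp_def)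
      also have "\<dots> = (\<Sum>j<Suc N. \<gamma> (v j) * w j i)"
        using that by (intro sum.cong refl arg_cong2[of _ _ _ _ "(*)"] v_index) auto
      finally show ?thesis by simp
    qed
    then have "\<forall>j<Suc N. \<gamma> (v j) = 0" by (rule indep)
    then show "\<forall>u\<in>v ` {..<Suc N}. \<gamma> u = 0" by auto
  qed (use v_carrier in auto)
  moreover have "v ` {..<Suc N} \<subseteq> set (cols W)"
    using assms(1,2) by (auto simp: v_def cols_def)
  ultimately have "card (v ` {..<Suc N}) \<le> rank W"
    using rank_ge_card_indpt[OF assms(1)] by blast
  then show ?thesis by (simp only: card_image[OF inj] card_lessThan)
qed

text \<open>Otherwise \<open>walk_vectors_independent\<close> provides too many independent columns.\<close>

lemma (in odd_pair) four_dvd_c_if_low_walk_rank: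
  assumes W: "W = mat_of_cols n (map (\<lambda>k. (sqmat n A ^\<^sub>m k) *\<^sub>v vec n (\<lambda>_. 1)) [0..<n])"
    and rank: "vec_space.rank n (map_mat (of_int :: int \<Rightarrow> bit) W) < Suc (n div 2)"
  shows "4 dvd c"
proof (rule ccontr)
  assume nd: "\<not> 4 dvd c"
  define w :: "nat \<Rightarrow> nat \<Rightarrow> bit" where
    "w k i = of_int (((sqmat n A ^\<^sub>m k) *\<^sub>v vec n (\<lambda>_. 1)) $ i)" for k i
  have "Suc (n div 2) \<le> vec_space.rank n (map_mat (of_int :: int \<Rightarrow> bit) W)"
  proof (rule rank_ge_independent_columns)
    show "map_mat of_int W \<in> carrier_mat n n" by (auto simp: W)
    show "n div 2 < n" using L.odd_n by (auto elim!: oddE)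
    show "map_mat of_int W $$ (i, k) = w k i" if "i < n" "k < n" for i k
      using that by (simp add: W w_def mat_of_cols_index)
    show "\<forall>j<Suc (n div 2). x j = 0"
      if "\<And>i. i < n \<Longrightarrow> (\<Sum>j<Suc (n div 2). x j * w j i) = 0" for x
    proof (rule walk_vectors_independent[OF nd])
      show "w 0 i = 1" if "i < n" for i
        using that walk_column(1)[of "sqmat n A" n i] by (simp add: w_def)
      show "w (Suc k) i = (\<Sum>j<n. L.Ab i j * w k j)" if "i < n" for i k
      proof -
        have "w (Suc k) i = of_int (\<Sum>j<n. sqmat n A $$ (i, j) * ((sqmat n A ^\<^sub>m k) *\<^sub>v vec n (\<lambda>_. 1)) $ j)"
          unfolding w_def using that by (intro arg_cong[of _ _ of_int] walk_column(2)) simp_all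
        also have "\<dots> = (\<Sum>j<n. of_int (sqmat n A $$ (i, j)) * w k j)"
          by (simp only: of_int_sum of_int_mult w_def)
        also have "\<dots> = (\<Sum>j<n. L.Ab i j * w k j)"
          using that by (intro sum.cong refl) (simp add: L.Ab_def)
        finally show ?thesis .
      qed
    qed (rule that)
  qed
  then show False using rank by simp
qed

lemma (in system_pair) complement_difference:
  assumes "4 dvd c"
  shows "4 dvd coeff ((-1) ^ n * pcompose (F + L.\<Omega>) [:-1, -1:]) k - coeff ((-1) ^ n * pcompose (G + R.\<Omega>) [:-1, -1:]) k"
proof -
  have "even c" using assms by auto
  then have "4 dvd L.\<Omega> - R.\<Omega>" by (rule \<Omega>_cong(2))
  moreover have "4 dvd F - G"
    using assms unfolding F_minus_G by (simp add: numeral_poly const_poly_dvd_const_poly_iff)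
  ultimately have "4 dvd (F - G) + (L.\<Omega> - R.\<Omega>)" by (rule dvd_add[rotated])
  then obtain Z where Z: "(F - G) + (L.\<Omega> - R.\<Omega>) = [:4:] * Z" by (auto simp: numeral_poly elim!: dvdE)
  have "(-1) ^ n * pcompose (F + L.\<Omega>) [:-1, -1:] - (-1) ^ n * pcompose (G + R.\<Omega>) [:-1, -1:]
      = (-1) ^ n * pcompose ((F - G) + (L.\<Omega> - R.\<Omega>)) [:-1, -1:]"
    by (simp add: pcompose_add pcompose_diff algebra_simps)
  also have "\<dots> = [:4:] * ((-1) ^ n * pcompose Z [:-1, -1:])"
    by (simp only: Z pcompose_mult pcompose_const mult.left_commute)
  finally have "(-1) ^ n * pcompose (F + L.\<Omega>) [:-1, -1:] - (-1) ^ n * pcompose (G + R.\<Omega>) [:-1, -1:]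
    = [:4:] * ((-1) ^ n * pcompose Z [:-1, -1:])" .
  from arg_cong[OF this, of "\<lambda>f. coeff f k"] show ?thesis by simp
qed

theorem theorem9:
  fixes G :: "(nat, 'b) pre_digraph" and H :: "(nat, 'c) pre_digraph" and n :: nat
  assumes "n \<ge> 3"
    and "graph G" and "verts G = {1..n}"
    and "even n \<or> int (walk_rank_F2 G) < \<lceil>real n / 2\<rceil>"
    and "graph H" and "verts H = {1..n}"
    and "poly_deck H = poly_deck G"
  shows "[coeff (graph_char_poly G) 0 = coeff (graph_char_poly H) 0] (mod 4) \<and>
    (\<forall>k. [coeff (graph_char_poly (graph_complement G)) k
        = coeff (graph_char_poly (graph_complement H)) k] (mod 4))"
proof -
  define A where "A = adjacency G"
  define B where "B = adjacency H"
  define a where "a = cofactor (sqmat n (char_entry A))"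
  define b where "b = cofactor (sqmat n (char_entry B))"
  define F where "F = char_poly (sqmat n A)"
  define K where "K = char_poly (sqmat n B)"
  have A: "A i j = A j i" "A i i = 0" and B: "B i j = B j i" "B i i = 0" for i j
    using assms(2,5) by (simp_all add: A_def B_def adjacency_sym adjacency_diag)
  interpret A: adjugate_system n A F a
    unfolding F_def a_def by (rule adjugate_system_char_poly) (rule A)+
  interpret B: adjugate_system n B K b
    unfolding K_def b_def by (rule adjugate_system_char_poly) (rule B)+
  have "image_mset (\<lambda>i. a i i) (mset_set {..<n}) = image_mset (\<lambda>i. b i i) (mset_set {..<n})"
    using assms(7) unfolding poly_deck_interval[OF assms(3)] poly_deck_interval[OF assms(6)]
    by (simp add: a_def b_def A_def B_def)
  then obtain \<pi> where \<pi>: "\<pi> permutes {..<n}" and diag: "\<And>i. i < n \<Longrightarrow> a i i = b (\<pi> i) (\<pi> i)"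
    by (rule image_mset_eq_implies_permutes[rotated]) auto
  \<comment> \<open>The second graph is relabelled so that the deleted vertices correspond. Its
      determinant and its \<open>\<Omega>\<close> do not change.\<close>
  define B' where "B' i j = B (\<pi> i) (\<pi> j)" for i j
  define b' where "b' i j = b (\<pi> i) (\<pi> j)" for i j
  interpret B': adjugate_system n B' K b'
    unfolding B'_def[abs_def] b'_def[abs_def] by (rule B.relabelled_system[OF \<pi>])
  have \<Omega>: "B'.\<Omega> = B.\<Omega>"
    unfolding b'_def[abs_def] by (rule B.relabelled_\<Omega>[OF \<pi>])
  interpret pair: system_pair n A F a B' K b'
    by unfold_locales (simp add: diag b'_def)
  have four_dvd_c: "4 dvd pair.c"
  proof (cases "even n")
    case True
    have "square_det_system n A F a"
      unfolding F_def a_def using A True by (intro square_det_system_char_poly)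
    moreover have "square_det_system n B K b"
      unfolding K_def b_def using B True by (intro square_det_system_char_poly)
    then have "square_det_system n B' K b'"
      unfolding B'_def[abs_def] b'_def[abs_def]
      by (rule square_det_system.relabelled_square_det_system) (rule \<pi>)
    ultimately have "even_pair n A F a B' K b'"
      using pair.system_pair_axioms by (simp add: even_pair_def)
    moreover have "4 \<le> n" using assms(1) True by (cases "n = 3") auto
    ultimately show ?thesis by (rule even_pair.const_coeff_cong_4)
  next
    case False
    have "odd_pair n A F a B' K b'"
      using False by (intro odd_pair.intro odd_system.intro odd_system_axioms.intro) unfold_locales
    moreover have "walk_matrix G = mat_of_cols n (map (\<lambda>k. (sqmat n A ^\<^sub>m k) *\<^sub>v vec n (\<lambda>_. 1)) [0..<n])"
      by (simp add: walk_matrix_def A_def adj_matrix_interval[OF assms(3)] assms(3))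
    moreover have "vec_space.rank n (map_mat (of_int :: int \<Rightarrow> bit) (walk_matrix G)) < Suc (n div 2)"
    proof -
      have "\<lceil>real n / 2\<rceil> = int (Suc (n div 2))"
        using False by (intro ceiling_unique) (auto elim!: oddE)
      then show ?thesis using assms(3,4) False by (simp add: walk_rank_F2_def)
    qed
    ultimately show ?thesis by (rule odd_pair.four_dvd_c_if_low_walk_rank)
  qed
  show ?thesis
  proof (intro conjI allI)
    show "[coeff (graph_char_poly G) 0 = coeff (graph_char_poly H) 0] (mod 4)"
      using four_dvd_c unfolding pair.c_def
      by (simp add: graph_char_poly_def adj_matrix_interval[OF assms(3)] adj_matrix_interval[OF assms(6)] F_def K_def A_def B_def cong_iff_dvd_diff)
    fix k
    have "graph_char_poly (graph_complement G) = (-1) ^ n * pcompose (F + A.\<Omega>) [:-1, -1:]"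
      using A.char_poly_complement[OF a_def F_def]
      by (simp only: graph_char_poly_def adj_matrix_complement[OF assms(3)] A_def)
    moreover have "graph_char_poly (graph_complement H) = (-1) ^ n * pcompose (K + B.\<Omega>) [:-1, -1:]"
      using B.char_poly_complement[OF b_def K_def]
      by (simp only: graph_char_poly_def adj_matrix_complement[OF assms(6)] B_def)
    ultimately show "[coeff (graph_char_poly (graph_complement G)) k
        = coeff (graph_char_poly (graph_complement H)) k] (mod 4)"
      using pair.complement_difference[OF four_dvd_c, of k] by (simp add: cong_iff_dvd_diff \<Omega>)
  qed
qed

end
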